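(* Let $\mathsf{X}\in\{\mathsf{A},\mathsf{B},\mathsf{D}\}$ and $n\in\mathbb{N}$, with $n\geq2$ if $\mathsf{X}=\mathsf{D}$. For all compact discrete valuation rings $\mathfrak{o}$ with residue field cardinality $q$, assumed to be odd unless $\mathsf{X}=\mathsf{A}$, $$\zeta^{\mathrm{at}}_{\mathsf{X}_n(\mathfrak{o})}\left((s_L)_{L\in\mathsf{X}_n}\right)=\frac{1}{1-q^{-n-\sum_{L\in\mathsf{X}_n}s_L}}\sum_{\tau\in\mathrm{TP}_{\mathsf{X},n}}\pi_{\mathsf{X},\tau}(-q^{-1})\cdot\mathsf{Cgp}_{\mathsf{X},\tau}\left(q^{-1},(q^{-s_L})_{L\in\mathsf{X}_n}\right),$$ where $\mathrm{TP}_{\mathsf{X},n}$ is the finite set of total partitions of type $\mathsf{X}_n$, and $\pi_{\mathsf{X},\tau}(Y)\in\mathbb{Z}[Y]$ and $\mathsf{Cgp}_{\mathsf{X},\tau}(Z,\boldsymbol{T})$ are the explicit polynomials and products of geometric progressions defined in the context.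
   Context: Notation: $[n]=\{1,\dots,n\}$, $[n]_0=\{0,\dots,n\}$, and $\mathsf{gp}(X)=X/(1-X)$. Arrangements (identified with sets of linear forms): $\mathsf{A}_n=\{X_i-X_j\mid 1\leq i<j\leq n+1\}$ in dimension $n+1$; $\mathsf{B}_n=\{X_i-\varepsilon X_j\mid 1\leq i<j\leq n,\ \varepsilon=\pm1\}\cup\{X_k\mid k\in[n]\}$ and $\mathsf{D}_n=\{X_i-\varepsilon X_j\mid 1\leq i<j\leq n,\ \varepsilon=\pm1\}$ in dimension $n$. With $d$ this dimension, the atom zeta function is $\zeta^{\mathrm{at}}_{\mathsf{X}_n(\mathfrak{o})}((s_L)_L)=\int_{\mathfrak{o}^d}\prod_{L\in\mathsf{X}_n}|L(\boldsymbol{X})|^{s_L}\,|\mathrm{d}\boldsymbol{X}|$, with $s_L$ complex variables, $|\cdot|$ the absolute value giving uniformizers absolute value $q^{-1}$, and Haar measure normalized so that $\mathfrak{o}^d$ has measure 1 (the identity is for $s_L$ of nonnegative real part, or equivalently of rational functions in the $q^{-s_L}$). Trees: For a rooted tree $\tau$ let $V(\tau)$ be its vertex set and $P(\tau)$ the set of parents (non-leaf vertices). Descendants and ancestors are proper (a vertex is not its own ancestor). A vertex is unbranched if it is a leaf or has exactly one leaf descendant. $v_\alpha$ is the leaf labeled $\alpha$, $V(\tau,\alpha)$ the set of ancestors of $v_\alpha$, and $v_\alpha^+$ the first (closest) ancestor of $v_\alpha$ with at least two children. Rooted trees are not plane (children are unordered). "Barring" an integer decorates it with a symbol; $i$ and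 $\bar{i}$ are distinct labels, compared by their underlying integers, so "minimal" refers to the underlying integers. A rooted tree $\tau$ with $n+1$ leaves is $\mathsf{A}_n$-labeled if its leaves are labeled bijectively by $[n+1]$; $\mathsf{B}_n$-labeled if its leaves are labeled bijectively by $[n]_0$, where each positive integer label may independently be barred; $\mathsf{D}_n$-labeled if it is $\mathsf{B}_n$-labeled and: if all children of $v_0^+$ are unbranched, then $v_0^+$ has at least three children. For a vertex $u$, $\mathrm{DLL}(\tau,u)$ is the set of labels of leaves that are descendants of $u$ (or the label of $u$ if $u$ is a leaf). $\tau$ is in standard form if for every $u\in V(\tau,0)$ and every child $v$ of $u$, the minimal label in $\mathrm{DLL}(\tau,v)$ is not barred (every $\mathsf{A}_n$-labeled tree is in standard form). $\mathrm{TP}_{\mathsf{X},n}$ is the set of (isomorphism classes of) $\mathsf{X}_n$-labeled rooted trees in standard form in which every parent has at least two children. Blocks: each $u\in V(\tau)$ has a block $\lambda(\tau,u)$, a set of possibly barred integers. For a leaf with label $\alpha$, $\lambda$ is the singleton of the unbarred $\alpha$. In type $\mathsf{A}$, for $u\in P(\tau)$, $\lambda(\tau,u)$ is the union of $\lambda(\tau,u')$ over children $u'$ of $u$. In types $\mathsf{B},\mathsf{D}$: to unbar a block is to remove all bars; to bar a block is to swap barred and unbarred status of all its elements. If $u\in V(\tau,0)$, $\lambda(\tau,u)$ is the union of the unbarred blocks $\lambda(\tau,u')$ over children $u'$. If $u\in P(\tau)\setminus V(\tau,0)$, $\lambda(\tau,u)$ is the union of the blocks $\lambda(\tau,u')$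 of its children, each barred if necessary, so that: (1) for the unique child $u'$ such that $\lambda(\tau,u')$ contains the minimal label in $\mathrm{DLL}(\tau,u)$ (up to bars), the block is not barred; (2) for every other child $u''$, the block is barred if necessary so that the minimal labels in $\mathrm{DLL}(\tau,u')$ and $\mathrm{DLL}(\tau,u'')$ have the same parity (both barred or both unbarred) as leaf labels if and only if the corresponding elements have the same parity in $\lambda(\tau,u)$. Polynomials: put $((n))_Y=1+nY$, $((n))_Y!=\prod_{i=1}^n((i))_Y$, $((n))_Y!!=\prod_{i=1}^n((2i-1))_Y$ (empty products are 1). Let $\mathsf{c}(\tau,u)$ be the number of children and $\mathsf{u}(\tau,u)$ the number of unbranched children of $u$. Define $$\pi_{\mathsf{A},\tau}(Y)=\prod_{u\in P(\tau)}((\mathsf{c}(\tau,u)-1))_Y!,$$ $$\pi_{\mathsf{B},\tau}(Y)=\prod_{u\in V(\tau,0)}((\mathsf{c}(\tau,u)-1))_Y!!\ \prod_{u\in P(\tau)\setminus V(\tau,0)}((\mathsf{c}(\tau,u)-1))_Y!,$$ $$\pi_{\mathsf{D},\tau}(Y)=\pi_{\mathsf{B},\tau}(Y)\cdot\frac{((2c_0-u_0-2))_Y\ ((c_0-2))_Y!!}{((c_0-1))_Y!!},\quad c_0=\mathsf{c}(\tau,v_0^+),\ u_0=\mathsf{u}(\tau,v_0^+).$$ Geometric progressions: a two-element set $J$ of possibly barred integers in $[n+1]$ (type $\mathsf{A}$, no bars) or $[n]_0$ (types $\mathsf{B},\mathsf{D}$) determines a form: for $1\leq i<j$, $J=\{i,j\}$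 or $\{\bar i,\bar j\}$ gives $X_i-X_j$; $J=\{i,\bar j\}$ or $\{\bar i,j\}$ gives $X_i+X_j$; $J=\{0,k\}$ gives $X_k$. Write $T_J$ for $T_L$ with $L$ this form. $\mathcal{P}(I;2)$ is the set of two-element subsets of $I$. For a set $I\subseteq\mathbb{N}_0$, $\mathcal{P}_{\mathsf{B}}(I;2)$ consists of all $\{0,k\}$ (if $0\in I$), $\{i,j\}$ and $\{i,\bar j\}$ with $k\in I\setminus\{0\}$ and $i<j$ in $I\setminus\{0\}$; $\mathcal{P}_{\mathsf{D}}(I;2)$ is obtained by omitting all $\{0,k\}$. Let $V_\circ(\tau)=P(\tau)\setminus\{\text{root}\}$ and $V_\circ(\tau,0)=V(\tau,0)\setminus\{\text{root}\}$ (empty in type $\mathsf{A}$). Then $$\mathsf{Cgp}_{\mathsf{X},\tau}(Z,\boldsymbol{T})=\prod_{u\in V_\circ(\tau)\setminus V_\circ(\tau,0)}\mathsf{gp}\Big(Z^{|\lambda(\tau,u)|-1}\prod_{J\in\mathcal{P}(\lambda(\tau,u);2)}T_J\Big)\cdot\prod_{u\in V_\circ(\tau,0)}\mathsf{gp}\Big(Z^{|\lambda(\tau,u)|-1}\prod_{J\in\mathcal{P}_{\mathsf{X}}(\lambda(\tau,u);2)}T_J\Big).$$ *)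

theory Defs
  imports
    "HOL-Analysis.Analysis"
    "HOL-Library.Multiset"
    "HOL-Computational_Algebra.Polynomial"
begin

section \<open>Compact discrete valuation rings\<close>

context comm_ring_1
begin

definition is_ideal :: "'a set \<Rightarrow> bool" where
  "is_ideal I \<longleftrightarrow> 0 \<in> I \<and> (\<forall>x\<in>I. \<forall>y\<in>I. x + y \<in> I) \<and> (\<forall>c. \<forall>x\<in>I. c * x \<in> I)"

definition is_maximal_ideal :: "'a set \<Rightarrow> bool" where
  "is_maximal_ideal M \<longleftrightarrow> is_ideal M \<and> M \<noteq> UNIV \<and>
     (\<forall>J. is_ideal J \<and> M \<subseteq> J \<longrightarrow> J = M \<or> J = UNIV)"

end

class dvr = idom +
  assumes ideal_principal: "is_ideal I \<Longrightarrow> \<exists>a. I = range ((*) a)"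
    and ex1_maximal_ideal: "\<exists>!M. is_maximal_ideal M"
    and not_field: "\<exists>x. x \<noteq> 0 \<and> \<not> x dvd 1"

definition (in dvr) max_ideal :: "'a set" where
  "max_ideal = (THE M. is_maximal_ideal M)"

definition (in dvr) uniformizer :: "'a \<Rightarrow> bool" where
  "uniformizer \<pi> \<longleftrightarrow> max_ideal = range ((*) \<pi>)"

definition residue_card :: "'a::dvr itself \<Rightarrow> nat" where
  "residue_card _ = card ((UNIV :: 'a set) // {(x, y). x - y \<in> max_ideal})"

definition valuation :: "'a::dvr \<Rightarrow> nat" where
  "valuation x = (THE k. \<exists>u \<pi>. u dvd 1 \<and> uniformizer \<pi> \<and> x = u * \<pi> ^ k)"

definition dvr_abs :: "'a::dvr \<Rightarrow> real" where
  "dvr_abs x = (if x = 0 then 0 else inverse (real (residue_card TYPE('a)) ^ valuation x))"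

text \<open>Compactness refers to the adic topology of the maximal ideal.\<close>

class compact_dvr = dvr + topological_space +
  assumes open_adic:
      "uniformizer \<pi> \<Longrightarrow> open U \<longleftrightarrow> (\<forall>x\<in>U. \<exists>k. {y. \<pi> ^ k dvd y - x} \<subseteq> U)"
    and compact_UNIV: "compact UNIV"

definition normalized_haar :: "'a::compact_dvr measure \<Rightarrow> bool" where
  "normalized_haar \<mu> \<longleftrightarrow> sets \<mu> = sets borel \<and> emeasure \<mu> UNIV = 1 \<and>
     (\<forall>a. \<forall>S\<in>sets \<mu>. emeasure \<mu> ((+) a ` S) = emeasure \<mu> S)"


section \<open>Arrangements and their atom zeta functions\<close>

text \<open>A linear form is represented by its integer coefficients.\<close>

type_synonym linform = "nat \<Rightarrow> int"

definition coord_form :: "nat \<Rightarrow> linform" where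
  "coord_form i = (\<lambda>k. if k = i then 1 else 0)"

definition pair_form :: "int \<Rightarrow> nat \<Rightarrow> nat \<Rightarrow> linform" where
  "pair_form \<epsilon> i j = (\<lambda>k. coord_form i k - \<epsilon> * coord_form j k)"

datatype arr_type = TypeA | TypeB | TypeD

fun arr_dim :: "arr_type \<Rightarrow> nat \<Rightarrow> nat" where
  "arr_dim TypeA n = n + 1"
| "arr_dim TypeB n = n"
| "arr_dim TypeD n = n"

fun arrangement :: "arr_type \<Rightarrow> nat \<Rightarrow> linform set" where
  "arrangement TypeA n = {pair_form 1 i j |i j. 1 \<le> i \<and> i < j \<and> j \<le> n + 1}"
| "arrangement TypeB n = {pair_form \<epsilon> i j |\<epsilon> i j. 1 \<le> i \<and> i < j \<and> j \<le> n \<and> \<epsilon> \<in> {1, -1}} \<union>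
     coord_form ` {1..n}"
| "arrangement TypeD n = {pair_form \<epsilon> i j |\<epsilon> i j. 1 \<le> i \<and> i < j \<and> j \<le> n \<and> \<epsilon> \<in> {1, -1}}"

definition eval_form :: "nat \<Rightarrow> linform \<Rightarrow> (nat \<Rightarrow> 'a::comm_ring_1) \<Rightarrow> 'a" where
  "eval_form d L x = (\<Sum>i\<in>{1..d}. of_int (L i) * x i)"

text \<open>
  Since the topology is second countable, the product \<sigma>-algebra is the Borel \<sigma>-algebra and the
  product measure is the normalized Haar measure of the free module of rank \<^term>\<open>arr_dim X n\<close>.
  The convention \<open>0 powr z = 0\<close>, even for \<open>z = 0\<close>, only affects the null set on which some form
  vanishes.
\<close>

definition atom_zeta ::
  "'a::compact_dvr measure \<Rightarrow> arr_type \<Rightarrow> nat \<Rightarrow> (linform \<Rightarrow> complex) \<Rightarrow> complex" where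
  "atom_zeta \<mu> X n s =
     (\<integral>x. (\<Prod>L\<in>arrangement X n. complex_of_real (dvr_abs (eval_form (arr_dim X n) L x)) powr s L)
        \<partial>(\<Pi>\<^sub>M i\<in>{1..arr_dim X n}. \<mu>))"


section \<open>Labelled rooted trees\<close>

text \<open>
  The children of a vertex form a multiset, so equality of trees is isomorphism of leaf-labelled
  rooted trees. A vertex is identified with the subtree rooted at it. This is faithful whenever
  different leaves carry different labels and every \<open>Node\<close> has children: two subtrees
  at different positions then have different sets of leaf labels, or one is a proper subtree of
  the other.
\<close>

datatype 'l rtree = is_Leaf: Leaf 'l | Node "'l rtree multiset"

primrec leaf_labels :: "'l rtree \<Rightarrow> 'l multiset" where
  "leaf_labels (Leaf l) = {#l#}"
| "leaf_labels (Node ts) = \<Sum>\<^sub># (image_mset leaf_labels ts)"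

primrec vertices :: "'l rtree \<Rightarrow> 'l rtree set" where
  "vertices (Leaf l) = {Leaf l}"
| "vertices (Node ts) = insert (Node ts) (\<Union> (set_mset (image_mset vertices ts)))"

primrec children :: "'l rtree \<Rightarrow> 'l rtree multiset" where
  "children (Leaf l) = {#}"
| "children (Node ts) = ts"

definition parents :: "'l rtree \<Rightarrow> 'l rtree set" where
  "parents t = {u \<in> vertices t. children u \<noteq> {#}}"

definition descendants :: "'l rtree \<Rightarrow> 'l rtree set" where
  "descendants u = vertices u - {u}"

definition ancestors :: "'l rtree \<Rightarrow> 'l rtree \<Rightarrow> 'l rtree set" where
  "ancestors t v = {u \<in> vertices t. v \<in> descendants u}"

definition unbranched :: "'l rtree \<Rightarrow> bool" where
  "unbranched u \<longleftrightarrow> is_Leaf u \<or> card {v \<in> descendants u. is_Leaf v} = 1"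

definition num_children :: "'l rtree \<Rightarrow> nat" where
  "num_children u = size (children u)"

definition num_unbranched :: "'l rtree \<Rightarrow> nat" where
  "num_unbranched u = size (filter_mset unbranched (children u))"

definition first_branching :: "'l rtree \<Rightarrow> 'l rtree \<Rightarrow> 'l rtree" where
  "first_branching t v = (THE u. u \<in> ancestors t v \<and> 2 \<le> num_children u \<and>
     (\<forall>w\<in>ancestors t v. 2 \<le> num_children w \<longrightarrow> w = u \<or> w \<in> ancestors t u))"

datatype blabel = Label (num: nat) (barred: bool)

abbreviation zero_leaf :: "blabel rtree" where
  "zero_leaf \<equiv> Leaf (Label 0 False)"

text \<open>A childless \<open>Node\<close> would be a leaf without a label; it is excluded here.\<close>

definition labelled_by :: "nat set \<Rightarrow> blabel rtree \<Rightarrow> bool" where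
  "labelled_by N t \<longleftrightarrow> Node {#} \<notin> vertices t \<and> image_mset num (leaf_labels t) = mset_set N"

definition B_labelled :: "nat \<Rightarrow> blabel rtree \<Rightarrow> bool" where
  "B_labelled n t \<longleftrightarrow> labelled_by {0..n} t \<and> (\<forall>l\<in>#leaf_labels t. num l = 0 \<longrightarrow> \<not> barred l)"

fun labelled :: "arr_type \<Rightarrow> nat \<Rightarrow> blabel rtree \<Rightarrow> bool" where
  "labelled TypeA n t \<longleftrightarrow> labelled_by {1..n + 1} t \<and> (\<forall>l\<in>#leaf_labels t. \<not> barred l)"
| "labelled TypeB n t \<longleftrightarrow> B_labelled n t"
| "labelled TypeD n t \<longleftrightarrow> B_labelled n t \<and>
     (let v = first_branching t zero_leaf
      in (\<forall>u\<in>#children v. unbranched u) \<longrightarrow> 3 \<le> num_children v)"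

definition min_label :: "blabel rtree \<Rightarrow> blabel" where
  "min_label u = (ARG_MIN num l. l \<in># leaf_labels u)"

definition standard_form :: "blabel rtree \<Rightarrow> bool" where
  "standard_form t \<longleftrightarrow>
     (\<forall>u\<in>ancestors t zero_leaf. \<forall>v\<in>#children u. \<not> barred (min_label v))"

definition total_partitions :: "arr_type \<Rightarrow> nat \<Rightarrow> blabel rtree set" where
  "total_partitions X n =
     {t. labelled X n t \<and> standard_form t \<and> (\<forall>u\<in>parents t. 2 \<le> num_children u)}"


section \<open>Blocks\<close>

definition unbar_block :: "blabel set \<Rightarrow> blabel set" where
  "unbar_block S = (\<lambda>l. Label (num l) False) ` S"

definition bar_block :: "blabel set \<Rightarrow> blabel set" where
  "bar_block S = (\<lambda>l. Label (num l) (\<not> barred l)) ` S"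

text \<open>
  The set \<open>P\<close> consists of the pairs of minimal label and block of the children of a
  vertex whose minimal label is \<open>m\<close>. The condition always holds for the distinguished
  child \<open>(m', S')\<close>, so its block is never barred.
\<close>

definition join_blocks :: "blabel \<Rightarrow> (blabel \<times> blabel set) set \<Rightarrow> blabel set" where
  "join_blocks m P = (let (m', S') = (THE p. p \<in> P \<and> num m \<in> num ` snd p) in
     \<Union>(m'', S'')\<in>P.
       if (barred m' = barred m'') = ((Label (num m') True \<in> S') = (Label (num m'') True \<in> S''))
       then S'' else bar_block S'')"

lemma size_child: "v \<in># us \<Longrightarrow> size v < size (Node us)"
proof -
  assume "v \<in># us"
  then obtain vs where "us = add_mset v vs" by (meson mset_add)
  then show ?thesis by simp
qed

function (sequential) block ::
  "arr_type \<Rightarrow> blabel rtree \<Rightarrow> blabel rtree \<Rightarrow> blabel set" where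
  "block X t (Leaf l) = {Label (num l) False}"
| "block X t (Node us) =
     (if X = TypeA then (\<Union>v\<in>set_mset us. block X t v)
      else if Node us \<in> ancestors t zero_leaf
      then (\<Union>v\<in>set_mset us. unbar_block (block X t v))
      else join_blocks (min_label (Node us))
             ((\<lambda>v. (min_label v, block X t v)) ` set_mset us))"
  by pat_completeness auto
termination
  by (relation "Wellfounded.measure (\<lambda>(X, t, u). size u)") (auto simp: size_child[simplified])


section \<open>Polynomials\<close>

text \<open>
  The quotient in type D is taken in the ring of integer polynomials, where it is exact (see
  \<open>pi_D_exact\<close> below). Dividing values would be wrong: \<^term>\<open>qdfact 2\<close>
  vanishes at \<open>- 1 / 3\<close>.
\<close>

definition qnum :: "nat \<Rightarrow> int poly" where
  "qnum n = [:1, int n:]"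

definition qfact :: "nat \<Rightarrow> int poly" where
  "qfact n = (\<Prod>i\<in>{1..n}. qnum i)"

definition qdfact :: "nat \<Rightarrow> int poly" where
  "qdfact n = (\<Prod>i\<in>{1..n}. qnum (2 * i - 1))"

definition pi_A :: "blabel rtree \<Rightarrow> int poly" where
  "pi_A t = (\<Prod>u\<in>parents t. qfact (num_children u - 1))"

definition pi_B :: "blabel rtree \<Rightarrow> int poly" where
  "pi_B t = (\<Prod>u\<in>ancestors t zero_leaf. qdfact (num_children u - 1)) *
     (\<Prod>u\<in>parents t - ancestors t zero_leaf. qfact (num_children u - 1))"

definition pi_D :: "blabel rtree \<Rightarrow> int poly" where
  "pi_D t = (let v = first_branching t zero_leaf; c = num_children v; u = num_unbranched v in
     (pi_B t * (qnum (2 * c - u - 2) * qdfact (c - 2))) div qdfact (c - 1))"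

fun tree_poly :: "arr_type \<Rightarrow> blabel rtree \<Rightarrow> int poly" where
  "tree_poly TypeA t = pi_A t"
| "tree_poly TypeB t = pi_B t"
| "tree_poly TypeD t = pi_D t"


section \<open>Products of geometric progressions\<close>

definition gp :: "'a::field \<Rightarrow> 'a" where
  "gp x = x / (1 - x)"

inductive determines_form :: "blabel set \<Rightarrow> linform \<Rightarrow> bool" where
  "1 \<le> i \<Longrightarrow> i < j \<Longrightarrow> determines_form {Label i b, Label j b} (pair_form 1 i j)"
| "1 \<le> i \<Longrightarrow> i < j \<Longrightarrow> determines_form {Label i b, Label j (\<not> b)} (pair_form (-1) i j)"
| "1 \<le> k \<Longrightarrow> determines_form {Label 0 False, Label k False} (coord_form k)"

definition form_of :: "blabel set \<Rightarrow> linform" where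
  "form_of J = (THE L. determines_form J L)"

definition pairs :: "blabel set \<Rightarrow> blabel set set" where
  "pairs S = {J. J \<subseteq> S \<and> card J = 2}"

definition pairs_D :: "nat set \<Rightarrow> blabel set set" where
  "pairs_D I = {{Label i False, Label j b} |i j b. i \<in> I - {0} \<and> j \<in> I - {0} \<and> i < j}"

definition pairs_B :: "nat set \<Rightarrow> blabel set set" where
  "pairs_B I = {{Label 0 False, Label k False} |k. 0 \<in> I \<and> k \<in> I - {0}} \<union> pairs_D I"

text \<open>The value in type A is irrelevant, as no tree of that type has a leaf labelled 0.\<close>

definition pairs_of_type :: "arr_type \<Rightarrow> nat set \<Rightarrow> blabel set set" where
  "pairs_of_type X I = (if X = TypeD then pairs_D I else pairs_B I)"

definition cgp ::
  "arr_type \<Rightarrow> blabel rtree \<Rightarrow> 'a::field \<Rightarrow> (linform \<Rightarrow> 'a) \<Rightarrow> 'a" where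
  "cgp X t Z T =
     (\<Prod>u\<in>(parents t - {t}) - (ancestors t zero_leaf - {t}).
        gp (Z ^ (card (block X t u) - 1) * (\<Prod>J\<in>pairs (block X t u). T (form_of J)))) *
     (\<Prod>u\<in>ancestors t zero_leaf - {t}.
        gp (Z ^ (card (block X t u) - 1) *
          (\<Prod>J\<in>pairs_of_type X (num ` block X t u). T (form_of J))))"


section \<open>Finiteness of the index set and integrality of the type D polynomials\<close>

lemma finite_vertices: "finite (vertices t)"
  by (induction t) auto

lemma vertices_self: "t \<in> vertices t"
  by (cases t) auto

lemma size_vertex_le: "u \<in> vertices t \<Longrightarrow> size u \<le> size t"
proof (induction t)
  case (Node ts)
  then show ?case using size_child by (fastforce intro: less_imp_le order.trans)
qed auto

lemma label_iff_vertex: "l \<in># leaf_labels t \<longleftrightarrow> Leaf l \<in> vertices t"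
  by (induction t) auto

lemma vertices_trans: "u \<in> vertices t \<Longrightarrow> w \<in> vertices u \<Longrightarrow> w \<in> vertices t"
  by (induction t) auto

lemma ancestor_size: "u \<in> ancestors t w \<Longrightarrow> size w < size u"
proof -
  assume "u \<in> ancestors t w"
  then have w: "w \<in> vertices u" "w \<noteq> u" by (auto simp: ancestors_def descendants_def)
  show ?thesis
  proof (cases u)
    case (Node ts)
    then obtain v where v: "v \<in># ts" "w \<in> vertices v" using w by auto
    then show ?thesis using size_vertex_le[of w v] size_child[of v ts] Node by simp
  qed (use w in auto)
qed

lemma vertices_chain:
  assumes "count (leaf_labels t) l = 1" "u \<in> vertices t" "w \<in> vertices t"
    "Leaf l \<in> vertices u" "Leaf l \<in> vertices w"
  shows "u \<in> vertices w \<or> w \<in> vertices u"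
  using assms
proof (induction t)
  case (Node ts)
  show ?case
  proof (cases "u = Node ts \<or> w = Node ts")
    case False
    then obtain a b where ab: "a \<in># ts" "u \<in> vertices a" "b \<in># ts" "w \<in> vertices b"
      using Node.prems by auto
    have la: "l \<in># leaf_labels a" "l \<in># leaf_labels b"
      using ab Node.prems(4,5) vertices_trans label_iff_vertex by metis+
    obtain us where us: "ts = add_mset a us" using ab(1) by (meson mset_add)
    have "count (leaf_labels (Node ts)) l = count (leaf_labels a) l + count (\<Sum>\<^sub># (image_mset leaf_labels us)) l"
      using us by simp
    moreover have "count (leaf_labels a) l \<ge> 1" using la by (simp add: Suc_le_eq)
    ultimately have c: "count (leaf_labels a) l = 1"
        "count (\<Sum>\<^sub># (image_mset leaf_labels us)) l = 0"
      using Node.prems(1) by linarith+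
    then have 1: "count (leaf_labels a) l = 1" "l \<notin># \<Sum>\<^sub># (image_mset leaf_labels us)"
      by (simp_all only: not_in_iff)
    have "a = b"
    proof (rule ccontr)
      assume "a \<noteq> b"
      then have "b \<in># us" using ab us by auto
      then show False using 1 la by auto
    qed
    then show ?thesis using Node.IH[OF ab(1) 1(1) ab(2) _ Node.prems(4,5)] ab(4) by simp
  next
    case True
    then show ?thesis using Node.prems(2,3) by metis
  qed
qed simp

lemma first_branching_ancestor:
  assumes "count (leaf_labels t) l = 1" "t \<noteq> Leaf l" "\<forall>u\<in>parents t. 2 \<le> num_children u"
  shows "first_branching t (Leaf l) \<in> ancestors t (Leaf l)"
    and "2 \<le> num_children (first_branching t (Leaf l))"
proof -
  let ?A = "ancestors t (Leaf l)"
  have A: "2 \<le> num_children u" if "u \<in> ?A" for u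
  proof -
    have "children u \<noteq> {#}" using that
      by (cases u) (auto simp: ancestors_def descendants_def)
    then show ?thesis using assms(3) that by (auto simp: ancestors_def parents_def)
  qed
  have "l \<in># leaf_labels t" using assms(1) by (simp add: count_inI)
  then have "t \<in> ?A" using assms(2) vertices_self
    by (auto simp: ancestors_def descendants_def label_iff_vertex)
  then obtain u where u: "u \<in> ?A" "\<And>w. w \<in> ?A \<Longrightarrow> size u \<le> size w"
    using ex_has_least_nat[of "\<lambda>u. u \<in> ?A" t size] by blast
  have cl: "w = u \<or> w \<in> ancestors t u" if w: "w \<in> ?A" for w
  proof (rule ccontr)
    assume n: "\<not> ?thesis"
    have "u \<in> vertices w \<or> w \<in> vertices u"
      using vertices_chain[OF assms(1), of u w] u(1) w by (auto simp: ancestors_def descendants_def)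
    then have "u \<in> ancestors t w"
      using n w u(1) by (auto simp: ancestors_def descendants_def)
    then show False using u(2)[OF w] ancestor_size by fastforce
  qed
  let ?P = "\<lambda>u. u \<in> ?A \<and> 2 \<le> num_children u \<and>
     (\<forall>w\<in>?A. 2 \<le> num_children w \<longrightarrow> w = u \<or> w \<in> ancestors t u)"
  have "?P (first_branching t (Leaf l))"
    unfolding first_branching_def
  proof (rule theI[of ?P u])
    show "?P u" using u A cl by auto
    show "x = u" if "?P x" for x
      using that u(1) A[OF u(1)] cl[of x] ancestor_size[of x t u] ancestor_size[of u t x] by fastforce
  qed
  then show "first_branching t (Leaf l) \<in> ?A" "2 \<le> num_children (first_branching t (Leaf l))" by auto
qed

lemma leaf_count_pos:
  assumes "\<forall>u\<in>parents t. 2 \<le> num_children u" "Node {#} \<notin> vertices t"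
  shows "leaf_labels t \<noteq> {#}"
  using assms
proof (induction t)
  case (Node ts)
  then obtain v us where v: "ts = add_mset v us" by (cases ts) auto
  then have "leaf_labels v \<noteq> {#}" using Node by (auto simp: parents_def)
  then show ?case using v by auto
qed auto

lemma finite_trees:
  assumes "finite L"
  shows "finite {t. set_mset (leaf_labels t) \<subseteq> L \<and> size (leaf_labels t) \<le> k \<and>
    Node {#} \<notin> vertices t \<and> (\<forall>u\<in>parents t. 2 \<le> num_children u)}"
proof -
  define good where "good t \<longleftrightarrow> set_mset (leaf_labels t) \<subseteq> L \<and> Node {#} \<notin> vertices t \<and>
    (\<forall>u\<in>parents t. 2 \<le> num_children u)" for t
  define T where "T k = {t. good t \<and> size (leaf_labels t) \<le> k}" for k
  have good_ne: "leaf_labels t \<noteq> {#}" if "good t" for t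
    using that leaf_count_pos unfolding good_def by blast
  have good_child: "good v" if "good (Node ts)" "v \<in># ts" for v ts
  proof -
    have "set_mset (leaf_labels v) \<subseteq> set_mset (leaf_labels (Node ts))"
      "vertices v \<subseteq> vertices (Node ts)" "parents v \<subseteq> parents (Node ts)"
      using that(2) by (auto simp: parents_def)
    then show ?thesis using that(1) unfolding good_def by blast
  qed
  have size_le: "size us \<le> size (\<Sum>\<^sub># (image_mset leaf_labels us))"
    if "\<And>v. v \<in># us \<Longrightarrow> good v" for us
    using that
  proof (induction us)
    case (add x us)
    have "1 \<le> size (leaf_labels x)"
      using good_ne[of x] add.prems[of x] by (simp add: Suc_le_eq nonempty_has_size)
    moreover have "size us \<le> size (\<Sum>\<^sub># (image_mset leaf_labels us))"
      using add.IH add.prems by simp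
    ultimately show ?case by simp
  qed simp
  have "finite (T k)" for k
  proof (induction k)
    case 0
    have "T 0 = {}" using good_ne by (auto simp: T_def)
    then show ?case by simp
  next
    case (Suc k)
    have "T (Suc k) \<subseteq> Leaf ` L \<union> Node ` (\<Union>j\<le>Suc k. multisets_of_size (T k) j)"
    proof
      fix t assume t: "t \<in> T (Suc k)"
      show "t \<in> Leaf ` L \<union> Node ` (\<Union>j\<le>Suc k. multisets_of_size (T k) j)"
      proof (cases t)
        case (Leaf l)
        then show ?thesis using t by (auto simp: T_def good_def)
      next
        case (Node ts)
        have g: "good (Node ts)" "size (\<Sum>\<^sub># (image_mset leaf_labels ts)) \<le> Suc k"
          using t Node by (auto simp: T_def)
        have gc: "\<And>v. v \<in># ts \<Longrightarrow> good v" using good_child[OF g(1)] .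
        have "Node ts \<in> parents (Node ts)" using g(1) by (auto simp: parents_def good_def)
        then have two: "2 \<le> size ts" using g(1) by (auto simp: good_def num_children_def)
        have "v \<in> T k" if v: "v \<in># ts" for v
        proof -
          obtain us where us: "ts = add_mset v us" using v by (meson mset_add)
          have "size us \<le> size (\<Sum>\<^sub># (image_mset leaf_labels us))"
            using size_le[of us] gc us by simp
          then have "size (leaf_labels v) \<le> k" using g(2) two us by simp
          then show ?thesis using gc[OF v] by (simp add: T_def)
        qed
        moreover have "size ts \<le> Suc k" using size_le[of ts] gc g(2) by simp
        ultimately have "ts \<in> (\<Union>j\<le>Suc k. multisets_of_size (T k) j)"
          by (auto simp: multisets_of_size_def)
        then show ?thesis using Node by blast
      qed
    qed
    moreover have "finite (Leaf ` L \<union> Node ` (\<Union>j\<le>Suc k. multisets_of_size (T k) j))"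
      using Suc assms by (intro finite_UnI finite_imageI finite_UN_I finite_multisets_of_size) auto
    ultimately show ?case by (rule finite_subset)
  qed
  then have "finite (T k)" .
  moreover have "T k = {t. set_mset (leaf_labels t) \<subseteq> L \<and> size (leaf_labels t) \<le> k \<and>
    Node {#} \<notin> vertices t \<and> (\<forall>u\<in>parents t. 2 \<le> num_children u)}"
    unfolding T_def good_def by blast
  ultimately show ?thesis by (simp only:)
qed

lemma finite_total_partitions: "finite (total_partitions X n)"
proof -
  define N where "N = {0..n + 1}"
  define L where "L = (\<lambda>(i, b). Label i b) ` (N \<times> UNIV)"
  have N: "labelled_by M t \<Longrightarrow> M \<subseteq> N \<Longrightarrow>
      set_mset (leaf_labels t) \<subseteq> L \<and> size (leaf_labels t) \<le> n + 2 \<and> Node {#} \<notin> vertices t" for M t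
  proof -
    assume t: "labelled_by M t" and M: "M \<subseteq> N"
    have f: "finite M" using M by (simp add: N_def finite_subset)
    have "size (leaf_labels t) = size (mset_set M)"
      using t unfolding labelled_by_def by (metis size_image_mset)
    also have "\<dots> \<le> n + 2" using card_mono[OF _ M] by (simp add: N_def)
    finally have 1: "size (leaf_labels t) \<le> n + 2" .
    have "num ` set_mset (leaf_labels t) = M"
      using t f unfolding labelled_by_def by (metis finite_set_mset_mset_set set_image_mset)
    then have num: "num l \<in> N" if "l \<in># leaf_labels t" for l using that M by blast
    have "l \<in> L" if "l \<in># leaf_labels t" for l
      unfolding L_def using num[OF that] by (intro image_eqI[of _ _ "(num l, barred l)"]) auto
    then have "set_mset (leaf_labels t) \<subseteq> L" by blast
    then show ?thesis using 1 t by (simp add: labelled_by_def)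
  qed
  have "total_partitions X n \<subseteq> {t. set_mset (leaf_labels t) \<subseteq> L \<and> size (leaf_labels t) \<le> n + 2 \<and>
      Node {#} \<notin> vertices t \<and> (\<forall>u\<in>parents t. 2 \<le> num_children u)}"
  proof
    fix t assume t: "t \<in> total_partitions X n"
    then have "labelled_by {1..n + 1} t \<or> labelled_by {0..n} t"
      by (cases X) (auto simp: total_partitions_def B_labelled_def)
    then show "t \<in> {t. set_mset (leaf_labels t) \<subseteq> L \<and> size (leaf_labels t) \<le> n + 2 \<and>
      Node {#} \<notin> vertices t \<and> (\<forall>u\<in>parents t. 2 \<le> num_children u)}"
      using t N[of "{1..n + 1}" t] N[of "{0..n}" t] by (auto simp: total_partitions_def N_def)
  qed
  moreover have "finite L" by (simp add: L_def N_def)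
  note finite_trees[OF this, of "n + 2"]
  ultimately show ?thesis by (rule finite_subset)
qed

lemma pi_D_exact:
  assumes "t \<in> total_partitions TypeD n" "1 \<le> n"
  defines "v \<equiv> first_branching t zero_leaf"
  shows "pi_D t * qdfact (num_children v - 1) =
    pi_B t * (qnum (2 * num_children v - num_unbranched v - 2) * qdfact (num_children v - 2))"
proof -
  have "labelled TypeD n t" and deg: "\<forall>u\<in>parents t. 2 \<le> num_children u"
    using assms(1) unfolding total_partitions_def by blast+
  then have "B_labelled n t" by simp
  then have lab: "image_mset num (leaf_labels t) = mset_set {0..n}"
    and bar: "\<And>l. l \<in># leaf_labels t \<Longrightarrow> num l = 0 \<Longrightarrow> \<not> barred l"
    unfolding B_labelled_def labelled_by_def by blast+
  have "count (image_mset num (leaf_labels t)) 0 = 1" by (simp add: lab)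
  then have "(\<Sum>l | l \<in># leaf_labels t \<and> 0 = num l. count (leaf_labels t) l) = 1"
    by (simp add: count_image_mset')
  moreover have "l = Label 0 False" if "l \<in># leaf_labels t" "0 = num l" for l
    using bar[OF that(1)] that(2) by (cases l) auto
  then have "{l. l \<in># leaf_labels t \<and> 0 = num l} = {} \<or>
      {l. l \<in># leaf_labels t \<and> 0 = num l} = {Label 0 False}" by blast
  ultimately have cnt: "count (leaf_labels t) (Label 0 False) = 1"
    by (elim disjE) (simp_all only: sum.empty zero_neq_one sum.insert finite.emptyI empty_iff
        not_False_eq_True add_0_right)
  have "t \<noteq> zero_leaf"
  proof
    assume "t = zero_leaf"
    then have "size (mset_set {0..n}) = 1" using lab by (metis leaf_labels.simps(1) size_image_mset size_single)
    then show False using assms(2) by simp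
  qed
  then have v: "v \<in> ancestors t zero_leaf"
    unfolding v_def using first_branching_ancestor(1)[OF cnt _ deg] by blast
  have "finite (ancestors t zero_leaf)" by (simp add: ancestors_def finite_vertices)
  then have "qdfact (num_children v - 1) dvd pi_B t"
    unfolding pi_B_def using v by (intro dvd_mult2 dvd_prodI)
  then show ?thesis by (simp add: pi_D_def Let_def v_def)
qed

end

theory Submission
  imports Defs
begin

text \<open>
  The Haar measure is self-similar: splitting every coordinate into its residue modulo the uniformizer
  and the rest expresses a zeta integral through the integrals over the residue classes of the free
  module. The residues of a point induce a partition of the index set, into classes of congruent
  coordinates in type A and of coordinates congruent up to sign in types B and D, where 0 is adjoined
  as a further coordinate. Forms involving different classes are units, forms within a class are
  divisible by the uniformizer, and the integral over a residue class factors over the classes. The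
  number of residue vectors with a given partition is the value of the polynomial attached to a
  vertex. Moving the summand of the trivial partition to the other side gives a recursion, which is
  also the recursion obtained by removing the root of a total partition. In type D, a class
  \<open>{0, k}\<close> supports no form, so that it has to be merged with the pair of classes \<open>{0}\<close>
  and \<open>{k}\<close>; this explains the correction factor of the polynomials of type D.
\<close>

section \<open>Discrete valuation rings\<close>

text \<open>A class that avoids 0 looks like type A after changing the signs of some variables. The
  type A recursion is therefore proved for every sign pattern \<open>\<sigma>\<close>; types B and D
  sum over patterns up to a global flip, which are the choices of bars allowed by standard form. In
  a class avoiding 0 the common digit is counted by the polynomial, so one factor \<open>q\<close>
  per class is freed and the exponent is one less than the number of labels; in a class with 0 the
  label 0 is no coordinate, which gives the same exponent. In type D a class \<open>{0, k}\<close>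
  has weight \<open>1 / q\<close>, while no total partition has a vertex with these labels. A
  partition with the class \<open>{0}\<close> makes up for one such class for each of its further
  singletons, which is where the number of unbranched children enters. Blocks, standard form, the
  closest branching ancestor of the leaf 0 and the polynomials refer to the whole tree; each is
  first expressed by data of a single vertex, since only then do the sums over trees split over the
  children of the root.\<close>

lemma maximal_ideal_exists:
  fixes I :: "'a::comm_ring_1 set"
  assumes "is_ideal I" "1 \<notin> I"
  shows "\<exists>M. is_maximal_ideal M \<and> I \<subseteq> M"
proof -
  let ?A = "{J. is_ideal J \<and> I \<subseteq> J \<and> (1::'a) \<notin> J}"
  have top: "J = UNIV" if "is_ideal J" "1 \<in> J" for J :: "'a set"
  proof -
    have "z * 1 \<in> J" for z using that unfolding is_ideal_def by blast
    then show ?thesis by auto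
  qed
  have "\<exists>M\<in>?A. \<forall>J\<in>?A. M \<subseteq> J \<longrightarrow> J = M"
  proof (rule subset_Zorn_nonempty)
    show "?A \<noteq> {}" using assms by blast
    fix \<C> assume ne: "\<C> \<noteq> {}" and ch: "subset.chain ?A \<C>"
    have el: "is_ideal J" "I \<subseteq> J" "1 \<notin> J" if "J \<in> \<C>" for J
      using ch that unfolding subset.chain_def by blast+
    have "is_ideal (\<Union>\<C>)"
      unfolding is_ideal_def
    proof (intro conjI ballI allI)
      show "0 \<in> \<Union>\<C>" using ne el by (auto simp: is_ideal_def)
      fix x assume x: "x \<in> \<Union>\<C>"
      show "c * x \<in> \<Union>\<C>" for c using x el unfolding is_ideal_def by blast
      fix y assume y: "y \<in> \<Union>\<C>"
      from x y obtain J K where JK: "J \<in> \<C>" "K \<in> \<C>" "x \<in> J" "y \<in> K" by blast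
      then have "J \<subseteq> K \<or> K \<subseteq> J" using ch unfolding subset.chain_def by blast
      then show "x + y \<in> \<Union>\<C>" using JK el unfolding is_ideal_def by blast
    qed
    moreover have "I \<subseteq> \<Union>\<C>" "1 \<notin> \<Union>\<C>" using ne el by blast+
    ultimately show "\<Union>\<C> \<in> ?A" by blast
  qed
  then obtain M where "M \<in> ?A" and max: "\<forall>J\<in>?A. M \<subseteq> J \<longrightarrow> J = M" by (rule bexE)
  then have M: "is_ideal M" "I \<subseteq> M" "1 \<notin> M" by simp_all
  have max': "J = M \<or> J = UNIV" if J: "is_ideal J" "M \<subseteq> J" for J
  proof (cases "1 \<in> J")
    case False
    then have "J \<in> ?A" using J(1) order_trans[OF M(2) J(2)] by blast
    then show ?thesis using max J(2) by metis
  qed (use top[OF J(1)] in metis)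
  have "\<forall>J. is_ideal J \<and> M \<subseteq> J \<longrightarrow> J = M \<or> J = UNIV" using max' by simp
  moreover have "M \<noteq> UNIV" using M(3) by auto
  ultimately have "is_maximal_ideal M"
    unfolding is_maximal_ideal_def using M(1) by (intro conjI)
  then show ?thesis using M(2) by (intro exI conjI)
qed

lemma is_ideal_principal: "is_ideal (range ((*) (a::'a::comm_ring_1)))"
proof -
  have "c * (a * z) \<in> range ((*) a)" for c z by (rule range_eqI[of _ _ "c * z"]) (simp add: ac_simps)
  moreover have "a * y + a * z \<in> range ((*) a)" for y z
    by (rule range_eqI[of _ _ "y + z"]) (simp only: distrib_left)
  moreover have "0 \<in> range ((*) a)" by (rule range_eqI[of _ _ 0]) simp
  ultimately show ?thesis unfolding is_ideal_def by auto
qed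

lemma mem_range_mult_iff: "x \<in> range ((*) a) \<longleftrightarrow> (a::'a::comm_monoid_mult) dvd x"
  by (auto simp: dvd_def)

lemma max_ideal_maximal: "is_maximal_ideal (max_ideal :: 'a::dvr set)"
  unfolding max_ideal_def by (rule theI') (rule ex1_maximal_ideal)

text \<open>A nonunit generates a proper ideal; by Zorn's lemma it lies in a maximal ideal, and
  there is only one. Conversely, a proper ideal contains no unit.\<close>

lemma mem_max_ideal_iff: "x \<in> max_ideal \<longleftrightarrow> \<not> x dvd (1::'a::dvr)"
proof
  assume x: "x \<in> max_ideal"
  note max = max_ideal_maximal[where ?'a='a, unfolded is_maximal_ideal_def]
  have id: "is_ideal (max_ideal::'a set)" using max by (rule conjunct1)
  have proper: "(max_ideal::'a set) \<noteq> UNIV" using max[THEN conjunct2] by (rule conjunct1)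
  show "\<not> x dvd 1"
  proof
    assume "x dvd 1"
    then obtain c where "1 = c * x" by (metis dvdE mult.commute)
    then have "1 \<in> (max_ideal::'a set)" using x id unfolding is_ideal_def by metis
    then have "y \<in> max_ideal" for y :: 'a using id unfolding is_ideal_def by (metis mult.right_neutral)
    then have "(max_ideal::'a set) = UNIV" by blast
    then show False using proper by simp
  qed
next
  assume "\<not> x dvd 1"
  then have "1 \<notin> range ((*) x)" by (simp add: mem_range_mult_iff)
  then obtain M where M: "is_maximal_ideal M" "range ((*) x) \<subseteq> M"
    using maximal_ideal_exists[OF is_ideal_principal] by metis
  then have "M = max_ideal" using max_ideal_maximal ex1_maximal_ideal by metis
  moreover have "x \<in> range ((*) x)" unfolding mem_range_mult_iff by simp
  ultimately show "x \<in> max_ideal" using M(2) by (metis subsetD)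
qed

section \<open>Uniformizers, valuation and absolute value\<close>

definition unif :: "'a::dvr" where "unif = (SOME p. uniformizer p)"

lemma uniformizer_unif: "uniformizer (unif :: 'a::dvr)"
proof -
  have "is_ideal (max_ideal :: 'a set)"
    using max_ideal_maximal[where ?'a='a] unfolding is_maximal_ideal_def by (elim conjE)
  then have "\<exists>p::'a. uniformizer p" using ideal_principal unfolding uniformizer_def by blast
  then show ?thesis unfolding unif_def by (rule someI_ex)
qed

lemma mem_max_ideal_unif: "x \<in> max_ideal \<longleftrightarrow> (unif::'a::dvr) dvd x"
  using uniformizer_unif[where ?'a='a] unfolding uniformizer_def by (metis mem_range_mult_iff)

lemma unit_iff: "x dvd 1 \<longleftrightarrow> \<not> (unif::'a::dvr) dvd x"
  using mem_max_ideal_iff mem_max_ideal_unif by blast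

lemma unif_not_unit: "\<not> (unif::'a::dvr) dvd 1"
  using unit_iff[of "unif::'a"] by simp

lemma unif_nonzero: "(unif::'a::dvr) \<noteq> 0"
proof
  assume "(unif::'a) = 0"
  then have "x dvd 1" if "x \<noteq> 0" for x :: 'a using that by (simp add: unit_iff)
  then show False using not_field by blast
qed

lemma unif_power_nonzero: "(unif::'a::dvr) ^ k \<noteq> 0"
  by (simp add: unif_nonzero)

text \<open>For nonzero \<open>x\<close> the quotients by the powers of the uniformizer generate an
  ascending chain of principal ideals. Its union is principal, so the chain becomes stationary, and
  a stationary step would make the uniformizer a unit.\<close>

lemma unif_divisible_zero:
  assumes "\<And>k. (unif::'a::dvr) ^ k dvd x"
  shows "x = 0"
proof (rule ccontr)
  assume x: "x \<noteq> 0"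
  obtain y where y: "\<And>k. x = unif ^ k * y k" using assms unfolding dvd_def by metis
  have step: "y k = unif * y (Suc k)" for k
  proof -
    have "unif ^ k * y k = unif ^ k * (unif * y (Suc k))"
      using y[of k] y[of "Suc k"] by (metis mult.assoc power_Suc2)
    then show ?thesis using unif_power_nonzero mult_left_cancel by blast
  qed
  have mono: "y (k + j) dvd y k" for k j
  proof (induction j)
    case (Suc j)
    have "y (k + Suc j) dvd y (k + j)" unfolding step[of "k + j"] by simp
    then show ?case using Suc by (rule dvd_trans)
  qed simp
  \<comment> \<open>The union of the principal ideals generated by the \<open>y k\<close>; closure
    under addition comes from \<open>mono\<close>.\<close>
  let ?I = "{z. \<exists>k. y k dvd z}"
  have "is_ideal ?I"
    unfolding is_ideal_def
  proof (intro conjI ballI allI)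
    show "0 \<in> ?I" by simp
    fix a assume a: "a \<in> ?I"
    then show "c * a \<in> ?I" for c using dvd_mult by blast
    fix b assume "b \<in> ?I"
    then obtain j k where "y j dvd a" "y k dvd b" using a by blast
    then have "y (j + k) dvd a + b" using mono[of j k] mono[of k j]
      by (metis add.commute dvd_add dvd_trans)
    then show "a + b \<in> ?I" by blast
  qed
  then obtain a where a: "?I = range ((*) a)" using ideal_principal by blast
  have "a \<in> ?I" unfolding a by (simp add: mem_range_mult_iff)
  then obtain k where k: "y k dvd a" by blast
  have "y (Suc k) \<in> range ((*) a)" unfolding a[symmetric] using dvd_refl by blast
  then have "y k dvd y (Suc k)" using k dvd_trans mem_range_mult_iff by blast
  then obtain c where "y (Suc k) = y k * c" by (elim dvdE)
  then have "y (Suc k) * 1 = y (Suc k) * (unif * c)" using step[of k] by (simp add: ac_simps)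
  moreover have "y (Suc k) \<noteq> 0" using x y[of "Suc k"] by auto
  ultimately have "unif * c = 1" using mult_left_cancel by metis
  then show False using unif_not_unit by (metis dvd_triv_left)
qed

lemma unif_decomp:
  assumes "x \<noteq> 0"
  obtains u k where "u dvd 1" "x = u * (unif::'a::dvr) ^ k"
proof -
  obtain m where m: "\<not> (unif::'a) ^ m dvd x" using unif_divisible_zero assms by blast
  let ?k = "LEAST k. \<not> unif ^ Suc k dvd x"
  have ex: "\<exists>k. \<not> unif ^ Suc k dvd x"
    using m by (cases m) auto
  have 1: "\<not> unif ^ Suc ?k dvd x" using LeastI_ex[OF ex] .
  have 2: "unif ^ ?k dvd x"
  proof (cases ?k)
    case (Suc j)
    then have "\<not> \<not> unif ^ Suc j dvd x" using not_less_Least[of j "\<lambda>k. \<not> unif ^ Suc k dvd x"] by simp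
    then show ?thesis using Suc by simp
  qed simp
  obtain k where 1: "\<not> unif ^ Suc k dvd x" and 2: "unif ^ k dvd x" using 1 2 by (rule that)
  then obtain u where u: "x = u * unif ^ k" by (metis dvd_def mult.commute)
  have "\<not> unif dvd u"
  proof
    assume "unif dvd u"
    then have "unif ^ Suc k dvd x" unfolding u by (simp add: mult_dvd_mono)
    then show False using 1 by blast
  qed
  then have "u dvd 1" by (simp add: unit_iff)
  then show thesis using u that by blast
qed

lemma unit_times_power_inj:
  assumes "u * (unif::'a::dvr) ^ k = v * unif ^ l" "u dvd 1" "v dvd 1"
  shows "k = l"
proof -
  have *: "k \<le> l" if "u * (unif::'a) ^ k = v * unif ^ l" "v dvd 1" for u v k l
  proof (rule ccontr)
    assume "\<not> k \<le> l"
    then obtain j where k: "k = l + Suc j" by (metis add_Suc_right less_imp_Suc_add not_le)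
    have "unif ^ l * (u * unif ^ Suc j) = unif ^ l * v"
      using that(1) unfolding k by (simp add: power_add ac_simps)
    then have "u * unif ^ Suc j = v" using unif_power_nonzero mult_left_cancel by blast
    then have "unif dvd v" by auto
    then show False using that(2) unit_iff by blast
  qed
  show ?thesis using *[OF assms(1,3)] *[OF assms(1)[symmetric] assms(2)] by simp
qed

lemma uniformizer_associated:
  assumes "uniformizer (p::'a::dvr)"
  obtains w where "w dvd 1" "p = w * unif"
proof -
  have eq: "range ((*) p) = range ((*) (unif::'a))"
    using assms uniformizer_unif[where ?'a='a] unfolding uniformizer_def by metis
  have "unif dvd p" "p dvd unif"
    using eq by (metis dvd_refl mem_range_mult_iff)+
  then obtain w c where w: "p = unif * w" and c: "unif = p * c" unfolding dvd_def by blast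
  then have "unif * 1 = unif * (w * c)" by (simp add: ac_simps)
  then have "w * c = 1" using unif_nonzero mult_left_cancel by metis
  then have "w dvd 1" by (metis dvd_triv_left)
  then show thesis using that w by (simp add: mult.commute)
qed

text \<open>\<open>valuation\<close> quantifies over all uniformizers. Each of them is a unit times
  \<open>unif\<close>, and a power of this unit can be absorbed into the unit factor, so one fixed
  uniformizer computes the valuation.\<close>

lemma valuation_eq:
  assumes "u dvd (1::'a::dvr)"
  shows "valuation (u * unif ^ k) = k"
  unfolding valuation_def
proof (rule the_equality)
  show "\<exists>v p. v dvd 1 \<and> uniformizer p \<and> u * unif ^ k = v * p ^ k"
    using assms uniformizer_unif by blast
  fix l assume "\<exists>v p. v dvd 1 \<and> uniformizer p \<and> u * unif ^ k = v * p ^ l"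
  then obtain v p where v: "v dvd 1" "uniformizer p" "u * unif ^ k = v * p ^ l" by blast
  obtain w where w: "w dvd 1" "p = w * unif" using v(2) by (rule uniformizer_associated)
  have "u * unif ^ k = (v * w ^ l) * unif ^ l" using v(3) w(2) by (simp add: power_mult_distrib ac_simps)
  moreover have "v * w ^ l dvd 1" using v(1) w(1)
    by (metis dvd_power_same mult_dvd_mono mult_1 power_one)
  ultimately show "l = k" using unit_times_power_inj assms by metis
qed

lemma dvr_abs_eq:
  assumes "u dvd (1::'a::dvr)"
  shows "dvr_abs (u * unif ^ k) = inverse (real (residue_card TYPE('a)) ^ k)"
proof -
  have "u \<noteq> 0" using assms by auto
  then show ?thesis by (simp add: dvr_abs_def valuation_eq[OF assms] unif_nonzero)
qed

lemma dvr_abs_unit: "u dvd (1::'a::dvr) \<Longrightarrow> dvr_abs u = 1"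
  using dvr_abs_eq[of u 0] by simp

lemma dvr_abs_0 [simp]: "dvr_abs (0::'a::dvr) = 0"
  by (simp add: dvr_abs_def)

lemma dvr_abs_nonneg: "0 \<le> dvr_abs (x::'a::dvr)"
  by (simp add: dvr_abs_def)

lemma dvr_abs_unif_mult:
  "dvr_abs (unif * x) = inverse (real (residue_card TYPE('a))) * dvr_abs (x::'a::dvr)"
proof (cases "x = 0")
  case False
  then obtain u k where u: "u dvd 1" "x = u * (unif::'a) ^ k" using unif_decomp by blast
  then have "unif * x = u * unif ^ Suc k" by (simp add: ac_simps)
  then show ?thesis using u dvr_abs_eq[OF u(1), of "Suc k"] dvr_abs_eq[OF u(1), of k]
    by (simp only: power_Suc inverse_mult_distrib)
qed simp

section \<open>Residue classes\<close>

text \<open>Digits are elements of the ring rather than of the residue field: a digit vector is then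
  a point at which forms are evaluated, and it makes sense to ask for exact vanishing and not only
  for divisibility by the uniformizer.\<close>

definition residue_system :: "'a::dvr set \<Rightarrow> bool" where
  "residue_system R \<longleftrightarrow> finite R \<and> (\<forall>x. \<exists>!r. r \<in> R \<and> unif dvd x - r)"

lemma dvd_diff_swap: "(p::'a::comm_ring_1) dvd x - y \<longleftrightarrow> p dvd y - x"
  using dvd_minus_iff[of p "x - y"] by simp

lemma dvd_diff_trans: "(p::'a::comm_ring_1) dvd x - y \<Longrightarrow> p dvd y - z \<Longrightarrow> p dvd x - z"
  using dvd_add[of p "x - y" "y - z"] by simp

lemma residue_systemE:
  assumes "residue_system R"
  obtains r where "r \<in> R" "unif dvd x - r"
  using assms unfolding residue_system_def by blast

lemma residue_system_unique:
  assumes "residue_system R" "r \<in> R" "r' \<in> R" "unif dvd r - r'"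
  shows "r = r'"
proof -
  have "unif dvd r - r" by simp
  then show ?thesis using assms unfolding residue_system_def by blast
qed

lemma equiv_residue: "equiv (UNIV::'a::dvr set) {(x, y). x - y \<in> max_ideal}"
  unfolding mem_max_ideal_unif
  by (rule equivI) (auto simp: refl_on_def sym_def trans_def dvd_diff_swap intro: dvd_diff_trans)

lemma card_residue_system:
  assumes "residue_system (R::'a::dvr set)"
  shows "card R = residue_card TYPE('a)"
proof -
  let ?E = "{(x, y). x - y \<in> (max_ideal::'a set)}"
  have "bij_betw (\<lambda>r. ?E `` {r}) R (UNIV // ?E)"
    unfolding bij_betw_def
  proof
    show "inj_on (\<lambda>r. ?E `` {r}) R"
    proof (rule inj_onI)
      fix r r' assume r: "r \<in> R" "r' \<in> R" "?E `` {r} = ?E `` {r'}"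
      then have "unif dvd r - r'" using eq_equiv_class[OF r(3) equiv_residue]
        by (simp add: mem_max_ideal_unif)
      then show "r = r'" using r residue_system_unique[OF assms] by blast
    qed
    show "(\<lambda>r. ?E `` {r}) ` R = UNIV // ?E"
    proof (intro equalityI subsetI)
      fix S assume "S \<in> UNIV // ?E"
      then obtain x where S: "S = ?E `` {x}" by (rule quotientE)
      obtain r where "r \<in> R" "unif dvd x - r" using residue_systemE[OF assms] .
      then show "S \<in> (\<lambda>r. ?E `` {r}) ` R"
        unfolding S using equiv_class_eq[OF equiv_residue, of x r]
        by (auto simp: mem_max_ideal_unif)
    qed (blast intro: quotientI)
  qed
  then show ?thesis unfolding residue_card_def by (rule bij_betw_same_card)
qed

lemma residue_system_card_ge_2:
  assumes "residue_system (R::'a::dvr set)"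
  shows "2 \<le> card R"
proof -
  obtain r r' where r: "r \<in> R" "unif dvd 0 - r" "r' \<in> R" "unif dvd 1 - r'"
    using residue_systemE[OF assms] by metis
  have "r \<noteq> r'"
  proof
    assume "r = r'"
    then have "unif dvd (1::'a) - 0" using r dvd_diff_trans dvd_diff_swap by metis
    then show False using unif_not_unit[where ?'a='a] by simp
  qed
  moreover have "finite R" using assms unfolding residue_system_def by blast
  ultimately show ?thesis using r card_mono[of R "{r, r'}"] by simp
qed

text \<open>Coordinates that carry a minus sign get negated digits, so that a form with signs
  vanishes at a digit vector exactly and not just modulo the uniformizer.\<close>

lemma residue_system_uminus:
  assumes "residue_system R"
  shows "residue_system (uminus ` R)"
  unfolding residue_system_def
proof (intro conjI allI)
  show "finite (uminus ` R)" using assms unfolding residue_system_def by blast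
  fix x
  obtain r where r: "r \<in> R" "unif dvd - x - r" using residue_systemE[OF assms] .
  show "\<exists>!r'. r' \<in> uminus ` R \<and> unif dvd x - r'"
  proof (rule ex1I)
    show "- r \<in> uminus ` R \<and> unif dvd x - - r"
      using r dvd_minus_iff[of unif "- x - r"] by (auto simp: algebra_simps)
    fix r' assume "r' \<in> uminus ` R \<and> unif dvd x - r'"
    then obtain t where t: "r' = - t" "t \<in> R" "unif dvd x + t" by auto
    have "unif dvd (x + t) + (- x - r)" using t(3) r(2) by (rule dvd_add)
    then have "unif dvd t - r" by simp
    then show "r' = - r" using residue_system_unique[OF assms t(2) r(1)] t(1) by simp
  qed
qed

text \<open>Translation by 1 is a fixed-point free involution of the residue field if 2 vanishes there.\<close>

lemma two_unit:
  assumes R: "residue_system (R::'a::dvr set)" and odd: "odd (card R)"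
  shows "(2::'a) dvd 1"
proof (rule ccontr)
  assume "\<not> (2::'a) dvd 1"
  then have two: "unif dvd (2::'a)" by (simp add: unit_iff)
  obtain f where f: "\<And>x. f x \<in> R" "\<And>x. unif dvd x - f x"
    using R unfolding residue_system_def by metis
  define g where "g r = f (r + 1)" for r
  have g: "g r \<in> R" "g (g r) = r" "g r \<noteq> r" if "r \<in> R" for r
  proof -
    show "g r \<in> R" unfolding g_def by (rule f)
    have 1: "unif dvd r + 1 - g r" "unif dvd g r + 1 - g (g r)" unfolding g_def by (rule f)+
    have "unif dvd (r + 1 - g r) + (g r + 1 - g (g r)) - 2" by (rule dvd_diff[OF dvd_add[OF 1] two])
    then have "unif dvd r - g (g r)" by (simp add: algebra_simps)
    then show "g (g r) = r" using residue_system_unique[OF R that, of "g (g r)"] f(1) g_def by metis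
    show "g r \<noteq> r"
    proof
      assume "g r = r"
      then have "unif dvd r + 1 - r" using 1(1) by simp
      then show False using unif_not_unit[where ?'a='a] by simp
    qed
  qed
  have fin: "finite R" using R unfolding residue_system_def by blast
  have "even (card R)"
  proof -
    let ?P = "(\<lambda>r. {r, g r}) ` R"
    have "card (\<Union>?P) = (\<Sum>A\<in>?P. card A)"
    proof (rule card_Union_disjoint)
      show "disjoint ?P"
        proof (rule pairwiseI)
        fix A B assume "A \<in> ?P" "B \<in> ?P" "A \<noteq> B"
        then obtain r r' where "r \<in> R" "r' \<in> R" "A = {r, g r}" "B = {r', g r'}" by auto
        moreover have "g r \<noteq> r'" "g r' \<noteq> r" if "r \<noteq> r'"
          using calculation \<open>A \<noteq> B\<close> g(2) by (metis insert_commute)+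
        ultimately show "disjnt A B" using \<open>A \<noteq> B\<close> g(2) unfolding disjnt_def
          by (metis Int_emptyI insertE singletonD)
      qed
    qed auto
    moreover have "\<Union>?P = R" using g(1) by auto
    moreover have "(\<Sum>A\<in>?P. card A) = (\<Sum>A\<in>?P. 2)"
    proof (rule sum.cong)
      fix A assume "A \<in> ?P"
      then obtain r where "r \<in> R" "A = {r, g r}" by auto
      then show "card A = 2" using g(3)[of r] by simp
    qed simp
    ultimately show ?thesis by simp
  qed
  then show False using odd by blast
qed

text \<open>Negation permutes the residue classes and, as 2 is a unit, fixes only the class of 0.
  Taking one representative from each remaining pair together with its exact negative makes a sum of
  two opposite digits vanish, where arbitrary representatives would only give divisibility.\<close>

lemma symmetric_residue_system:
  assumes R: "residue_system (R::'a::dvr set)" and odd: "odd (card R)"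
  obtains H :: "'a::dvr set" where "finite H" "0 \<notin> H" "H \<inter> uminus ` H = {}"
      "residue_system ({0} \<union> H \<union> uminus ` H)"
proof -
  obtain f where f: "\<And>x. f x \<in> R" "\<And>x. unif dvd x - f x"
    using R unfolding residue_system_def by metis
  have fin: "finite R" using R unfolding residue_system_def by blast
  obtain e :: "'a \<Rightarrow> nat" where e: "inj_on e R" using finite_imp_inj_to_nat_seg[OF fin] by blast
  \<comment> \<open>The map \<open>r \<mapsto> f (- r)\<close> is the involution induced on
    \<open>R\<close>. The injection \<open>e\<close> merely selects one element of each pair, and
    the strict inequality drops the fixed class of 0.\<close>
  define H where "H = {r \<in> R. e r < e (f (- r))}"
  have two: "\<not> unif dvd (2::'a)" using two_unit[OF R odd] unit_iff by blast
  have neg: "f (- f (- r)) = r" if "r \<in> R" for r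
  proof -
    have "unif dvd (- f (- r) - f (- f (- r))) - (- r - f (- r))" by (rule dvd_diff[OF f(2) f(2)])
    then have "unif dvd r - f (- f (- r))" by (simp add: algebra_simps)
    then show ?thesis using residue_system_unique[OF R that f(1)] by metis
  qed
  have dvd_neg: "unif dvd r" if "f (- r) = r" for r
  proof -
    have "unif dvd - r - r" using f(2)[of "- r"] that by simp
    then have "unif dvd - (2 * r)" by (simp add: algebra_simps)
    then have "unif dvd 2 * r" using dvd_minus_iff by blast
    moreover have "\<not> unif dvd 2 * r" if "\<not> unif dvd r"
    proof -
      have "2 dvd (1::'a)" "r dvd 1" using two that unit_iff by auto
      then have "2 * r dvd 1" using mult_dvd_mono[of 2 1 r 1] by simp
      then show ?thesis using unit_iff by blast
    qed
    ultimately show ?thesis by blast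
  qed
  have H_unit: "\<not> unif dvd r" if "r \<in> H" for r
  proof
    assume "unif dvd r"
    then have "unif dvd r - f (- r)"
      using dvd_add[OF f(2)[of "- r"], of "2 * r"] by (simp add: algebra_simps)
    then have "r = f (- r)" using that residue_system_unique[OF R _ f(1)] by (auto simp: H_def)
    then show False using that by (auto simp: H_def)
  qed
  have H_opp: False if "r \<in> H" "r' \<in> H" "unif dvd r + r'" for r r'
  proof -
    have "unif dvd (r + r') + (- r - f (- r))" by (rule dvd_add[OF that(3) f(2)])
    then have "unif dvd r' - f (- r)" by simp
    then have r': "r' = f (- r)" using that residue_system_unique[OF R _ f(1)] by (auto simp: H_def)
    have "f (- r') = r" unfolding r' using neg that by (auto simp: H_def)
    then show False using that r' by (auto simp: H_def)
  qed
  have H_eq: "r = r'" if "r \<in> H" "r' \<in> H" "unif dvd r - r'" for r r'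
    using residue_system_unique[OF R] that by (auto simp: H_def)
  have "residue_system ({0} \<union> H \<union> uminus ` H)"
    unfolding residue_system_def
  proof (intro conjI allI)
    show "finite ({0} \<union> H \<union> uminus ` H)" using fin by (simp add: H_def)
    fix x
    let ?r = "f x"
    have "\<exists>r. r \<in> {0} \<union> H \<union> uminus ` H \<and> unif dvd x - r"
    proof (cases "unif dvd x")
      case True then show ?thesis by (intro exI[of _ 0]) simp
    next
      case False
      then have nd: "\<not> unif dvd f x" using f(2)[of x] by (metis diff_add_cancel dvd_add)
      then have "f (- f x) \<noteq> f x" using dvd_neg by blast
      then have "e (f (- f x)) \<noteq> e (f x)" using e f(1) by (meson inj_onD)
      then consider "e (f x) < e (f (- f x))" | "e (f (- f x)) < e (f x)" by linarith
      then show ?thesis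
      proof cases
        case 1
        then show ?thesis using f by (intro exI[of _ "f x"]) (auto simp: H_def)
      next
        case 2
        then have "f (- f x) \<in> H" using neg[OF f(1)[of x]] f(1) by (auto simp: H_def)
        moreover have "unif dvd (x - f x) - (- f x - f (- f x))" by (rule dvd_diff[OF f(2) f(2)])
        ultimately show ?thesis by (intro exI[of _ "- f (- f x)"]) auto
      qed
    qed
    then obtain r where r: "r \<in> {0} \<union> H \<union> uminus ` H" "unif dvd x - r" by blast
    show "\<exists>!r. r \<in> {0} \<union> H \<union> uminus ` H \<and> unif dvd x - r"
    proof (rule ex1I[of _ r])
      fix r' assume r': "r' \<in> {0} \<union> H \<union> uminus ` H \<and> unif dvd x - r'"
      then have d: "unif dvd r' - r" using r by (metis dvd_diff_swap dvd_diff_trans)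
      consider "r = 0" | "r \<in> H" | t where "r = - t" "t \<in> H" using r(1) by blast
      then show "r' = r"
      proof cases
        case 1
        consider "r' = 0" | "r' \<in> H" | t where "r' = - t" "t \<in> H" using r' by blast
        then show ?thesis using d 1 H_unit by cases auto
      next
        case 2
        consider "r' = 0" | "r' \<in> H" | t where "r' = - t" "t \<in> H" using r' by blast
        then show ?thesis
        proof cases
          case (3 t)
          then have "unif dvd - (t + r)" using d by simp
          then show ?thesis using 2 3 H_opp[of t r] dvd_minus_iff by blast
        qed (use d 2 H_unit H_eq in auto)
      next
        case (3 t)
        consider "r' = 0" | "r' \<in> H" | t where "r' = - t" "t \<in> H" using r' by blast
        then show ?thesis
        proof cases
          case (3 t')
          then have "unif dvd t - t'" using d \<open>r = - t\<close> by simp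
          then show ?thesis using 3 \<open>r = - t\<close> \<open>t \<in> H\<close> H_eq by blast
        qed (use d 3 H_unit H_opp[of r' t] in auto)
      qed
    qed (use r in blast)
  qed
  moreover have "finite H" "0 \<notin> H" "H \<inter> uminus ` H = {}"
    using fin H_unit H_opp by (fastforce simp: H_def)+
  ultimately show thesis by (intro that[of H])
qed

section \<open>Balls of the adic topology\<close>

definition coset :: "'a::dvr \<Rightarrow> nat \<Rightarrow> 'a set" where
  "coset a k = {x. unif ^ k dvd x - a}"

lemma coset_self: "a \<in> coset a k"
  by (simp add: coset_def)

lemma coset_0: "coset a 0 = UNIV"
  by (simp add: coset_def)

lemma coset_eq: "b \<in> coset a k \<Longrightarrow> coset b k = coset a k"
  unfolding coset_def using dvd_diff_swap dvd_diff_trans by blast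

lemma coset_mono: "k \<le> l \<Longrightarrow> coset a l \<subseteq> coset a k"
  unfolding coset_def using le_imp_power_dvd[of k l unif] dvd_trans by blast

text \<open>Every point of such a ball is a center of it, so two balls with a common point are
  nested.\<close>

lemma coset_int:
  "coset a k \<inter> coset b l = {} \<or> coset a k \<inter> coset b l = coset a k \<or> coset a k \<inter> coset b l = coset b l"
proof (cases "coset a k \<inter> coset b l = {}")
  case False
  then obtain c where "c \<in> coset a k" "c \<in> coset b l" by blast
  then have "coset a k = coset c k" "coset b l = coset c l" using coset_eq by blast+
  then show ?thesis using coset_mono[of k l c] coset_mono[of l k c] by (cases "k \<le> l") auto
qed simp

lemma open_coset: "open (coset (a::'a::compact_dvr) k)"
  unfolding open_adic[OF uniformizer_unif] coset_def using dvd_diff_trans by blast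

text \<open>Compactness: the residue classes modulo the uniformizer form an open cover.\<close>

lemma residue_system_exists: "\<exists>R::'a::compact_dvr set. residue_system R"
proof -
  have "UNIV \<subseteq> (\<Union>a\<in>UNIV. coset (a::'a) 1)" using coset_self by blast
  then obtain D :: "'a set" where D: "finite D" "UNIV \<subseteq> (\<Union>a\<in>D. coset a 1)"
    using compactE_image[OF compact_UNIV, of UNIV "\<lambda>a::'a. coset a 1"] open_coset by metis
  \<comment> \<open>The choice depends on \<open>x\<close> only through its residue class, since
    congruent elements satisfy the same predicate; hence one representative per class
    results.\<close>
  define f where "f x = (SOME d. d \<in> D \<and> unif dvd x - d)" for x
  have "\<exists>d. d \<in> D \<and> unif dvd x - d" for x using D(2) by (auto simp: coset_def)
  then have f: "f x \<in> D" "unif dvd x - f x" for x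
    unfolding f_def using someI_ex[of "\<lambda>d. d \<in> D \<and> unif dvd x - d"] by blast+
  have f_eq: "f x = f y" if "unif dvd x - y" for x y
  proof -
    have "unif dvd x - d \<longleftrightarrow> unif dvd y - d" for d
      using that dvd_diff_swap dvd_diff_trans by blast
    then show ?thesis unfolding f_def by simp
  qed
  have "residue_system (range f)"
    unfolding residue_system_def
  proof (intro conjI allI)
    show "finite (range f)" using D(1) f(1) by (meson finite_subset image_subsetI)
    fix x
    show "\<exists>!r. r \<in> range f \<and> unif dvd x - r"
    proof (rule ex1I[of _ "f x"])
      fix r assume r: "r \<in> range f \<and> unif dvd x - r"
      then obtain y where y: "r = f y" by blast
      then have "unif dvd x - y" using r f(2) dvd_diff_swap dvd_diff_trans by blast
      then show "r = f x" using y f_eq by simp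
    qed (use f in simp)
  qed
  then show ?thesis by blast
qed

lemma residue_card_ge_2: "2 \<le> residue_card TYPE('a::compact_dvr)"
  using residue_system_exists[where ?'a='a] card_residue_system residue_system_card_ge_2 by metis

lemma dvr_abs_le_iff:
  "dvr_abs (x::'a::compact_dvr) \<le> inverse (real (residue_card TYPE('a)) ^ k) \<longleftrightarrow> unif ^ k dvd x"
proof (cases "x = 0")
  case False
  let ?q = "real (residue_card TYPE('a))"
  have q: "1 < ?q" using residue_card_ge_2[where ?'a='a] by simp
  obtain u j where u: "u dvd 1" "x = u * (unif::'a) ^ j" using unif_decomp False by blast
  have "dvr_abs x \<le> inverse (?q ^ k) \<longleftrightarrow> ?q ^ k \<le> ?q ^ j"
    unfolding u(2) dvr_abs_eq[OF u(1)] using q by simp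
  also have "\<dots> \<longleftrightarrow> k \<le> j" using q by (rule power_increasing_iff)
  also have "\<dots> \<longleftrightarrow> unif ^ k dvd x"
  proof
    assume "k \<le> j"
    then show "unif ^ k dvd x" unfolding u(2) by (intro dvd_mult le_imp_power_dvd)
  next
    assume "unif ^ k dvd x"
    then obtain c where c: "u * unif ^ j = unif ^ k * c" unfolding u(2) by (elim dvdE)
    show "k \<le> j"
    proof (rule ccontr)
      assume "\<not> k \<le> j"
      then obtain i where k: "k = j + Suc i" by (metis add_Suc_right less_imp_Suc_add not_le)
      have "unif ^ j * u = unif ^ j * (unif * (unif ^ i * c))"
        using c unfolding k by (simp add: power_add ac_simps)
      then have "u = unif * (unif ^ i * c)" using unif_power_nonzero mult_left_cancel by blast
      then have "unif dvd u" by simp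
      then show False using u(1) unit_iff by blast
    qed
  qed
  finally show ?thesis .
qed simp

lemma dvr_abs_le_1: "dvr_abs (x::'a::compact_dvr) \<le> 1"
  using dvr_abs_le_iff[of x 0] by simp

text \<open>A class modulo the next power is determined by the class modulo the present one and one
  further digit. Finiteness at each level makes the family of all balls countable.\<close>

lemma finite_cosets: "finite (range (\<lambda>a::'a::compact_dvr. coset a k))"
proof (induction k)
  case 0
  then show ?case by (simp add: coset_0)
next
  case (Suc k)
  obtain R :: "'a set" where R: "residue_system R" using residue_system_exists by blast
  obtain D :: "'a set" where D: "finite D" "range (\<lambda>a. coset a k) = (\<lambda>a. coset a k) ` D"
    using finite_subset_image[OF Suc, of "\<lambda>a. coset a k" UNIV] by blast
  have "range (\<lambda>a. coset a (Suc k)) \<subseteq> (\<lambda>(d, r). coset (d + unif ^ k * r) (Suc k)) ` (D \<times> R)"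
  proof
    fix S :: "'a set" assume "S \<in> range (\<lambda>a. coset a (Suc k))"
    then obtain a where S: "S = coset a (Suc k)" by blast
    have "coset a k \<in> (\<lambda>a. coset a k) ` D" using D(2) by blast
    then obtain d where d: "d \<in> D" "coset a k = coset d k" by blast
    then have "a \<in> coset d k" using coset_self by blast
    then obtain c where c: "a - d = unif ^ k * c" unfolding coset_def by (auto elim: dvdE)
    obtain r where r: "r \<in> R" "unif dvd c - r" using residue_systemE[OF R] .
    have "a - (d + unif ^ k * r) = unif ^ k * (c - r)" using c by (simp add: algebra_simps)
    then have "unif ^ Suc k dvd a - (d + unif ^ k * r)"
      using r(2) by (simp add: mult_dvd_mono mult.commute[of unif])
    then have "a \<in> coset (d + unif ^ k * r) (Suc k)" by (simp add: coset_def)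
    then have "S = coset (d + unif ^ k * r) (Suc k)" unfolding S by (rule coset_eq)
    then show "S \<in> (\<lambda>(d, r). coset (d + unif ^ k * r) (Suc k)) ` (D \<times> R)"
      using d(1) r(1) by (intro image_eqI[of _ _ "(d, r)"]) auto
  qed
  moreover have "finite ((\<lambda>(d, r). coset (d + unif ^ k * r) (Suc k)) ` (D \<times> R))"
    using D(1) R by (auto simp: residue_system_def)
  ultimately show ?case by (rule finite_subset)
qed

lemma coset_split:
  fixes R :: "'a::dvr set"
  assumes R: "residue_system R"
  shows "coset a k = (\<Union>r\<in>R. coset (a + unif ^ k * r) (Suc k))"
    and "disjoint_family_on (\<lambda>r. coset (a + unif ^ k * r) (Suc k)) R"
proof -
  have iff: "x \<in> coset (a + unif ^ k * r) (Suc k) \<longleftrightarrow> (\<exists>c. x = a + unif ^ k * c \<and> unif dvd c - r)" for x r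
  proof
    assume "x \<in> coset (a + unif ^ k * r) (Suc k)"
    then obtain c where c: "x - (a + unif ^ k * r) = unif ^ Suc k * c"
      unfolding coset_def by (auto elim: dvdE)
    then have "x = a + unif ^ k * (r + unif * c)" by (simp add: algebra_simps)
    then show "\<exists>c. x = a + unif ^ k * c \<and> unif dvd c - r" by (intro exI[of _ "r + unif * c"]) simp
  next
    assume "\<exists>c. x = a + unif ^ k * c \<and> unif dvd c - r"
    then obtain c where x: "x = a + unif ^ k * c" and c: "unif dvd c - r" by blast
    obtain d where "c - r = unif * d" using c by (elim dvdE)
    with x
    have "x - (a + unif ^ k * r) = unif ^ k * (unif * d)"
      by (metis add_diff_cancel_left right_diff_distrib)
    then show "x \<in> coset (a + unif ^ k * r) (Suc k)"
      by (simp add: coset_def mult_dvd_mono mult.assoc[symmetric] mult.commute[of unif])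
  qed
  show "coset a k = (\<Union>r\<in>R. coset (a + unif ^ k * r) (Suc k))"
  proof (intro equalityI subsetI)
    fix x assume "x \<in> coset a k"
    then obtain c where c: "x - a = unif ^ k * c" unfolding coset_def by (auto elim: dvdE)
    obtain r where r: "r \<in> R" "unif dvd c - r" using residue_systemE[OF R] .
    have "x = a + unif ^ k * c" using c by (simp add: algebra_simps)
    then show "x \<in> (\<Union>r\<in>R. coset (a + unif ^ k * r) (Suc k))" using r iff by blast
  next
    fix x assume "x \<in> (\<Union>r\<in>R. coset (a + unif ^ k * r) (Suc k))"
    then obtain c where "x = a + unif ^ k * c" using iff by blast
    then show "x \<in> coset a k" by (simp add: coset_def)
  qed
  show "disjoint_family_on (\<lambda>r. coset (a + unif ^ k * r) (Suc k)) R"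
    unfolding disjoint_family_on_def
  proof (intro ballI impI)
    fix r r' assume r: "r \<in> R" "r' \<in> R" "r \<noteq> r'"
    show "coset (a + unif ^ k * r) (Suc k) \<inter> coset (a + unif ^ k * r') (Suc k) = {}"
    proof (rule ccontr)
      assume "\<not> ?thesis"
      then obtain x c c' where c: "x = a + unif ^ k * c" "unif dvd c - r"
        "x = a + unif ^ k * c'" "unif dvd c' - r'" using iff by (metis disjoint_iff)
      then have "unif ^ k * c = unif ^ k * c'" by (metis add_left_cancel)
      then have "c = c'" using unif_power_nonzero mult_left_cancel by blast
      then have "unif dvd r - r'" using c dvd_diff_swap dvd_diff_trans by blast
      then show False using r residue_system_unique[OF R] by blast
    qed
  qed
qed

section \<open>Balls generate the Borel sets\<close>

definition coset_family :: "'a::dvr set set" where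
  "coset_family = insert {} (\<Union>k. range (\<lambda>a. coset a k))"

lemma countable_coset_family: "countable (coset_family :: 'a::compact_dvr set set)"
  unfolding coset_family_def by (simp add: finite_cosets countable_finite)

text \<open>An open set is the union of the balls that it contains, and there are only countably
  many balls.\<close>

lemma sets_borel_coset: "sets (borel :: 'a::compact_dvr measure) = sigma_sets UNIV coset_family"
proof -
  have "sets (borel :: 'a measure) = sigma_sets UNIV {S. open S}"
    unfolding borel_def by (rule sets_measure_of) simp
  also have "\<dots> = sigma_sets UNIV coset_family"
  proof (rule sigma_sets_eqI)
    fix U :: "'a set" assume "U \<in> {S. open S}"
    then have U: "\<exists>k. coset x k \<subseteq> U" if "x \<in> U" for x
      using that open_adic[OF uniformizer_unif, of U] unfolding coset_def by blast
    have "U = \<Union>{S \<in> coset_family. S \<subseteq> U}"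
    proof (intro equalityI subsetI)
      fix x assume "x \<in> U"
      then obtain k where "coset x k \<subseteq> U" using U by blast
      moreover have "coset x k \<in> coset_family" by (auto simp: coset_family_def)
      ultimately show "x \<in> \<Union>{S \<in> coset_family. S \<subseteq> U}" using coset_self by blast
    qed blast
    moreover have "\<Union>{S \<in> coset_family. S \<subseteq> U} \<in> sigma_sets UNIV coset_family"
    proof -
      interpret sigma_algebra UNIV "sigma_sets UNIV (coset_family :: 'a set set)"
        by (rule sigma_algebra_sigma_sets) simp
      show ?thesis
        by (rule countable_Union) (auto intro: countable_subset[OF _ countable_coset_family])
    qed
    ultimately show "U \<in> sigma_sets UNIV coset_family" by metis
  next
    fix S :: "'a set" assume "S \<in> coset_family"
    then show "S \<in> sigma_sets UNIV {S. open S}"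
      unfolding coset_family_def using open_coset by auto
  qed
  finally show ?thesis .
qed

text \<open>Balls together with the empty set are stable under intersection, and the whole ring is
  itself a ball, so a finite measure is determined by its values on balls.\<close>

lemma borel_measure_eqI:
  fixes M N :: "'a::compact_dvr measure"
  assumes sets: "sets M = sets borel" "sets N = sets borel"
    and fin: "emeasure M UNIV \<noteq> \<infinity>"
    and eq: "\<And>a k. emeasure M (coset a k) = emeasure N (coset a k)"
  shows "M = N"
proof (rule measure_eqI_generator_eq[where E = coset_family and \<Omega> = UNIV and A = "\<lambda>_. UNIV"])
  show "Int_stable (coset_family :: 'a set set)"
  proof (rule Int_stableI)
    fix A B :: "'a set" assume "A \<in> coset_family" "B \<in> coset_family"
    then consider "A = {} \<or> B = {}" | a k b l where "A = coset a k" "B = coset b l"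
      unfolding coset_family_def by blast
    then show "A \<inter> B \<in> coset_family"
    proof cases
      case 1
      then show ?thesis by (auto simp: coset_family_def)
    next
      case 2
      have "A \<inter> B \<in> {{}, A, B}" using coset_int[of a k b l] unfolding 2 by blast
      moreover have "{{}, A, B} \<subseteq> coset_family" unfolding 2 coset_family_def by blast
      ultimately show ?thesis by blast
    qed
  qed
  have "UNIV = coset (0::'a) 0" by (simp add: coset_0)
  then show "range (\<lambda>_. UNIV) \<subseteq> (coset_family :: 'a set set)" unfolding coset_family_def by auto
  show "emeasure M X = emeasure N X" if "X \<in> coset_family" for X
    using that eq unfolding coset_family_def by auto
qed (use sets fin in \<open>simp_all add: sets_borel_coset\<close>)

lemma measurable_cosetI:
  fixes f :: "'b \<Rightarrow> 'a::compact_dvr"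
  assumes "\<And>a k. {x \<in> space M. f x \<in> coset a k} \<in> sets M"
  shows "f \<in> measurable M borel"
proof (rule measurable_sigma_sets[OF sets_borel_coset])
  fix S :: "'a set" assume "S \<in> coset_family"
  then consider "S = {}" | a k where "S = coset a k" unfolding coset_family_def by blast
  then show "f -` S \<inter> space M \<in> sets M"
  proof cases
    case 2
    have "f -` S \<inter> space M = {x \<in> space M. f x \<in> coset a k}" unfolding 2 by blast
    then show ?thesis using assms by simp
  qed simp
qed auto

lemma coset_borel [measurable]: "coset (a::'a::compact_dvr) k \<in> sets borel"
  using open_coset by (rule borel_open)

lemma finite_coset_reps:
  "\<exists>D::'a::compact_dvr set. finite D \<and> (\<forall>x. \<exists>d\<in>D. x \<in> coset d k)"
proof -
  obtain D :: "'a set" where D: "finite D" "range (\<lambda>a. coset a k) = (\<lambda>a. coset a k) ` D"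
    using finite_subset_image[OF finite_cosets[of k], of "\<lambda>a. coset a k" UNIV] by (metis subset_refl)
  have "\<exists>d\<in>D. x \<in> coset d k" for x
  proof -
    have "coset x k \<in> (\<lambda>a. coset a k) ` D" unfolding D(2)[symmetric] by (rule rangeI)
    then obtain d where "d \<in> D" "coset x k = coset d k" by (rule imageE)
    then show ?thesis using coset_self by blast
  qed
  then show ?thesis using D(1) by blast
qed

text \<open>The class of a sum modulo a power of the uniformizer depends only on the classes of the
  summands, and only finitely many classes of \<open>f\<close> have to be distinguished.\<close>

lemma borel_measurable_dvr_add:
  fixes f g :: "'b \<Rightarrow> 'a::compact_dvr"
  assumes f: "f \<in> measurable M borel" and g: "g \<in> measurable M borel"
  shows "(\<lambda>x. f x + g x) \<in> measurable M borel"
proof (rule measurable_cosetI)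
  fix a :: 'a and k
  obtain D :: "'a set" where D: "finite D" "\<And>x. \<exists>d\<in>D. x \<in> coset d k" using finite_coset_reps[of k]
    by metis
  have "{x \<in> space M. f x + g x \<in> coset a k} =
    (\<Union>d\<in>D. (f -` coset d k \<inter> space M) \<inter> (g -` coset (a - d) k \<inter> space M))"
  proof (intro equalityI subsetI)
    fix x assume x: "x \<in> {x \<in> space M. f x + g x \<in> coset a k}"
    obtain d where d: "d \<in> D" "f x \<in> coset d k" using D(2) by blast
    note fd = d(2)
    have "unif ^ k dvd f x + g x - a" "unif ^ k dvd f x - d"
      using fd x unfolding coset_def by simp_all
    then have "unif ^ k dvd (f x + g x - a) - (f x - d)" by (rule dvd_diff)
    then have "g x \<in> coset (a - d) k" unfolding coset_def by (simp add: algebra_simps)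
    then show "x \<in> (\<Union>d\<in>D. (f -` coset d k \<inter> space M) \<inter> (g -` coset (a - d) k \<inter> space M))"
      using d fd x by blast
  next
    fix x assume "x \<in> (\<Union>d\<in>D. (f -` coset d k \<inter> space M) \<inter> (g -` coset (a - d) k \<inter> space M))"
    then obtain d where d: "x \<in> space M" "unif ^ k dvd f x - d" "unif ^ k dvd g x - (a - d)"
      by (auto simp: coset_def)
    have "unif ^ k dvd (f x - d) + (g x - (a - d))" using d by (intro dvd_add)
    then show "x \<in> {x \<in> space M. f x + g x \<in> coset a k}" using d(1)
      by (simp add: coset_def algebra_simps)
  qed
  moreover have "\<dots> \<in> sets M"
    by (intro sets.finite_UN sets.Int D(1) measurable_sets[OF f] measurable_sets[OF g] coset_borel)
  ultimately show "{x \<in> space M. f x + g x \<in> coset a k} \<in> sets M" by simp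
qed

lemma borel_measurable_dvr_affine: "(\<lambda>x. a +
    c * x) \<in> measurable borel (borel :: 'a::compact_dvr measure)"
proof (rule measurable_cosetI)
  fix b :: 'a and k
  have "open {x. a + c * x \<in> coset b k}"
    unfolding open_adic[OF uniformizer_unif]
  proof (intro ballI exI[of _ k] subsetI)
    fix x y assume x: "x \<in> {x. a + c * x \<in> coset b k}" and y: "y \<in> {y. unif ^ k dvd y - x}"
    have "unif ^ k dvd c * (y - x) + (a + c * x - b)"
      using x y by (intro dvd_add dvd_mult) (auto simp: coset_def)
    then show "y \<in> {x. a + c * x \<in> coset b k}" by (simp add: coset_def algebra_simps)
  qed
  then show "{x \<in> space borel. a + c * x \<in> coset b k} \<in> sets borel" by simp
qed

text \<open>The absolute value takes the value 0 and powers of \<open>1 / q\<close>, so a sublevel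
  set is empty, the intersection \<open>{0}\<close> of all balls around 0, or one of these
  balls.\<close>

lemma borel_measurable_dvr_abs: "dvr_abs \<in> borel_measurable (borel :: 'a::compact_dvr measure)"
  unfolding borel_measurable_iff_le
proof
  fix t :: real
  let ?q = "real (residue_card TYPE('a))"
  have q: "1 < ?q" using residue_card_ge_2[where ?'a='a] by simp
  consider "t < 0" | "t = 0" | "0 < t" by linarith
  then show "{x \<in> space borel. dvr_abs (x::'a) \<le> t} \<in> sets borel"
  proof cases
    case 1
    then have "{x \<in> space borel. dvr_abs (x::'a) \<le> t} = {}"
      using dvr_abs_nonneg not_less order_trans by (metis (mono_tags, lifting) Collect_empty_eq)
    then show ?thesis by simp
  next
    case 2
    have "x = 0" if "dvr_abs x \<le> 0" for x :: 'a
    proof (rule unif_divisible_zero)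
      fix k
      have "dvr_abs x \<le> inverse (?q ^ k)" using that by (rule order_trans) simp
      then show "unif ^ k dvd x" unfolding dvr_abs_le_iff .
    qed
    then have "{x \<in> space borel. dvr_abs (x::'a) \<le> t} = {0}" using 2 by auto
    also have "{0::'a} = (\<Inter>k. coset 0 k)" using unif_divisible_zero by (auto simp: coset_def)
    finally show ?thesis by simp
  next
    case 3
    have "\<exists>k. inverse ?q ^ k < t" using 3 q by (intro real_arch_pow_inv) (auto simp: field_simps)
    then have ex: "\<exists>k. inverse (?q ^ k) \<le> t" by (metis less_imp_le power_inverse)
    \<comment> \<open>The first exponent at which the powers of \<open>1 / q\<close> have dropped to
      \<open>t\<close>; the sublevel set is the ball around 0 of this level.\<close>
    define k where "k = (LEAST k. inverse (?q ^ k) \<le> t)"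
    have k: "inverse (?q ^ k) \<le> t" unfolding k_def using LeastI_ex[OF ex] .
    have "dvr_abs x \<le> t \<longleftrightarrow> unif ^ k dvd x" for x :: 'a
    proof
      assume *: "dvr_abs x \<le> t"
      show "unif ^ k dvd x"
      proof (cases "x = 0")
        case False
        then obtain u j where u: "u dvd 1" "x = u * (unif::'a) ^ j" using unif_decomp by blast
        then have "inverse (?q ^ j) \<le> t" using * by (simp add: dvr_abs_eq)
        then have "k \<le> j" unfolding k_def by (rule Least_le)
        then show ?thesis unfolding u(2) by (intro dvd_mult le_imp_power_dvd)
      qed simp
    next
      assume "unif ^ k dvd x"
      then show "dvr_abs x \<le> t" using k unfolding dvr_abs_le_iff[symmetric] by linarith
    qed
    then have "{x \<in> space borel. dvr_abs (x::'a) \<le> t} = coset 0 k" by (simp add: coset_def)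
    then show ?thesis by simp
  qed
qed

section \<open>Haar measure and its self-similarity\<close>

locale haar =
  fixes \<mu> :: "'a::compact_dvr measure" and q :: nat
  assumes normalized_haar: "normalized_haar \<mu>"
    and q: "q = residue_card TYPE('a)"
begin

lemma q_ge_2: "2 \<le> q"
  unfolding q by (rule residue_card_ge_2)

lemma sets_haar [measurable_cong]: "sets \<mu> = sets borel"
  using normalized_haar unfolding normalized_haar_def by (rule conjunct1)

lemma space_haar [simp]: "space \<mu> = UNIV"
  using sets_eq_imp_space_eq[OF sets_haar] by simp

lemma emeasure_UNIV [simp]: "emeasure \<mu> UNIV = 1"
  using normalized_haar unfolding normalized_haar_def by (elim conjE)

lemma emeasure_translate: "S \<in> sets \<mu> \<Longrightarrow> emeasure \<mu> ((+) a ` S) = emeasure \<mu> S"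
  using normalized_haar unfolding normalized_haar_def by blast

lemma finite_measure_haar: "finite_measure \<mu>"
  by (rule finite_measureI) simp

sublocale finite_measure \<mu> by (rule finite_measure_haar)

text \<open>A ball splits into \<open>q\<close> balls of the next level, and these are translates of
  each other.\<close>

lemma measure_coset: "measure \<mu> (coset a k) = inverse (real q ^ k)"
proof (induction k arbitrary: a)
  case 0
  then show ?case by (simp add: coset_0 measure_def)
next
  case (Suc k)
  obtain R :: "'a set" where R: "residue_system R" using residue_system_exists by blast
  have fin: "finite R" using R unfolding residue_system_def by blast
  have shift: "measure \<mu> (coset b (Suc k)) = measure \<mu> (coset 0 (Suc k))" for b
  proof -
    have "coset b (Suc k) = (+) b ` coset 0 (Suc k)"
    proof (intro equalityI subsetI)
      fix x assume "x \<in> coset b (Suc k)"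
      then show "x \<in> (+) b ` coset 0 (Suc k)"
        by (intro image_eqI[of _ _ "x - b"]) (auto simp: coset_def)
    qed (auto simp: coset_def)
    then show ?thesis unfolding measure_def by (simp add: emeasure_translate sets_haar)
  qed
  have "inverse (real q ^ k) = measure \<mu> (\<Union>r\<in>R. coset (a + unif ^ k * r) (Suc k))"
    using Suc[of a] coset_split(1)[OF R, of a k] by simp
  also have "\<dots> = (\<Sum>r\<in>R. measure \<mu> (coset (a + unif ^ k * r) (Suc k)))"
    by (intro finite_measure_finite_Union fin coset_split(2)[OF R]) (auto simp: sets_haar)
  also have "\<dots> = (\<Sum>r\<in>R. measure \<mu> (coset 0 (Suc k)))"
    by (rule sum.cong) (use shift in auto)
  also have "\<dots> = real q * measure \<mu> (coset a (Suc k))"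
    using shift[of a] card_residue_system[OF R] q by simp
  finally show ?case using q_ge_2 by (simp add: field_simps)
qed

lemma q_pos: "0 < real q" "real q \<noteq> 0"
  using q_ge_2 by simp_all

text \<open>The substitution maps the ring onto the residue class of \<open>a\<close> and shrinks
  volumes by the factor \<open>1 / q\<close>, which the density compensates. It suffices to compare
  both measures on balls.\<close>

lemma distr_affine:
  "distr \<mu> borel (\<lambda>x. a + unif * x) = density \<mu> (\<lambda>x. ennreal (real q * indicator (coset a 1) x))"
proof (rule borel_measure_eqI)
  have T [measurable]: "(\<lambda>x. a + unif * x) \<in> measurable \<mu> borel"
    using borel_measurable_dvr_affine[of a unif] by (simp cong: measurable_cong_sets add: sets_haar)
  show "emeasure (distr \<mu> borel (\<lambda>x. a + unif * x)) UNIV \<noteq> \<infinity>"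
    by (subst emeasure_distr) (use T in auto)
  fix b :: 'a and k
  have S: "coset b k \<in> sets \<mu>" "coset a 1 \<inter> coset b k \<in> sets \<mu>" by (auto simp: sets_haar)
  have "emeasure (density \<mu> (\<lambda>x. ennreal (real q * indicator (coset a 1) x))) (coset b k)
      = (\<integral>\<^sup>+x. ennreal (real q) * indicator (coset a 1 \<inter> coset b k) x \<partial>\<mu>)"
    using S(1) by (subst emeasure_density)
      (auto simp: sets_haar indicator_def intro!: nn_integral_cong borel_measurable_times
          borel_measurable_indicator)
  also have "\<dots> = ennreal (real q) * emeasure \<mu> (coset a 1 \<inter> coset b k)"
    using S(2) by (rule nn_integral_cmult_indicator)
  also have "\<dots> = ennreal (real q * measure \<mu> (coset a 1 \<inter> coset b k))"
    by (simp add: emeasure_eq_measure ennreal_mult)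
  \<comment> \<open>The preimage of a ball inside the residue class of \<open>a\<close> is a ball
    whose exponent is smaller by one; a ball of positive level outside this class has empty
    preimage.\<close>
  also have "\<dots> = ennreal (measure \<mu> {x. a + unif * x \<in> coset b k})"
  proof (cases k)
    case 0
    then show ?thesis using q_pos measure_coset[of a 1] by (simp add: coset_0 measure_def)
  next
    case (Suc j)
    show ?thesis
    proof (cases "b \<in> coset a 1")
      case True
      then obtain c where c: "b - a = unif * c" unfolding coset_def by (auto elim: dvdE)
      have "coset b k \<subseteq> coset b 1" using coset_mono[of 1 k b] Suc by simp
      then have "coset a 1 \<inter> coset b k = coset b k" using coset_eq[OF True] by blast
      moreover have "a + unif * x \<in> coset b k \<longleftrightarrow> x \<in> coset c j" for x
      proof -
        have "a + unif * x - b = unif * (x - c)" using c by (simp add: algebra_simps)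
        then show ?thesis unfolding coset_def Suc using unif_nonzero[where ?'a='a] by simp
      qed
      then have "{x. a + unif * x \<in> coset b k} = coset c j" by blast
      ultimately show ?thesis using measure_coset q_pos by (simp add: Suc)
    next
      case False
      have *: "coset a 1 \<inter> coset b k = {}"
      proof (rule ccontr)
        assume "coset a 1 \<inter> coset b k \<noteq> {}"
        then obtain x where x: "x \<in> coset a 1" "x \<in> coset b 1"
          using coset_mono[of 1 k b] Suc by auto
        then have "coset a 1 = coset b 1" using coset_eq by blast
        then show False using False coset_self by blast
      qed
      moreover have "a + unif * x \<in> coset a 1" for x by (simp add: coset_def)
      ultimately have "{x. a + unif * x \<in> coset b k} = {}" by blast
      then show ?thesis using * by simp
    qed
  qed
  also have "\<dots> = emeasure (distr \<mu> borel (\<lambda>x. a + unif * x)) (coset b k)"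
    by (subst emeasure_distr) (use T in \<open>auto simp: emeasure_eq_measure vimage_def\<close>)
  finally show "emeasure (distr \<mu> borel (\<lambda>x. a + unif * x)) (coset b k) =
    emeasure (density \<mu> (\<lambda>x. ennreal (real q * indicator (coset a 1) x))) (coset b k)" by simp
qed (simp_all add: sets_haar)

text \<open>The indicators of the residue classes sum to 1, and \<open>distr_affine\<close>
  stretches each class to the whole ring.\<close>

lemma integral_residues:
  fixes f :: "'a \<Rightarrow> complex"
  assumes R: "residue_system R" and f: "f \<in> borel_measurable \<mu>" and bound: "\<And>x. norm (f x) \<le> B"
  shows "(\<integral>x. f x \<partial>\<mu>) = inverse (of_nat q) * (\<Sum>r\<in>R. \<integral>x. f (r + unif * x) \<partial>\<mu>)"
proof -
  have fin: "finite R" using R unfolding residue_system_def by blast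
  have fb: "f \<in> borel_measurable borel" using f by (simp cong: measurable_cong_sets add: sets_haar)
  have int: "integrable \<mu> f" using f bound by (intro integrable_const_bound[of _ B]) auto
  have ind: "(indicator (coset r 1) :: 'a \<Rightarrow> real) \<in> borel_measurable \<mu>" for r
    by (simp add: sets_haar)
  have one: "(\<integral>x. f (r + unif * x) \<partial>\<mu>) = of_nat q * (\<integral>x. indicator (coset r 1) x *\<^sub>R f x \<partial>\<mu>)" for r
  proof -
    have T: "(\<lambda>x. r + unif * x) \<in> measurable \<mu> borel"
      using borel_measurable_dvr_affine[of r unif] by (simp cong: measurable_cong_sets add: sets_haar)
    have "(\<integral>x. f (r + unif * x) \<partial>\<mu>) = (\<integral>x. f x \<partial>distr \<mu> borel (\<lambda>x. r + unif * x))"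
      by (rule integral_distr[OF T fb, symmetric])
    also have "\<dots> = (\<integral>x. (real q * indicator (coset r 1) x) *\<^sub>R f x \<partial>\<mu>)"
      unfolding distr_affine using f ind by (intro integral_density) auto
    also have "\<dots> = (\<integral>x. of_nat q * (indicator (coset r 1) x *\<^sub>R f x) \<partial>\<mu>)"
      by (rule Bochner_Integration.integral_cong) (auto simp: scaleR_conv_of_real)
    also have "\<dots> = of_nat q * (\<integral>x. indicator (coset r 1) x *\<^sub>R f x \<partial>\<mu>)"
      by (rule integral_mult_right_zero)
    finally show ?thesis .
  qed
  have "(\<Sum>r\<in>R. indicator (coset r 1) x *\<^sub>R f x) = f x" for x
  proof -
    obtain r where r: "r \<in> R" "unif dvd x - r" using residue_systemE[OF R] .
    have "unif dvd x - r' \<longleftrightarrow> r' = r" if "r' \<in> R" for r'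
      using that r residue_system_unique[OF R that r(1)] dvd_diff_swap dvd_diff_trans
      by blast
    then have "indicator (coset r' 1) x = (if r' = r then 1 else 0 :: real)" if "r' \<in> R" for r'
      using that by (simp add: indicator_def coset_def)
    then have "(\<Sum>r'\<in>R. indicator (coset r' 1) x *\<^sub>R f x) = (\<Sum>r'\<in>R. if r' = r then f x else 0)"
      by (intro sum.cong) auto
    then show ?thesis using r(1) fin by simp
  qed
  then have "(\<integral>x. f x \<partial>\<mu>) = (\<integral>x. (\<Sum>r\<in>R. indicator (coset r 1) x *\<^sub>R f x) \<partial>\<mu>)" by simp
  also have "\<dots> = (\<Sum>r\<in>R. \<integral>x. indicator (coset r 1) x *\<^sub>R f x \<partial>\<mu>)"
    by (intro Bochner_Integration.integral_sum integrable_mult_indicator int) (simp add: sets_haar)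
  also have "\<dots> = inverse (of_nat q) * (\<Sum>r\<in>R. \<integral>x. f (r + unif * x) \<partial>\<mu>)"
    unfolding one sum_distrib_left[symmetric] using q_pos by simp
  finally show ?thesis .
qed

section \<open>Integration over free modules\<close>

sublocale product_sigma_finite "\<lambda>_::nat. \<mu>"
  by (rule product_sigma_finite.intro) (rule sigma_finite_measure_axioms)

abbreviation power_measure :: "nat set \<Rightarrow> (nat \<Rightarrow> 'a) measure" where
  "power_measure I \<equiv> PiM I (\<lambda>_. \<mu>)"

lemma finite_power_measure:
  assumes "finite I"
  shows "finite_measure (power_measure I)"
proof (rule finite_measureI)
  have "emeasure (power_measure I) (Pi\<^sub>E I (\<lambda>_. UNIV)) = (\<Prod>i\<in>I. emeasure \<mu> UNIV)"
    using assms by (intro emeasure_PiM) (auto simp: sets_haar)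
  then show "emeasure (power_measure I) (space (power_measure I)) \<noteq> \<infinity>"
    by (simp add: space_PiM)
qed

lemma integrable_power_measure:
  fixes f :: "(nat \<Rightarrow> 'a) \<Rightarrow> complex"
  assumes "finite I" "f \<in> borel_measurable (power_measure I)" "\<And>x. norm (f x) \<le> B"
  shows "integrable (power_measure I) f"
  using finite_measure.integrable_const_bound[OF finite_power_measure[OF assms(1)], of f B] assms by simp

lemma norm_integral_power_measure:
  fixes f :: "'a \<Rightarrow> complex"
  assumes f: "f \<in> borel_measurable \<mu>" and bound: "\<And>x. norm (f x) \<le> B"
  shows "norm (\<integral>x. f x \<partial>\<mu>) \<le> B"
proof -
  have "norm (\<integral>x. f x \<partial>\<mu>) \<le> (\<integral>x. norm (f x) \<partial>\<mu>)" by (rule integral_norm_bound)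
  also have "\<dots> \<le> (\<integral>x. B \<partial>\<mu>)"
    using f bound by (intro integral_mono integrable_norm integrable_const_bound[of f B]) auto
  also have "\<dots> = B" by (simp add: measure_def)
  finally show ?thesis .
qed

lemma measurable_digits:
  "(\<lambda>x. \<lambda>i\<in>I. r i + unif * x i) \<in> measurable (power_measure I) (power_measure I)"
proof (rule measurable_restrict)
  fix i assume i: "i \<in> I"
  have "(\<lambda>x. r i + unif * x) \<in> measurable \<mu> \<mu>"
    using borel_measurable_dvr_affine[of "r i" unif] by (simp cong: measurable_cong_sets add: sets_haar)
  then show "(\<lambda>x. r i + unif * x i) \<in> measurable (power_measure I) \<mu>"
    by (rule measurable_compose[OF measurable_component_singleton[OF i]])
qed

text \<open>Induction on the coordinates: the new coordinate is integrated first and split by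
  \<open>integral_residues\<close>, the others are left to the induction hypothesis.\<close>

lemma integral_digits:
  fixes f :: "(nat \<Rightarrow> 'a) \<Rightarrow> complex"
  assumes "finite I" and R: "\<And>i. residue_system (R i)"
    and "f \<in> borel_measurable (power_measure I)" and "\<And>x. norm (f x) \<le> B"
  shows "(\<integral>x. f x \<partial>power_measure I) =
    inverse (of_nat q) ^ card I * (\<Sum>r\<in>Pi\<^sub>E I R. \<integral>x. f (\<lambda>i\<in>I. r i + unif * x i) \<partial>power_measure I)"
  using assms(1,3,4)
proof (induction I arbitrary: f rule: finite_induct)
  case empty
  have "f x = f (\<lambda>i. undefined)" if "x \<in> space (power_measure {})" for x
    using that by (auto simp: space_PiM)
  then have "(\<integral>x. f x \<partial>power_measure {}) = (\<integral>x. f (\<lambda>i. undefined) \<partial>power_measure {})"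
    by (rule Bochner_Integration.integral_cong[OF refl])
  then show ?case by (simp add: restrict_def)
next
  case (insert i I)
  have fin: "finite (R j)" for j using R unfolding residue_system_def by blast
  note f = insert.prems(1) and bound = insert.prems(2)
  have upd: "(\<lambda>(x, y). x(i := y)) \<in> measurable (power_measure I \<Otimes>\<^sub>M \<mu>) (power_measure (insert i I))"
    by (rule measurable_add_dim)
  have f2: "(\<lambda>(x, y). f (x(i := y))) \<in> borel_measurable (power_measure I \<Otimes>\<^sub>M \<mu>)"
    using measurable_compose[OF upd f] unfolding case_prod_unfold .
  have f1: "(\<lambda>y. f (x(i := y))) \<in> borel_measurable \<mu>" if "x \<in> space (power_measure I)" for x
    using measurable_Pair2[OF f2 that] unfolding prod.case .
  define g where "g a x = (\<integral>y. f (x(i := a + unif * y)) \<partial>\<mu>)" for a x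
  have aff: "(\<lambda>y. a + unif * y) \<in> measurable \<mu> \<mu>" for a
    using borel_measurable_dvr_affine[of a unif] by (simp cong: measurable_cong_sets add: sets_haar)
  have fa: "(\<lambda>(x, y). f (x(i := a + unif * y))) \<in> borel_measurable (power_measure I \<Otimes>\<^sub>M \<mu>)" for a
  proof -
    have "(\<lambda>p. (fst p, a + unif * snd p)) \<in> measurable (power_measure I \<Otimes>\<^sub>M \<mu>) (power_measure I \<Otimes>\<^sub>M \<mu>)"
      by (intro measurable_Pair measurable_fst measurable_compose[OF measurable_snd aff])
    from measurable_compose[OF this f2] show ?thesis unfolding case_prod_unfold fst_conv snd_conv .
  qed
  have g: "g a \<in> borel_measurable (power_measure I)" for a
    unfolding g_def by (rule borel_measurable_lebesgue_integral) (rule fa)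
  have gb: "norm (g a (restrict x I)) \<le> B" for a x
  proof -
    have "restrict x I \<in> space (power_measure I)" by (simp add: space_PiM)
    then show ?thesis unfolding g_def using measurable_Pair2[OF fa] bound
      by (intro norm_integral_power_measure) auto
  qed
  \<comment> \<open>The bound on \<open>g\<close> rests on measurability in the last coordinate,
    which is known at points of the product space. Composing with the restriction gives a function
    bounded everywhere, as the induction hypothesis demands.\<close>
  define g' where "g' a x = g a (restrict x I)" for a x
  have g'_eq: "g' a x = g a x" if "x \<in> space (power_measure I)" for a x
    using that by (simp add: g'_def space_PiM PiE_restrict)
  have g': "g' a \<in> borel_measurable (power_measure I)" for a
    using g g'_eq by (simp cong: measurable_cong)
  have gb': "norm (g' a x) \<le> B" for a x unfolding g'_def by (rule gb)
  have "(\<integral>x. f x \<partial>power_measure (insert i I)) = (\<integral>x. (\<integral>y. f (x(i := y)) \<partial>\<mu>) \<partial>power_measure I)"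
    using insert.hyps integrable_power_measure[OF _ f bound] by (intro product_integral_insert) auto
  also have "\<dots> = (\<integral>x. inverse (of_nat q) * (\<Sum>a\<in>R i. g' a x) \<partial>power_measure I)"
  proof (rule Bochner_Integration.integral_cong[OF refl])
    fix x assume x: "x \<in> space (power_measure I)"
    show "(\<integral>y. f (x(i := y)) \<partial>\<mu>) = inverse (of_nat q) * (\<Sum>a\<in>R i. g' a x)"
      unfolding g'_eq[OF x] g_def by (rule integral_residues[OF R f1[OF x] bound])
  qed
  also have "\<dots> = inverse (of_nat q) * (\<Sum>a\<in>R i. \<integral>x. g' a x \<partial>power_measure I)"
    using integrable_power_measure[OF insert.hyps(1) g' gb']
    by (subst integral_mult_right_zero, subst Bochner_Integration.integral_sum) auto
  also have "(\<Sum>a\<in>R i. \<integral>x. g' a x \<partial>power_measure I) = (\<Sum>a\<in>R i. inverse (of_nat q) ^ card I *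
      (\<Sum>r\<in>Pi\<^sub>E I R. \<integral>x. g' a (\<lambda>j\<in>I. r j + unif * x j) \<partial>power_measure I))"
    by (rule sum.cong[OF refl]) (rule insert.IH[OF g' gb'])
  also have "\<dots> = inverse (of_nat q) ^ card I * (\<Sum>(a, r)\<in>R i \<times> Pi\<^sub>E I R.
      \<integral>x. f (\<lambda>j\<in>insert i I. (r(i := a)) j + unif * x j) \<partial>power_measure (insert i I))"
  proof -
    have "(\<integral>x. g' a (\<lambda>j\<in>I. r j + unif * x j) \<partial>power_measure I) =
      (\<integral>x. f (\<lambda>j\<in>insert i I. (r(i := a)) j + unif * x j) \<partial>power_measure (insert i I))" for a r
    proof -
      let ?f = "\<lambda>x. f (\<lambda>j\<in>insert i I. (r(i := a)) j + unif * x j)"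
      have "?f \<in> borel_measurable (power_measure (insert i I))"
        by (rule measurable_compose[OF measurable_digits f])
      then have "integral\<^sup>L (power_measure (insert i I)) ?f =
          (\<integral>x. (\<integral>y. ?f (x(i := y)) \<partial>\<mu>) \<partial>power_measure I)"
        using insert.hyps bound by (intro product_integral_insert
            integrable_power_measure[of _ _ B]) auto
      also have "\<dots> = (\<integral>x. g' a (\<lambda>j\<in>I. r j + unif * x j) \<partial>power_measure I)"
      proof (rule Bochner_Integration.integral_cong[OF refl])
        fix x
        have "(\<lambda>j\<in>insert i I. (r(i := a)) j + unif * (x(i := y)) j) =
            (restrict (\<lambda>j\<in>I. r j + unif * x j) I)(i := a + unif * y)" for y
          using insert.hyps(2) by auto
        then show "(\<integral>y. ?f (x(i := y)) \<partial>\<mu>) = g' a (\<lambda>j\<in>I. r j + unif * x j)"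
          by (simp add: g'_def g_def)
      qed
      finally show ?thesis by simp
    qed
    then show ?thesis by (simp add: sum_distrib_left[symmetric] sum.cartesian_product)
  qed
  also have "(\<Sum>(a, r)\<in>R i \<times> Pi\<^sub>E I R.
      \<integral>x. f (\<lambda>j\<in>insert i I. (r(i := a)) j + unif * x j) \<partial>power_measure (insert i I)) =
    (\<Sum>r\<in>Pi\<^sub>E (insert i I) R. \<integral>x. f (\<lambda>j\<in>insert i I. r j + unif * x j) \<partial>power_measure (insert i I))"
    unfolding PiE_insert_eq using inj_combinator[OF insert.hyps(2), of R]
    by (subst sum.reindex) (auto simp: case_prod_unfold intro!: sum.cong)
  finally show ?case unfolding card_insert_disjoint[OF insert.hyps] power_Suc mult.assoc .
qed

text \<open>Fubini's theorem; the hypotheses on restrictions say that each factor depends on its own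
  coordinates only.\<close>

lemma integral_disjoint:
  fixes f g :: "(nat \<Rightarrow> 'a) \<Rightarrow> complex"
  assumes fin: "finite I" "finite J" and disj: "I \<inter> J = {}"
    and f: "f \<in> borel_measurable (power_measure I)" "\<And>x. norm (f x) \<le> 1" "\<And>x. f (restrict x I) = f x"
    and g: "g \<in> borel_measurable (power_measure J)" "\<And>x. norm (g x) \<le> 1" "\<And>x. g (restrict x J) = g x"
  shows "(\<integral>x. f x * g x \<partial>power_measure (I \<union> J)) =
    (\<integral>x. f x \<partial>power_measure I) * (\<integral>x. g x \<partial>power_measure J)"
proof -
  have "(\<lambda>x. f (restrict x I)) \<in> borel_measurable (power_measure (I \<union> J))"
    by (rule measurable_compose[OF measurable_restrict_subset f(1)]) auto
  moreover have "(\<lambda>x. g (restrict x J)) \<in> borel_measurable (power_measure (I \<union> J))"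
    by (rule measurable_compose[OF measurable_restrict_subset g(1)]) auto
  ultimately have m: "(\<lambda>x. f x * g x) \<in> borel_measurable (power_measure (I \<union> J))"
    using f(3) g(3) by (simp add: borel_measurable_times)
  have b: "norm (f x * g x) \<le> 1" for x
    using mult_mono[OF f(2)[of x] g(2)[of x]] by (simp add: norm_mult)
  have "(\<integral>x. f x * g x \<partial>power_measure (I \<union> J)) =
    (\<integral>x. (\<integral>y. f (merge I J (x, y)) * g (merge I J (x, y)) \<partial>power_measure J) \<partial>power_measure I)"
    using integrable_power_measure[OF _ m b] fin disj by (intro product_integral_fold) auto
  also have "\<dots> = (\<integral>x. (\<integral>y. f x * g y \<partial>power_measure J) \<partial>power_measure I)"
  proof -
    have "restrict (merge I J (x, y)) I = restrict x I" "restrict (merge I J (x, y)) J =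
        restrict y J" for x y
      using disj by (auto simp: merge_def fun_eq_iff)
    then have "f (merge I J (x, y)) = f x" "g (merge I J (x, y)) = g y" for x y
      using f(3) g(3) by metis+
    then show ?thesis by simp
  qed
  finally show ?thesis by simp
qed

end

section \<open>Linear forms and their zeta integrals\<close>

definition linform_supp :: "linform \<Rightarrow> nat set" where
  "linform_supp L = {i. L i \<noteq> 0}"

text \<open>Summing over the support makes the value independent of an ambient dimension, so that a
  form can be integrated over any set of coordinates that contains its variables.\<close>

definition leval :: "linform \<Rightarrow> (nat \<Rightarrow> 'a::comm_ring_1) \<Rightarrow> 'a" where
  "leval L x = (\<Sum>i\<in>linform_supp L. of_int (L i) * x i)"

lemma leval_eq_sum:
  assumes "finite I" "linform_supp L \<subseteq> I"
  shows "leval L x = (\<Sum>i\<in>I. of_int (L i) * x i)"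
  unfolding leval_def using assms by (intro sum.mono_neutral_left) (auto simp: linform_supp_def)

lemma eval_form_eq_leval: "linform_supp L \<subseteq> {1..d} \<Longrightarrow> eval_form d L x = leval L x"
  unfolding eval_form_def by (rule leval_eq_sum[symmetric]) auto

lemma leval_cong: "(\<And>i. i \<in> linform_supp L \<Longrightarrow> x i = y i) \<Longrightarrow> leval L x = leval L y"
  unfolding leval_def by (rule sum.cong) auto

lemma leval_digits: "leval L (\<lambda>i. r i + c * x i) = leval L r + c * leval L x"
  unfolding leval_def by (simp add: algebra_simps sum.distrib sum_distrib_left)

lemma complex_powr_scale:
  assumes "0 < b" "0 \<le> a"
  shows "complex_of_real (inverse b * a) powr z = of_real b powr (- z) * of_real a powr z"
proof -
  have "complex_of_real (inverse b * a) powr z = of_real (inverse b) powr z * of_real a powr z"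
    unfolding of_real_mult using assms by (intro powr_times_real) auto
  also have "complex_of_real (inverse b) powr z = of_real b powr (- z)"
    using assms(1) by (simp add: powr_def Ln_of_real ln_inverse flip: of_real_inverse)
  finally show ?thesis .
qed

lemma norm_unit_powr_le_1:
  assumes "0 \<le> a" "a \<le> 1" "0 \<le> Re z"
  shows "norm (complex_of_real a powr z) \<le> 1"
proof (cases "a = 0")
  case False
  then have "norm (complex_of_real a powr z) = exp (Re z * ln a)"
    using assms by (simp add: powr_def Ln_of_real)
  also have "\<dots> \<le> exp 0"
    using assms False by (subst exp_le_cancel_iff) (simp add: mult_nonneg_nonpos)
  finally show ?thesis by simp
qed simp

definition supported :: "nat set \<Rightarrow> linform set \<Rightarrow> bool" where
  "supported I F \<longleftrightarrow> finite I \<and> finite F \<and> (\<forall>L\<in>F. linform_supp L \<subseteq> I)"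

text \<open>Nonnegative real parts bound all integrands by 1, which settles integrability, and keep
  the weights of the forms in the closed unit disc.\<close>

locale haar_zeta = haar \<mu> q for \<mu> :: "'a::compact_dvr measure" and q +
  fixes s :: "linform \<Rightarrow> complex"
  assumes Re_s: "0 \<le> Re (s L)"
begin

definition form_prod :: "linform set \<Rightarrow> (nat \<Rightarrow> 'a) \<Rightarrow> complex" where
  "form_prod F x = (\<Prod>L\<in>F. complex_of_real (dvr_abs (leval L x)) powr s L)"

definition zeta_int :: "nat set \<Rightarrow> linform set \<Rightarrow> complex" where
  "zeta_int I F = (\<integral>x. form_prod F x \<partial>power_measure I)"

definition form_weight :: "linform \<Rightarrow> complex" where
  "form_weight L = of_nat q powr (- s L)"

text \<open>
  The contribution to a zeta integral of a residue class modulo the uniformizer: its measure, the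
  scaling factor of the forms vanishing on it, and the zeta integral of these forms.
\<close>

definition block_zeta :: "nat set \<Rightarrow> linform set \<Rightarrow> complex" where
  "block_zeta I F = inverse (of_nat q) ^ card I * (\<Prod>L\<in>F. form_weight L) * zeta_int I F"

lemma norm_form_prod: "norm (form_prod F x) \<le> 1"
proof -
  have "norm (form_prod F x) \<le> (\<Prod>L\<in>F. 1)"
    unfolding form_prod_def prod_norm[symmetric]
    by (intro prod_mono conjI norm_ge_zero norm_unit_powr_le_1 dvr_abs_nonneg dvr_abs_le_1 Re_s)
  then show ?thesis by simp
qed

lemma form_prod_restrict: "supported I F \<Longrightarrow> form_prod F (restrict x I) = form_prod F x"
proof -
  assume "supported I F"
  then have "leval L (restrict x I) = leval L x" if "L \<in> F" for L
    using that by (intro leval_cong) (auto simp: supported_def)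
  then show ?thesis unfolding form_prod_def by (intro prod.cong) auto
qed

lemma measurable_leval:
  assumes "finite I" "linform_supp L \<subseteq> I"
  shows "leval L \<in> measurable (power_measure I) borel"
proof -
  have summand: "(\<lambda>x. of_int (L i) * x i) \<in> measurable (power_measure I) borel" if "i \<in> I" for i
  proof -
    have "(\<lambda>x. 0 + of_int (L i) * x) \<in> measurable \<mu> borel"
      using borel_measurable_dvr_affine[of 0 "of_int (L i)"]
      by (simp cong: measurable_cong_sets add: sets_haar)
    then have "(\<lambda>x. 0 + of_int (L i) * x i) \<in> measurable (power_measure I) borel"
      by (rule measurable_compose[OF measurable_component_singleton[OF that]])
    then show ?thesis by simp
  qed
  have "(\<lambda>x. \<Sum>i\<in>J. of_int (L i) * x i) \<in> measurable (power_measure I) borel" if "finite J" "J \<subseteq> I" for J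
    using that
  proof (induction J rule: finite_induct)
    case (insert i J)
    then show ?case using summand[of i] by (simp add: borel_measurable_dvr_add)
  qed simp
  from this[OF assms(1) subset_refl] show ?thesis
    using leval_eq_sum[OF assms] by (subst measurable_cong[of _ _ "\<lambda>x. \<Sum>i\<in>I. of_int (L i) * x i"]) auto
qed

lemma measurable_form_prod:
  assumes "supported I F"
  shows "form_prod F \<in> borel_measurable (power_measure I)"
  unfolding form_prod_def
proof (rule borel_measurable_prod)
  fix L assume "L \<in> F"
  then have "leval L \<in> measurable (power_measure I) borel"
    using assms by (intro measurable_leval) (auto simp: supported_def)
  then have "(\<lambda>x. dvr_abs (leval L x)) \<in> borel_measurable (power_measure I)"
    by (rule measurable_compose[OF _ borel_measurable_dvr_abs])
  \<comment> \<open>The complex power of a nonnegative base, written as an explicit Borel function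
    of the base; its value at the base 0 is 0 by convention.\<close>
  moreover have "(\<lambda>t. if t = 0 then 0 else exp (s L * complex_of_real (ln t))) \<in> borel_measurable borel"
    by measurable
  ultimately have "(\<lambda>x.
      if dvr_abs (leval L x) = 0 then 0 else exp (s L * complex_of_real (ln (dvr_abs (leval L x)))))
      \<in> borel_measurable (power_measure I)"
    by (rule measurable_compose)
  moreover have "complex_of_real (dvr_abs (leval L x)) powr s L =
      (if dvr_abs (leval L x) = 0 then 0 else exp (s L * complex_of_real (ln (dvr_abs (leval L x)))))"
          for x :: "nat \<Rightarrow> 'a"
    using dvr_abs_nonneg[of "leval L x"] by (auto simp: powr_def Ln_of_real)
  ultimately show "(\<lambda>x. complex_of_real (dvr_abs (leval L x)) powr s L) \<in>
      borel_measurable (power_measure I)"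
    by presburger
qed

lemma zeta_int_empty [simp]: "zeta_int {} {} = 1"
proof -
  have "measure (power_measure {}) (space (power_measure {})) = 1"
    using emeasure_PiM[of "{}" "\<lambda>_. UNIV"] by (simp add: measure_def space_PiM)
  then show ?thesis unfolding zeta_int_def form_prod_def by simp
qed

lemma block_zeta_empty [simp]: "block_zeta {} {} = 1"
  by (simp add: block_zeta_def)

lemma zeta_int_no_forms: "finite I \<Longrightarrow> zeta_int I {} = 1"
proof -
  assume "finite I"
  then have "emeasure (power_measure I) (Pi\<^sub>E I (\<lambda>_. UNIV)) = (\<Prod>i\<in>I. emeasure \<mu> UNIV)"
    by (intro emeasure_PiM) (auto simp: sets_haar)
  then show ?thesis unfolding zeta_int_def form_prod_def by (simp add: measure_def space_PiM)
qed

lemma zeta_int_Un: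
  assumes "supported I F" "supported J G" "I \<inter> J = {}" "F \<inter> G = {}"
  shows "zeta_int (I \<union> J) (F \<union> G) = zeta_int I F * zeta_int J G"
proof -
  have "form_prod (F \<union> G) x = form_prod F x * form_prod G x" for x
    unfolding form_prod_def using assms by (intro prod.union_disjoint) (auto simp: supported_def)
  then have "zeta_int (I \<union> J) (F \<union> G) = (\<integral>x. form_prod F x * form_prod G x \<partial>power_measure (I \<union> J))"
    unfolding zeta_int_def by presburger
  also have "\<dots> = zeta_int I F * zeta_int J G"
    unfolding zeta_int_def
    using assms by (intro integral_disjoint norm_form_prod measurable_form_prod form_prod_restrict)
        (auto simp: supported_def)
  finally show ?thesis .
qed

text \<open>All three factors of \<open>block_zeta\<close> are multiplicative over disjoint sets of
  coordinates and forms, the integral by Fubini's theorem.\<close>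

lemma block_zeta_Un:
  assumes "supported I F" "supported J G" "I \<inter> J = {}" "F \<inter> G = {}"
  shows "block_zeta (I \<union> J) (F \<union> G) = block_zeta I F * block_zeta J G"
proof -
  have "card (I \<union> J) = card I + card J"
    using assms by (intro card_Un_disjoint) (auto simp: supported_def)
  moreover have "(\<Prod>L\<in>F \<union> G. form_weight L) = (\<Prod>L\<in>F. form_weight L) * (\<Prod>L\<in>G. form_weight L)"
    using assms by (intro prod.union_disjoint) (auto simp: supported_def)
  ultimately show ?thesis unfolding block_zeta_def zeta_int_Un[OF assms] by (simp add: power_add)
qed

lemma block_zeta_UN:
  assumes "finite P" "\<And>C. C \<in> P \<Longrightarrow> supported (J C) (F C)"
    and "disjoint_family_on J P" "disjoint_family_on F P"
  shows "block_zeta (\<Union>C\<in>P. J C) (\<Union>C\<in>P. F C) = (\<Prod>C\<in>P. block_zeta (J C) (F C))"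
  using assms
proof (induction P rule: finite_induct)
  case (insert C P)
  have "supported (\<Union>C\<in>P. J C) (\<Union>C\<in>P. F C)"
    using insert.hyps(1) insert.prems(1) unfolding supported_def by (simp, blast)
  moreover have "J C \<inter> (\<Union>C\<in>P. J C) = {}" "F C \<inter> (\<Union>C\<in>P. F C) = {}"
    using insert.prems(2,3) insert.hyps(2) unfolding disjoint_family_on_def by auto
  moreover have "disjoint_family_on J P" "disjoint_family_on F P"
    using insert.prems(2,3) by (auto simp: disjoint_family_on_def)
  ultimately show ?case
    using insert by (simp add: block_zeta_Un)
qed simp

text \<open>The forms vanishing on a digit vector are rescaled by the uniformizer; the others become units.\<close>

lemma zeta_int_digits:
  fixes R :: "nat \<Rightarrow> 'a set"
  assumes F: "supported I F" and R: "\<And>i. residue_system (R i)"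
    and unit: "\<And>r L. r \<in> Pi\<^sub>E I R \<Longrightarrow> L \<in> F \<Longrightarrow> leval L r \<noteq> 0 \<Longrightarrow> \<not> unif dvd leval L r"
  shows "zeta_int I F = (\<Sum>r\<in>Pi\<^sub>E I R. block_zeta I {L \<in> F. leval L r = 0})"
proof -
  have fin: "finite I" "finite F" using F by (auto simp: supported_def)
  have shift: "form_prod F (\<lambda>i\<in>I. r i + unif * x i) =
      (\<Prod>L\<in>{L \<in> F. leval L r = 0}. form_weight L) * form_prod {L \<in> F. leval L r = 0} x" if r: "r \<in>
          Pi\<^sub>E I R" for r x
  proof -
    have "complex_of_real (dvr_abs (leval L (\<lambda>i\<in>I. r i + unif * x i))) powr s L =
      (if leval L r = 0 then form_weight L * (complex_of_real (dvr_abs (leval L x)) powr s L) else 1)"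
          if L: "L \<in> F" for L
    proof -
      have "leval L (\<lambda>i\<in>I. r i + unif * x i) = leval L (\<lambda>i. r i + unif * x i)"
        using F L by (intro leval_cong) (auto simp: supported_def)
      then have eq: "leval L (\<lambda>i\<in>I. r i + unif * x i) = leval L r + unif * leval L x"
        unfolding leval_digits .
      show ?thesis
      proof (cases "leval L r = 0")
        case True
        then have "dvr_abs (leval L (\<lambda>i\<in>I. r i + unif * x i)) = inverse (real q) * dvr_abs (leval L x)"
          unfolding eq q using dvr_abs_unif_mult by simp
        then show ?thesis
          using True complex_powr_scale[OF q_pos(1) dvr_abs_nonneg]
          by (simp only: form_weight_def refl if_True of_real_of_nat_eq)
      next
        case False
        have "\<not> unif dvd leval L r + unif * leval L x"
          using unit[OF r L False] by (metis dvd_add_left_iff dvd_triv_left)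
        then show ?thesis unfolding eq using False by (simp add: unit_iff dvr_abs_unit)
      qed
    qed
    then have "form_prod F (\<lambda>i\<in>I. r i + unif * x i) =
      (\<Prod>L\<in>F. if leval L r = 0 then form_weight L *
          (complex_of_real (dvr_abs (leval L x)) powr s L) else 1)"
      unfolding form_prod_def by (rule prod.cong[OF refl])
    also have "\<dots> = (\<Prod>L\<in>{L \<in> F. leval L r = 0}. form_weight L *
        (complex_of_real (dvr_abs (leval L x)) powr s L))"
      using fin(2) by (rule prod.inter_filter[symmetric])
    finally show ?thesis by (simp add: form_prod_def prod.distrib)
  qed
  have "zeta_int I F = inverse (of_nat q) ^ card I *
      (\<Sum>r\<in>Pi\<^sub>E I R. \<integral>x. form_prod F (\<lambda>i\<in>I. r i + unif * x i) \<partial>power_measure I)"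
    unfolding zeta_int_def by (rule integral_digits[OF fin(1) R measurable_form_prod[OF F]
        norm_form_prod])
  also have "\<dots> = (\<Sum>r\<in>Pi\<^sub>E I R. block_zeta I {L \<in> F. leval L r = 0})"
    unfolding sum_distrib_left block_zeta_def zeta_int_def by (rule sum.cong[OF refl]) (simp add: shift)
  finally show ?thesis .
qed

end

section \<open>Sums over set partitions\<close>

definition classes :: "('i \<Rightarrow> 'k) \<Rightarrow> 'i set \<Rightarrow> 'i set set" where
  "classes h N = (\<lambda>i. {j \<in> N. h j = h i}) ` N"

definition part_of :: "'i set set \<Rightarrow> 'i \<Rightarrow> 'i set" where
  "part_of P i = (THE C. C \<in> P \<and> i \<in> C)"

lemma partition_on_classes: "partition_on N (classes h N)"
  unfolding partition_on_def classes_def disjoint_def by auto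

lemma classes_cong: "(\<And>i. i \<in> N \<Longrightarrow> h i = k i) \<Longrightarrow> classes h N = classes k N"
  unfolding classes_def by (intro image_cong) auto

lemma part_of_eq:
  assumes "partition_on N P" "C \<in> P" "i \<in> C"
  shows "part_of P i = C"
  unfolding part_of_def
  using assms by (intro the_equality) (auto simp: partition_on_def disjoint_def)

lemma part_of:
  assumes "partition_on N P" "i \<in> N"
  shows "part_of P i \<in> P" "i \<in> part_of P i"
proof -
  obtain C where "C \<in> P" "i \<in> C" using assms by (auto simp: partition_on_def)
  then show "part_of P i \<in> P" "i \<in> part_of P i" using part_of_eq[OF assms(1)] by auto
qed

lemma the_elem_class:
  assumes "C \<in> classes h N" "i \<in> C"
  shows "the_elem (h ` C) = h i"
proof -
  have "h ` C = {h i}" using assms by (auto simp: classes_def)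
  then show ?thesis by simp
qed

lemma classes_part_of:
  assumes P: "partition_on N P" and \<rho>: "inj_on \<rho> P"
  shows "classes (\<lambda>i. \<rho> (part_of P i)) N = P"
proof -
  have "{j \<in> N. \<rho> (part_of P j) = \<rho> (part_of P i)} = part_of P i" if i: "i \<in> N" for i
  proof (intro equalityI subsetI)
    fix j assume "j \<in> {j \<in> N. \<rho> (part_of P j) = \<rho> (part_of P i)}"
    then have "j \<in> N" "part_of P j = part_of P i"
      using \<rho> part_of(1)[OF P] i by (auto dest: inj_onD)
    then show "j \<in> part_of P i" using part_of(2)[OF P] by metis
  next
    fix j assume j: "j \<in> part_of P i"
    then have "part_of P j = part_of P i" using part_of_eq[OF P] part_of(1)[OF P i] by blast
    moreover have "j \<in> N" using j part_of(1)[OF P i] P by (auto simp: partition_on_def)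
    ultimately show "j \<in> {j \<in> N. \<rho> (part_of P j) = \<rho> (part_of P i)}" by simp
  qed
  then have "classes (\<lambda>i. \<rho> (part_of P i)) N = part_of P ` N"
    unfolding classes_def by (intro image_cong) auto
  also have "\<dots> = P"
  proof (intro equalityI subsetI)
    fix C assume C: "C \<in> P"
    then have "C \<noteq> {}" using partition_onD3[OF P] by metis
    then obtain i where "i \<in> C" by blast
    moreover have "i \<in> N" using calculation C P by (auto simp: partition_on_def)
    ultimately show "C \<in> part_of P ` N" using part_of_eq[OF P C] by (intro image_eqI[of _ _ i]) auto
  qed (use part_of(1)[OF P] in auto)
  finally show ?thesis .
qed

lemma finite_partitions: "finite N \<Longrightarrow> finite {P. partition_on N P}"
  by (rule finitely_many_partition_on)

lemma finite_partition_element: "finite N \<Longrightarrow> partition_on N P \<Longrightarrow> C \<in> P \<Longrightarrow> finite C"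
  using finite_subset[of C N] by (auto simp: partition_on_def)

text \<open>A function on \<open>N\<close> amounts to the partition into its fibres together with an
  injective map on the blocks, which assigns to each fibre its value.\<close>

lemma sum_classes:
  fixes \<Psi> :: "'i set \<Rightarrow> 'k \<Rightarrow> 'c::comm_semiring_1"
  assumes fin: "finite N" "finite K"
  shows "(\<Sum>h\<in>N \<rightarrow>\<^sub>E K. \<Prod>C\<in>classes h N. \<Psi> C (the_elem (h ` C))) =
    (\<Sum>P\<in>{P. partition_on N P}. \<Sum>\<rho>\<in>{\<rho> \<in> P \<rightarrow>\<^sub>E K. inj_on \<rho> P}. \<Prod>C\<in>P. \<Psi> C (\<rho> C))"
proof -
  let ?S = "SIGMA P:{P. partition_on N P}. {\<rho> \<in> P \<rightarrow>\<^sub>E K. inj_on \<rho> P}"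
  let ?j = "\<lambda>h. (classes h N, \<lambda>C\<in>classes h N. the_elem (h ` C))"
  let ?i = "\<lambda>(P, \<rho>). \<lambda>i\<in>N. \<rho> (part_of P i)"
  have ij: "?i (?j h) = h \<and> ?j h \<in> ?S" if h: "h \<in> N \<rightarrow>\<^sub>E K" for h
  proof
    have mem: "part_of (classes h N) i \<in> classes h N" "i \<in> part_of (classes h N) i" if "i \<in> N" for i
      using part_of[OF partition_on_classes that] .
    show "?i (?j h) = h"
    proof
      fix i
      show "?i (?j h) i = h i"
        using h mem[of i] the_elem_class[of "part_of (classes h N) i" h N i] by (cases "i \<in> N") auto
    qed
    have "the_elem (h ` C) \<in> K" if "C \<in> classes h N" for C
    proof -
      obtain i where i: "i \<in> N" "C = {j \<in> N. h j = h i}" using \<open>C \<in> classes h N\<close>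
        by (auto simp: classes_def)
      then have "the_elem (h ` C) = h i" using that by (intro the_elem_class) auto
      then show ?thesis using h i by auto
    qed
    moreover have "inj_on (\<lambda>C\<in>classes h N. the_elem (h ` C)) (classes h N)"
    proof (rule inj_onI)
      fix C D assume C: "C \<in> classes h N" and D: "D \<in> classes h N"
        and eq: "(\<lambda>C\<in>classes h N. the_elem (h ` C)) C = (\<lambda>C\<in>classes h N. the_elem (h ` C)) D"
      obtain i where i: "i \<in> N" "C = {j \<in> N. h j = h i}" using C by (auto simp: classes_def)
      obtain k where k: "k \<in> N" "D = {j \<in> N. h j = h k}" using D by (auto simp: classes_def)
      have "h i = h k"
        using eq C D the_elem_class[OF C, of i] the_elem_class[OF D, of k] i k by simp
      then show "C = D" using i k by simp
    qed
    ultimately show "?j h \<in> ?S" using partition_on_classes by auto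
  qed
  have ji: "?j (?i p) = p \<and> ?i p \<in> N \<rightarrow>\<^sub>E K" if p: "p \<in> ?S" for p
  proof -
    obtain P \<rho> where p': "p = (P, \<rho>)" "partition_on N P" "\<rho> \<in> P \<rightarrow>\<^sub>E K" "inj_on \<rho> P" using p by auto
    have cl: "classes (?i p) N = P"
      using classes_part_of[OF p'(2,4)]
      by (subst classes_cong[of N _ "\<lambda>i. \<rho> (part_of P i)"]) (auto simp: p'(1))
    have "(\<lambda>C\<in>P. the_elem (?i p ` C)) = \<rho>"
    proof
      fix C
      show "(\<lambda>C\<in>P. the_elem (?i p ` C)) C = \<rho> C"
      proof (cases "C \<in> P")
        case True
        then have "C \<noteq> {}" using partition_onD3[OF p'(2)] by metis
        then obtain i where i: "i \<in> C" by blast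
        have "the_elem (?i p ` C) = ?i p i" using cl True i by (intro the_elem_class[of _ _ N]) auto
        also have "\<dots> = \<rho> C" using part_of_eq[OF p'(2) True i] True i p'(1,2)
          by (auto simp: partition_on_def)
        finally show ?thesis using True by simp
      qed (use p'(3) in auto)
    qed
    moreover have "?i p \<in> N \<rightarrow>\<^sub>E K" using part_of(1)[OF p'(2)] p'(3) by (auto simp: p'(1))
    ultimately show ?thesis using cl by (simp add: p'(1))
  qed
  have "(\<Sum>P\<in>{P. partition_on N P}. \<Sum>\<rho>\<in>{\<rho> \<in> P \<rightarrow>\<^sub>E K. inj_on \<rho> P}. \<Prod>C\<in>P. \<Psi> C (\<rho> C)) =
    (\<Sum>(P, \<rho>)\<in>?S. \<Prod>C\<in>P. \<Psi> C (\<rho> C))"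
  proof (rule sum.Sigma)
    show "\<forall>P\<in>{P. partition_on N P}. finite {\<rho> \<in> P \<rightarrow>\<^sub>E K. inj_on \<rho> P}"
      using fin(2) finite_elements[OF fin(1)]
      by (intro ballI finite_subset[OF Collect_subset] finite_PiE) auto
  qed (use finite_partitions[OF fin(1)] in simp)
  also have "\<dots> = (\<Sum>h\<in>N \<rightarrow>\<^sub>E K. \<Prod>C\<in>classes h N. \<Psi> C (the_elem (h ` C)))"
  proof (rule sum.reindex_bij_witness[where i = ?j and j = ?i])
    fix p assume p: "p \<in> ?S"
    show "?j (?i p) = p" using ji[OF p] by blast
    show "?i p \<in> N \<rightarrow>\<^sub>E K" using ji[OF p] by blast
    have "(\<Prod>C\<in>classes (?i p) N. \<Psi> C (the_elem (?i p ` C))) =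
        (case ?j (?i p) of (P, \<rho>) \<Rightarrow> \<Prod>C\<in>P. \<Psi> C (\<rho> C))"
      unfolding prod.case by (rule prod.cong[OF refl]) simp
    then show "(\<Prod>C\<in>classes (?i p) N. \<Psi> C (the_elem (?i p ` C))) = (case p of (P, \<rho>) \<Rightarrow> \<Prod>C\<in>P. \<Psi> C (\<rho> C))"
      unfolding \<open>?j (?i p) = p\<close> .
  next
    fix h assume h: "h \<in> N \<rightarrow>\<^sub>E K"
    show "?i (?j h) = h" "?j h \<in> ?S" using ij[OF h] by blast+
  qed
  finally show ?thesis by simp
qed

text \<open>Digit vectors are sorted by the vector \<open>h\<close> of their values under
  \<open>\<kappa>\<close>, the datum that determines the partition.\<close>

lemma sum_PiE_fibres:
  fixes \<Phi> :: "('i \<Rightarrow> 'a) \<Rightarrow> 'c::comm_monoid_add"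
  assumes fin: "finite N" "finite K" "\<And>i. finite (R i)"
    and \<kappa>: "\<And>i a. i \<in> N \<Longrightarrow> a \<in> R i \<Longrightarrow> \<kappa> i a \<in> K"
  shows "(\<Sum>r\<in>Pi\<^sub>E N R. \<Phi> r) = (\<Sum>h\<in>N \<rightarrow>\<^sub>E K. \<Sum>r\<in>(\<Pi>\<^sub>E i\<in>N. {a \<in> R i. \<kappa> i a = h i}). \<Phi> r)"
proof -
  have "(\<Sum>h\<in>N \<rightarrow>\<^sub>E K. \<Sum>r\<in>(\<Pi>\<^sub>E i\<in>N. {a \<in> R i. \<kappa> i a = h i}). \<Phi> r) =
    (\<Sum>(h, r)\<in>(SIGMA h:N \<rightarrow>\<^sub>E K. \<Pi>\<^sub>E i\<in>N. {a \<in> R i. \<kappa> i a = h i}). \<Phi> r)"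
    using fin by (intro sum.Sigma) (auto intro!: finite_PiE)
  also have "\<dots> = (\<Sum>r\<in>Pi\<^sub>E N R. \<Phi> r)"
  proof (rule sum.reindex_bij_witness[where j = snd and i = "\<lambda>r. (\<lambda>i\<in>N. \<kappa> i (r i), r)"])
    fix p assume p: "p \<in> (SIGMA h:N \<rightarrow>\<^sub>E K. \<Pi>\<^sub>E i\<in>N. {a \<in> R i. \<kappa> i a = h i})"
    then obtain h r where hr: "p = (h, r)" "h \<in> N \<rightarrow>\<^sub>E K" "r \<in> (\<Pi>\<^sub>E i\<in>N. {a \<in> R i. \<kappa> i a = h i})" by auto
    have "(\<lambda>i\<in>N. \<kappa> i (r i)) = h"
    proof
      fix i
      show "(\<lambda>i\<in>N. \<kappa> i (r i)) i = h i"
        using hr(2) PiE_mem[OF hr(3), of i] by (cases "i \<in> N") auto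
    qed
    then show "(\<lambda>i\<in>N. \<kappa> i (snd p i), snd p) = p" using hr(1) by simp
    show "snd p \<in> Pi\<^sub>E N R" using hr by (auto simp: PiE_iff)
  qed (use \<kappa> in \<open>auto simp: PiE_iff\<close>)
  finally show ?thesis by simp
qed

text \<open>A function on \<open>N\<close> is a family of functions on the blocks, so this is the
  distributive law.\<close>

lemma sum_PiE_partition:
  fixes \<phi> :: "'i set \<Rightarrow> ('i \<Rightarrow> 'a) \<Rightarrow> 'c::comm_semiring_1"
  assumes fin: "finite N" "\<And>i. finite (A i)" and P: "partition_on N P"
  shows "(\<Sum>r\<in>Pi\<^sub>E N A. \<Prod>C\<in>P. \<phi> C (restrict r C)) = (\<Prod>C\<in>P. \<Sum>r\<in>Pi\<^sub>E C A. \<phi> C r)"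
proof -
  have sub: "C \<subseteq> N" if "C \<in> P" for C using P that by (auto simp: partition_on_def)
  have "(\<Prod>C\<in>P. \<Sum>r\<in>Pi\<^sub>E C A. \<phi> C r) = (\<Sum>g\<in>(\<Pi>\<^sub>E C\<in>P. Pi\<^sub>E C A). \<Prod>C\<in>P. \<phi> C (g C))"
    using finite_elements[OF fin(1) P] finite_partition_element[OF fin(1) P] fin(2)
    by (intro prod_sum_PiE finite_PiE) auto
  also have "\<dots> = (\<Sum>r\<in>Pi\<^sub>E N A. \<Prod>C\<in>P. \<phi> C (restrict r C))"
  proof (rule sum.reindex_bij_witness[where j = "\<lambda>g. \<lambda>i\<in>N. g (part_of P i) i"
      and i = "\<lambda>r. \<lambda>C\<in>P. restrict r C"])
    fix g assume g: "g \<in> (\<Pi>\<^sub>E C\<in>P. Pi\<^sub>E C A)"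
    have *: "restrict (\<lambda>i\<in>N. g (part_of P i) i) C = g C" if C: "C \<in> P" for C
    proof
      fix i
      have "g C \<in> Pi\<^sub>E C A" using g C by auto
      then show "restrict (\<lambda>i\<in>N. g (part_of P i) i) C i = g C i"
        using sub[OF C] part_of_eq[OF P C, of i] by (cases "i \<in> C") auto
    qed
    show "(\<lambda>C\<in>P. restrict (\<lambda>i\<in>N. g (part_of P i) i) C) = g"
    proof
      fix C
      show "(\<lambda>C\<in>P. restrict (\<lambda>i\<in>N. g (part_of P i) i) C) C = g C"
        using *[of C] g by (cases "C \<in> P") auto
    qed
    show "(\<Prod>C\<in>P. \<phi> C (restrict (\<lambda>i\<in>N. g (part_of P i) i) C)) = (\<Prod>C\<in>P. \<phi> C (g C))"
      using * by (intro prod.cong) auto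
    have "g (part_of P i) i \<in> A i" if i: "i \<in> N" for i
    proof -
      have "g (part_of P i) \<in> Pi\<^sub>E (part_of P i) A" using g part_of(1)[OF P i] by auto
      then show ?thesis using part_of(2)[OF P i] by auto
    qed
    then show "(\<lambda>i\<in>N. g (part_of P i) i) \<in> Pi\<^sub>E N A" by auto
  next
    fix r assume r: "r \<in> Pi\<^sub>E N A"
    show "(\<lambda>i\<in>N. (\<lambda>C\<in>P. restrict r C) (part_of P i) i) = r"
    proof
      fix i
      show "(\<lambda>i\<in>N. (\<lambda>C\<in>P. restrict r C) (part_of P i) i) i = r i"
        using r part_of[OF P, of i] by (cases "i \<in> N") auto
    qed
    show "(\<lambda>C\<in>P. restrict r C) \<in> (\<Pi>\<^sub>E C\<in>P. Pi\<^sub>E C A)" using r sub by (auto simp: PiE_iff)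
  qed
  finally show ?thesis by simp
qed

text \<open>
  A digit vector consists of the partition into the classes of \<open>\<kappa>\<close>, pairwise different values on the
  classes, and a choice of digits with these values in each class.
\<close>

lemma sum_digit_vectors:
  fixes \<phi> :: "'i set \<Rightarrow> ('i \<Rightarrow> 'a) \<Rightarrow> 'c::comm_semiring_1"
  assumes fin: "finite N" "finite K" "\<And>i. finite (R i)"
    and \<kappa>: "\<And>i a. i \<in> N \<Longrightarrow> a \<in> R i \<Longrightarrow> \<kappa> i a \<in> K"
  shows "(\<Sum>r\<in>Pi\<^sub>E N R. \<Prod>C\<in>classes (\<lambda>i. \<kappa> i (r i)) N. \<phi> C (restrict r C)) =
    (\<Sum>P\<in>{P. partition_on N P}. \<Sum>\<rho>\<in>{\<rho> \<in> P \<rightarrow>\<^sub>E K. inj_on \<rho> P}.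
       \<Prod>C\<in>P. \<Sum>r\<in>(\<Pi>\<^sub>E i\<in>C. {a \<in> R i. \<kappa> i a = \<rho> C}). \<phi> C r)"
proof -
  let ?A = "\<lambda>h i. {a \<in> R i. \<kappa> i a = h i}"
  have "(\<Sum>r\<in>Pi\<^sub>E N R. \<Prod>C\<in>classes (\<lambda>i. \<kappa> i (r i)) N. \<phi> C (restrict r C)) =
    (\<Sum>h\<in>N \<rightarrow>\<^sub>E K. \<Sum>r\<in>Pi\<^sub>E N (?A h). \<Prod>C\<in>classes (\<lambda>i. \<kappa> i (r i)) N. \<phi> C (restrict r C))"
    by (rule sum_PiE_fibres[OF fin \<kappa>])
  also have "\<dots> = (\<Sum>h\<in>N \<rightarrow>\<^sub>E K. \<Prod>C\<in>classes h N. \<Sum>r\<in>(\<Pi>\<^sub>E i\<in>C. {a \<in> R i. \<kappa> i a = the_elem (h ` C)}). \<phi> C r)"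
  proof (rule sum.cong[OF refl])
    fix h assume h: "h \<in> N \<rightarrow>\<^sub>E K"
    have "(\<Sum>r\<in>Pi\<^sub>E N (?A h). \<Prod>C\<in>classes (\<lambda>i. \<kappa> i (r i)) N. \<phi> C (restrict r C)) =
      (\<Sum>r\<in>Pi\<^sub>E N (?A h). \<Prod>C\<in>classes h N. \<phi> C (restrict r C))"
    proof (rule sum.cong[OF refl])
      fix r assume "r \<in> Pi\<^sub>E N (?A h)"
      then have "classes (\<lambda>i. \<kappa> i (r i)) N = classes h N" by (intro classes_cong) auto
      then show "(\<Prod>C\<in>classes (\<lambda>i. \<kappa> i (r i)) N. \<phi> C (restrict r C)) =
          (\<Prod>C\<in>classes h N. \<phi> C (restrict r C))"
        by simp
    qed
    also have "\<dots> = (\<Prod>C\<in>classes h N. \<Sum>r\<in>Pi\<^sub>E C (?A h). \<phi> C r)"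
      using fin by (intro sum_PiE_partition partition_on_classes) auto
    also have "\<dots> = (\<Prod>C\<in>classes h N. \<Sum>r\<in>(\<Pi>\<^sub>E i\<in>C. {a \<in> R i. \<kappa> i a = the_elem (h ` C)}). \<phi> C r)"
    proof (rule prod.cong[OF refl])
      fix C assume C: "C \<in> classes h N"
      have "Pi\<^sub>E C (?A h) = (\<Pi>\<^sub>E i\<in>C. {a \<in> R i. \<kappa> i a = the_elem (h ` C)})"
        by (rule PiE_cong) (simp add: the_elem_class[OF C])
      then show "(\<Sum>r\<in>Pi\<^sub>E C (?A h). \<phi> C r) = (\<Sum>r\<in>(\<Pi>\<^sub>E i\<in>C. {a \<in> R i. \<kappa> i a = the_elem (h ` C)}). \<phi> C r)"
        by simp
    qed
    finally show "(\<Sum>r\<in>Pi\<^sub>E N (?A h). \<Prod>C\<in>classes (\<lambda>i. \<kappa> i (r i)) N. \<phi> C (restrict r C)) =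
      (\<Prod>C\<in>classes h N. \<Sum>r\<in>(\<Pi>\<^sub>E i\<in>C. {a \<in> R i. \<kappa> i a = the_elem (h ` C)}). \<phi> C r)" .
  qed
  also have "\<dots> = (\<Sum>P\<in>{P. partition_on N P}. \<Sum>\<rho>\<in>{\<rho> \<in> P \<rightarrow>\<^sub>E K. inj_on \<rho> P}.
       \<Prod>C\<in>P. \<Sum>r\<in>(\<Pi>\<^sub>E i\<in>C. {a \<in> R i. \<kappa> i a = \<rho> C}). \<phi> C r)"
    by (rule sum_classes[OF fin(1,2)])
  finally show ?thesis .
qed

text \<open>This serves two purposes: counting injections recursively, and pinning the class of the
  label 0 to the digit 0.\<close>

lemma bij_betw_inj_insert:
  assumes "a \<notin> A" "b \<in> B"
  shows "bij_betw (\<lambda>\<rho>. \<rho>(a := b)) {\<rho> \<in> A \<rightarrow>\<^sub>E B - {b}. inj_on \<rho> A}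
    {\<rho> \<in> insert a A \<rightarrow>\<^sub>E B. inj_on \<rho> (insert a A) \<and> \<rho> a = b}"
proof (rule bij_betw_byWitness[where f' = "\<lambda>\<rho>. \<rho>(a := undefined)"])
  show "\<forall>\<rho>\<in>{\<rho> \<in> A \<rightarrow>\<^sub>E B - {b}. inj_on \<rho> A}. (\<rho>(a := b))(a := undefined) = \<rho>"
    using assms by (auto simp: PiE_iff extensional_def fun_eq_iff)
  show "(\<lambda>\<rho>. \<rho>(a := b)) ` {\<rho> \<in> A \<rightarrow>\<^sub>E B - {b}. inj_on \<rho> A} \<subseteq>
      {\<rho> \<in> insert a A \<rightarrow>\<^sub>E B. inj_on \<rho> (insert a A) \<and> \<rho> a = b}"
    using assms by (auto simp: PiE_iff extensional_def inj_on_def split: if_splits)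
  show "(\<lambda>\<rho>. \<rho>(a := undefined)) ` {\<rho> \<in> insert a A \<rightarrow>\<^sub>E B. inj_on \<rho> (insert a A) \<and> \<rho> a = b} \<subseteq>
      {\<rho> \<in> A \<rightarrow>\<^sub>E B - {b}. inj_on \<rho> A}"
  proof (intro image_subsetI)
    fix \<rho> assume "\<rho> \<in> {\<rho> \<in> insert a A \<rightarrow>\<^sub>E B. inj_on \<rho> (insert a A) \<and> \<rho> a = b}"
    then have \<rho>: "\<rho> \<in> insert a A \<rightarrow>\<^sub>E B" "inj_on \<rho> (insert a A)" "\<rho> a = b" by auto
    have "\<rho> i \<noteq> b" if "i \<in> A" for i
      using inj_onD[OF \<rho>(2), of i a] \<rho>(3) that assms(1) by auto
    moreover have "inj_on (\<rho>(a := undefined)) A"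
      using \<rho>(2) assms(1) by (simp add: inj_on_def)
    moreover have "\<rho> i = undefined" if "i \<notin> A" "i \<noteq> a" for i
      using PiE_arb[OF \<rho>(1)] that by blast
    ultimately show "\<rho>(a := undefined) \<in> {\<rho> \<in> A \<rightarrow>\<^sub>E B - {b}. inj_on \<rho> A}"
      using \<rho>(1) assms(1) by (auto simp: PiE_iff extensional_def)
  qed
qed auto

text \<open>A falling factorial. With too few values a factor vanishes by truncated subtraction, in
  agreement with the absence of injections.\<close>

lemma card_inj_PiE:
  assumes "finite A" "finite B"
  shows "card {\<rho> \<in> A \<rightarrow>\<^sub>E B. inj_on \<rho> A} = (\<Prod>i<card A. card B - i)"
  using assms
proof (induction A arbitrary: B rule: finite_induct)
  case empty
  have "{\<rho> \<in> {} \<rightarrow>\<^sub>E B. inj_on \<rho> {}} = {\<lambda>_. undefined}" by auto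
  then show ?case by simp
next
  case (insert a A)
  let ?S = "\<lambda>b. {\<rho> \<in> insert a A \<rightarrow>\<^sub>E B. inj_on \<rho> (insert a A) \<and> \<rho> a = b}"
  have "{\<rho> \<in> insert a A \<rightarrow>\<^sub>E B. inj_on \<rho> (insert a A)} = (\<Union>b\<in>B. ?S b)" by auto
  moreover have "card (\<Union>b\<in>B. ?S b) = (\<Sum>b\<in>B. card (?S b))"
    using insert.prems insert.hyps(1)
    by (intro card_UN_disjoint) (auto intro!: finite_subset[OF _ finite_PiE[of "insert a A" "\<lambda>_. B"]])
  moreover have "card (?S b) = (\<Prod>i<card A. (card B - 1) - i)" if b: "b \<in> B" for b
    using bij_betw_same_card[OF bij_betw_inj_insert[OF insert.hyps(2) b]] insert.IH[of "B - {b}"]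
      insert.prems b by simp
  ultimately have "card {\<rho> \<in> insert a A \<rightarrow>\<^sub>E B. inj_on \<rho> (insert a A)} =
      card B * (\<Prod>i<card A. card B - Suc i)" by simp
  also have "\<dots> = (\<Prod>i<card (insert a A). card B - i)"
    using insert.hyps by (simp add: prod.lessThan_Suc_shift del: prod.lessThan_Suc)
  finally show ?case .
qed

section \<open>Evaluation of integer polynomials\<close>

definition eval_poly :: "int poly \<Rightarrow> 'a::comm_ring_1 \<Rightarrow> 'a" where
  "eval_poly p y = poly (map_poly of_int p) y"

lemma eval_poly_pCons: "eval_poly (pCons a p) y = of_int a + y * eval_poly p y"
  by (simp add: eval_poly_def map_poly_pCons)

lemma eval_poly_0 [simp]: "eval_poly 0 y = 0"
  by (simp add: eval_poly_def)

lemma eval_poly_1 [simp]: "eval_poly 1 y = 1"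
  by (simp add: eval_poly_def)

lemma eval_poly_add: "eval_poly (p + r) y = eval_poly p y + eval_poly r y"
  by (induction p r rule: poly_induct2) (simp_all add: eval_poly_pCons algebra_simps)

lemma eval_poly_smult: "eval_poly (smult a p) y = of_int a * eval_poly p y"
  by (induction p) (simp_all add: eval_poly_pCons algebra_simps)

lemma eval_poly_mult: "eval_poly (p * r) y = eval_poly p y * eval_poly r y"
  by (induction p) (simp_all add: eval_poly_pCons eval_poly_add eval_poly_smult algebra_simps)

lemma eval_poly_prod: "eval_poly (\<Prod>i\<in>A. f i) y = (\<Prod>i\<in>A. eval_poly (f i) y)"
  by (induction A rule: infinite_finite_induct) (simp_all add: eval_poly_mult)

lemma eval_poly_qnum: "eval_poly (qnum n) y = 1 + of_nat n * y"
  by (simp add: qnum_def eval_poly_pCons mult.commute)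

lemma eval_poly_qfact: "eval_poly (qfact n) y = (\<Prod>i<n. 1 + of_nat (Suc i) * y)"
  unfolding qfact_def eval_poly_prod eval_poly_qnum by (simp add: prod.atLeast1_atMost_eq)

lemma eval_poly_qdfact: "eval_poly (qdfact n) y = (\<Prod>i<n. 1 + of_nat (2 * i + 1) * y)"
  unfolding qdfact_def eval_poly_prod eval_poly_qnum by (simp add: prod.atLeast1_atMost_eq)

text \<open>Truncated subtraction does no harm: once it would occur, the factor with
  \<open>i = m\<close> makes both products zero.\<close>

lemma of_nat_falling: "(of_nat (\<Prod>i<k. m - i) :: complex) = (\<Prod>i<k. of_nat m - of_nat i)"
proof (cases "k \<le> m")
  case True
  then show ?thesis by (auto simp: of_nat_prod of_nat_diff intro!: prod.cong)
next
  case False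
  then have "\<exists>i\<in>{..<k}. m - i = 0" "\<exists>i\<in>{..<k}. of_nat m - of_nat i = (0::complex)"
    by (auto intro!: bexI[of _ m])
  then have "(\<Prod>i<k. m - i) = 0" "(\<Prod>i<k. of_nat m - of_nat i :: complex) = 0"
    using prod_zero[OF finite_lessThan] by metis+
  then show ?thesis by (simp only: of_nat_0)
qed

section \<open>The forms of the arrangements\<close>

text \<open>
  The forms with all variables congruent to a common nonzero digit up to the signs \<open>\<sigma>\<close>, and the forms
  with all variables congruent to 0. The element 0 of \<open>N\<close> stands for a coordinate with value 0.
\<close>

definition signed_forms :: "nat set \<Rightarrow> (nat \<Rightarrow> bool) \<Rightarrow> linform set" where
  "signed_forms C \<sigma> = (\<lambda>(i, j). pair_form (if \<sigma> i = \<sigma> j then 1 else -1) i j) ` {(i, j). i \<in> C \<and>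
      j \<in> C \<and> i < j}"

lemma signed_forms_iff:
  "L \<in> signed_forms C \<sigma> \<longleftrightarrow> (\<exists>i j. i \<in> C \<and> j \<in> C \<and> i < j \<and> L =
      pair_form (if \<sigma> i = \<sigma> j then 1 else -1) i j)"
  by (auto simp: signed_forms_def image_iff)

definition zero_forms :: "arr_type \<Rightarrow> nat set \<Rightarrow> linform set" where
  "zero_forms X N = (\<lambda>(\<epsilon>, i, j). pair_form \<epsilon> i j) ` ({1, -1} \<times> {(i, j). i \<in> N - {0} \<and>
      j \<in> N - {0} \<and> i < j}) \<union>
     (if X = TypeD then {} else coord_form ` (N - {0}))"

lemma zero_forms_iff:
  "L \<in> zero_forms X N \<longleftrightarrow>
    (\<exists>\<epsilon> i j. \<epsilon> \<in> {1, -1} \<and> i \<in> N - {0} \<and> j \<in> N - {0} \<and> i < j \<and> L = pair_form \<epsilon> i j) \<or>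
    X \<noteq> TypeD \<and> (\<exists>k\<in>N - {0}. L = coord_form k)"
  unfolding zero_forms_def by (cases "X = TypeD") (auto simp: image_iff)

lemma supp_pair_form: "i < j \<Longrightarrow> \<epsilon> \<in> {1, -1} \<Longrightarrow> linform_supp (pair_form \<epsilon> i j) = {i, j}"
  by (auto simp: linform_supp_def pair_form_def coord_form_def)

lemma supp_coord_form: "linform_supp (coord_form k) = {k}"
  by (auto simp: linform_supp_def coord_form_def)

lemma leval_pair_form:
  "i < j \<Longrightarrow> \<epsilon> \<in> {1, -1} \<Longrightarrow> leval (pair_form \<epsilon> i j) x = x i - of_int \<epsilon> * x j"
  unfolding leval_def by (subst supp_pair_form) (auto simp: pair_form_def coord_form_def)

lemma leval_coord_form: "leval (coord_form k) x = x k"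
  unfolding leval_def supp_coord_form by (simp add: coord_form_def)

lemma pair_form_inject:
  assumes "pair_form \<epsilon> i j = pair_form \<epsilon>' i' j'" "i < j" "i' < j'" "\<epsilon> \<in> {1, -1}" "\<epsilon>' \<in> {1, -1}"
  shows "\<epsilon> = \<epsilon>' \<and> i = i' \<and> j = j'"
proof -
  have "{i, j} = {i', j'}" using assms supp_pair_form by metis
  then have ij: "i = i'" "j = j'" using assms(2,3) by (auto simp: doubleton_eq_iff)
  moreover have "pair_form \<epsilon> i j j = pair_form \<epsilon>' i' j' j" using assms(1) by simp
  ultimately show ?thesis using assms(2) by (simp add: pair_form_def coord_form_def)
qed

lemma signed_forms_supp: "L \<in> signed_forms C \<sigma> \<Longrightarrow> linform_supp L \<subseteq> C \<and> linform_supp L \<noteq> {}"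
  unfolding signed_forms_iff by (auto simp: supp_pair_form)

lemma zero_forms_supp: "L \<in> zero_forms X N \<Longrightarrow> linform_supp L \<subseteq> N - {0} \<and> linform_supp L \<noteq> {}"
  unfolding zero_forms_iff by (auto simp: supp_pair_form supp_coord_form)

lemma signed_forms_cong:
  assumes "\<And>i j. i \<in> C \<Longrightarrow> j \<in> C \<Longrightarrow> (\<sigma> i = \<sigma> j) = (\<tau> i = \<tau> j)"
  shows "signed_forms C \<sigma> = signed_forms C \<tau>"
  unfolding signed_forms_def using assms by (intro image_cong) auto

lemma finite_signed_forms: "finite C \<Longrightarrow> finite (signed_forms C \<sigma>)"
  unfolding signed_forms_def by (rule finite_imageI) (rule finite_subset[of _ "C \<times> C"], auto)

lemma finite_zero_forms: "finite N \<Longrightarrow> finite (zero_forms X N)"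
  unfolding zero_forms_def
  by (intro finite_UnI finite_imageI finite_cartesian_product finite_subset[of "{(i, j). _ i j}"
      "N \<times> N"]) auto

lemma supported_signed_forms: "finite C \<Longrightarrow> supported C (signed_forms C \<sigma>)"
  unfolding supported_def using finite_signed_forms signed_forms_supp by blast

lemma supported_zero_forms: "finite N \<Longrightarrow> supported (N - {0}) (zero_forms X N)"
  unfolding supported_def using finite_zero_forms zero_forms_supp by blast

lemma signed_forms_singleton: "signed_forms {k} \<sigma> = {}"
  by (auto simp: signed_forms_iff)

lemma disjoint_family_supp:
  assumes "disjoint_family_on J P" "\<And>C L. C \<in> P \<Longrightarrow> L \<in> F C \<Longrightarrow> linform_supp L \<subseteq> J C \<and> linform_supp L \<noteq> {}"
  shows "disjoint_family_on F P"
  using assms unfolding disjoint_family_on_def by blast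

lemma partition_disjoint_family: "partition_on N P \<Longrightarrow> disjoint_family_on (\<lambda>C. C - S) P"
  unfolding partition_on_def disjoint_family_on_def disjoint_def by blast

text \<open>One representative of each pair of opposite sign patterns, chosen without a sign at the
  minimum because standard form leaves the minimal label unbarred.\<close>

definition normal_signs :: "nat set \<Rightarrow> (nat \<Rightarrow> bool) set" where
  "normal_signs C = {\<sigma> \<in> C \<rightarrow>\<^sub>E UNIV. \<not> \<sigma> (Min C)}"

text \<open>Flipping all signs exchanges the patterns with and without a sign at the
  minimum.\<close>

lemma sum_sign_patterns:
  fixes g :: "(nat \<Rightarrow> bool) \<Rightarrow> complex"
  assumes C: "finite C" "C \<noteq> {}" and g: "\<And>\<sigma>. g (\<lambda>i\<in>C. \<not> \<sigma> i) = g \<sigma>"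
  shows "(\<Sum>\<sigma>\<in>C \<rightarrow>\<^sub>E UNIV. g \<sigma>) = 2 * (\<Sum>\<sigma>\<in>normal_signs C. g \<sigma>)"
proof -
  have m: "Min C \<in> C" using C by (rule Min_in)
  have fin: "finite (C \<rightarrow>\<^sub>E (UNIV :: bool set))" using C(1) by (intro finite_PiE) auto
  have split: "C \<rightarrow>\<^sub>E UNIV = normal_signs C \<union> {\<sigma> \<in> C \<rightarrow>\<^sub>E UNIV. \<sigma> (Min C)}" unfolding normal_signs_def
    by auto
  have "(\<Sum>\<sigma>\<in>C \<rightarrow>\<^sub>E UNIV. g \<sigma>) = (\<Sum>\<sigma>\<in>normal_signs C. g \<sigma>) + (\<Sum>\<sigma>\<in>{\<sigma> \<in> C \<rightarrow>\<^sub>E UNIV. \<sigma> (Min C)}. g \<sigma>)"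
    by (subst split, rule sum.union_disjoint) (use fin in \<open>auto simp: normal_signs_def\<close>)
  also have "(\<Sum>\<sigma>\<in>{\<sigma> \<in> C \<rightarrow>\<^sub>E UNIV. \<sigma> (Min C)}. g \<sigma>) = (\<Sum>\<sigma>\<in>normal_signs C. g \<sigma>)"
    by (rule sum.reindex_bij_witness[where i = "\<lambda>\<sigma>. \<lambda>i\<in>C. \<not> \<sigma> i" and j = "\<lambda>\<sigma>. \<lambda>i\<in>C. \<not> \<sigma> i"])
      (use m g in \<open>auto simp: normal_signs_def fun_eq_iff PiE_iff extensional_def\<close>)
  finally show ?thesis by simp
qed

section \<open>Recursion of the zeta integrals over set partitions\<close>

context haar_zeta
begin

text \<open>The number of ways to give \<open>k + 1\<close> classes distinct residues. Pulling
  \<open>q\<close> out of each factor leaves \<open>1 - i / q\<close>, which is the origin of the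
  argument \<open>- 1 / q\<close> of the polynomials.\<close>

lemma q_falling:
  "(of_nat (\<Prod>i<Suc k. q - i) :: complex) = of_nat q ^ Suc k * eval_poly (qfact k) (- inverse (of_nat q))"
proof -
  have "(of_nat (\<Prod>i<Suc k. q - i) :: complex) = of_nat q * (\<Prod>i<k. of_nat q - of_nat (Suc i))"
    unfolding of_nat_falling by (simp add: prod.lessThan_Suc_shift del: prod.lessThan_Suc)
  also have "(\<Prod>i<k. of_nat q - of_nat (Suc i) :: complex) =
      (\<Prod>i<k. of_nat q * (1 + of_nat (Suc i) * (- inverse (of_nat q))))"
    using q_pos by (intro prod.cong) (auto simp: field_simps)
  also have "\<dots> = of_nat q ^ k * eval_poly (qfact k) (- inverse (of_nat q))"
    unfolding prod.distrib eval_poly_qfact by simp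
  finally show ?thesis by simp
qed

text \<open>Here \<open>h\<close> is the number of pairs of opposite nonzero residues, and
  \<open>2 (h - i) = q - (2 i + 1)\<close>. The powers of 2 stem from the two signs available in
  each class; the odd numbers give the double factorial.\<close>

lemma q_odd_falling:
  assumes "q = 2 * h + 1"
  shows "2 ^ k * (of_nat (\<Prod>i<k. h - i) :: complex) =
      of_nat q ^ k * eval_poly (qdfact k) (- inverse (of_nat q))"
proof -
  have "2 ^ k * (of_nat (\<Prod>i<k. h - i) :: complex) = (\<Prod>i<k. 2 * (of_nat h - of_nat i))"
    unfolding of_nat_falling prod.distrib by simp
  also have "\<dots> = (\<Prod>i<k. of_nat q * (1 + of_nat (2 * i + 1) * (- inverse (of_nat q))))"
  proof (rule prod.cong[OF refl])
    fix i
    have "of_nat q * (1 + of_nat (2 * i + 1) * (- inverse (of_nat q))) =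
        (of_nat q - of_nat (2 * i + 1) :: complex)"
      using q_pos by (simp add: field_simps)
    then show "2 * (of_nat h - of_nat i) =
        of_nat q * (1 + of_nat (2 * i + 1) * (- inverse (of_nat q)) :: complex)"
      using assms by simp
  qed
  also have "\<dots> = of_nat q ^ k * eval_poly (qdfact k) (- inverse (of_nat q))"
    unfolding prod.distrib eval_poly_qdfact by simp
  finally show ?thesis .
qed

text \<open>Changing the sign of the variables marked by \<open>\<sigma>\<close> turns the forms
  into differences, up to sign. A partition into \<open>c\<close> classes arises from
  \<open>q (q - 1) ... (q - c + 1)\<close> digit vectors; one factor \<open>q\<close> goes to each
  class, and what remains is the value of \<open>qfact (c - 1)\<close>.\<close>

lemma zeta_int_A:
  assumes C: "finite C" "C \<noteq> {}"
  shows "zeta_int C (signed_forms C \<sigma>) = (\<Sum>P\<in>{P. partition_on C P}.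
    eval_poly (qfact (card P - 1)) (- inverse (of_nat q)) *
        (\<Prod>D\<in>P. of_nat q * block_zeta D (signed_forms D \<sigma>)))"
proof -
  obtain R0 :: "'a set" where R0: "residue_system R0" using residue_system_exists by blast
  have finR: "finite R0" using R0 unfolding residue_system_def by blast
  \<comment> \<open>Digits at coordinates with a sign are negated, and \<open>\<kappa>\<close>
    undoes this, so that all values lie in the common system \<open>R0\<close>.\<close>
  define R where "R i = (if \<sigma> i then uminus ` R0 else R0)" for i
  define \<kappa> where "\<kappa> i a = (if \<sigma> i then - a else a)" for i :: nat and a :: 'a
  have R: "residue_system (R i)" for i using R0 residue_system_uminus[OF R0] by (simp add: R_def)
  have \<kappa>: "\<kappa> i a \<in> R0" if "a \<in> R i" for i a using that by (auto simp: \<kappa>_def R_def split: if_splits)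
  have leval_\<kappa>: "leval (pair_form (if \<sigma> i = \<sigma> j then 1 else -1) i j) r =
      (if \<sigma> i then - (\<kappa> i (r i) - \<kappa> j (r j)) else \<kappa> i (r i) - \<kappa> j (r j))" if "i < j" for i j r
    using that by (subst leval_pair_form) (auto simp: \<kappa>_def)
  have leval_zero: "leval (pair_form (if \<sigma> i = \<sigma> j then 1 else -1) i j) r = 0 \<longleftrightarrow> \<kappa> i (r i) = \<kappa> j (r j)"
    if "i < j" for i j r
    unfolding leval_\<kappa>[OF that] by auto
  have leval_dvd: "unif dvd leval (pair_form (if \<sigma> i = \<sigma> j then 1 else -1) i j) r \<longleftrightarrow>
      unif dvd \<kappa> i (r i) - \<kappa> j (r j)"
    if "i < j" for i j r
    unfolding leval_\<kappa>[OF that] using dvd_minus_iff by metis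
  have unit: "\<not> unif dvd leval L r"
      if r: "r \<in> Pi\<^sub>E C R" and L: "L \<in> signed_forms C \<sigma>" "leval L r \<noteq> 0" for r L
  proof -
    obtain i j where ij: "i \<in> C" "j \<in> C" "i < j" "L = pair_form (if \<sigma> i = \<sigma> j then 1 else -1) i j"
      using L(1) by (auto simp: signed_forms_iff)
    have "\<kappa> i (r i) \<in> R0" "\<kappa> j (r j) \<in> R0" using r ij \<kappa> by auto
    then show ?thesis
      using L(2) residue_system_unique[OF R0] unfolding ij(4) leval_dvd[OF ij(3)] leval_zero[OF ij(3)]
      by blast
  qed
  have vanish: "block_zeta C {L \<in> signed_forms C \<sigma>. leval L r = 0} =
      (\<Prod>D\<in>classes (\<lambda>i. \<kappa> i (r i)) C. block_zeta D (signed_forms D \<sigma>))" for r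
  proof -
    let ?P = "classes (\<lambda>i. \<kappa> i (r i)) C"
    have P: "partition_on C ?P" by (rule partition_on_classes)
    have "{L \<in> signed_forms C \<sigma>. leval L r = 0} = (\<Union>D\<in>?P. signed_forms D \<sigma>)"
    proof (intro equalityI subsetI)
      fix L assume "L \<in> {L \<in> signed_forms C \<sigma>. leval L r = 0}"
      then obtain i j where ij: "i \<in> C" "j \<in> C" "i < j"
          "L = pair_form (if \<sigma> i = \<sigma> j then 1 else -1) i j" "leval L r = 0"
        by (auto simp: signed_forms_iff)
      then have "\<kappa> j (r j) = \<kappa> i (r i)" using leval_zero by simp
      then have "L \<in> signed_forms {k \<in> C. \<kappa> k (r k) = \<kappa> i (r i)} \<sigma>" using ij(1-4)
        unfolding signed_forms_iff by blast
      then show "L \<in> (\<Union>D\<in>?P. signed_forms D \<sigma>)" using ij(1) unfolding classes_def by blast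
    next
      fix L assume "L \<in> (\<Union>D\<in>?P. signed_forms D \<sigma>)"
      then obtain k where "L \<in> signed_forms {j \<in> C. \<kappa> j (r j) = \<kappa> k (r k)} \<sigma>"
        unfolding classes_def by blast
      then obtain i j where ij: "i \<in> C" "j \<in> C" "i < j" "L = pair_form (if \<sigma> i = \<sigma> j then 1 else -1) i j"
        "\<kappa> i (r i) = \<kappa> k (r k)" "\<kappa> j (r j) = \<kappa> k (r k)"
        unfolding signed_forms_iff by blast
      then have "leval L r = 0" using leval_zero by simp
      moreover have "L \<in> signed_forms C \<sigma>" using ij(1-4) unfolding signed_forms_iff by blast
      ultimately show "L \<in> {L \<in> signed_forms C \<sigma>. leval L r = 0}" by simp
    qed
    \<comment> \<open>Writing \<open>D - {}\<close> gives the blocks the shape used by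
      \<open>partition_disjoint_family\<close>, which is stated for blocks with some labels
      removed.\<close>
    moreover have "block_zeta (\<Union>D\<in>?P. D - {}) (\<Union>D\<in>?P. signed_forms D \<sigma>) =
        (\<Prod>D\<in>?P. block_zeta (D - {}) (signed_forms D \<sigma>))"
      using finite_elements[OF C(1) P] finite_partition_element[OF C(1) P] signed_forms_supp
      by (intro block_zeta_UN disjoint_family_supp[where J = "\<lambda>D. D - {}"]
          partition_disjoint_family[OF P])
        (auto intro!: supported_signed_forms)
    moreover have "(\<Union>D\<in>?P. D) = C" using partition_onD1[OF P] by simp
    ultimately show ?thesis by simp
  qed
  have "zeta_int C (signed_forms C \<sigma>) =
      (\<Sum>r\<in>Pi\<^sub>E C R. block_zeta C {L \<in> signed_forms C \<sigma>. leval L r = 0})"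
    using C(1) by (intro zeta_int_digits supported_signed_forms R unit)
  also have "\<dots> = (\<Sum>P\<in>{P. partition_on C P}. \<Sum>\<rho>\<in>{\<rho> \<in> P \<rightarrow>\<^sub>E R0. inj_on \<rho> P}.
       \<Prod>D\<in>P. \<Sum>r\<in>(\<Pi>\<^sub>E i\<in>D. {a \<in> R i. \<kappa> i a = \<rho> D}). block_zeta D (signed_forms D \<sigma>))"
    unfolding vanish using C(1) finR \<kappa> by (intro sum_digit_vectors) (auto simp: R_def)
  also have "\<dots> = (\<Sum>P\<in>{P. partition_on C P}.
    eval_poly (qfact (card P - 1)) (- inverse (of_nat q)) *
        (\<Prod>D\<in>P. of_nat q * block_zeta D (signed_forms D \<sigma>)))"
  proof (rule sum.cong[OF refl])
    fix P assume "P \<in> {P. partition_on C P}"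
    then have P: "partition_on C P" by simp
    have finP: "finite P" by (rule finite_elements[OF C(1) P])
    have "P \<noteq> {}" using P C(2) by (auto simp: partition_on_def)
    then obtain c where card: "card P = Suc c" using finP by (metis card_eq_0_iff not0_implies_Suc)
    have "(\<Sum>\<rho>\<in>{\<rho> \<in> P \<rightarrow>\<^sub>E R0. inj_on \<rho> P}.
       \<Prod>D\<in>P. \<Sum>r\<in>(\<Pi>\<^sub>E i\<in>D. {a \<in> R i. \<kappa> i a = \<rho> D}). block_zeta D (signed_forms D \<sigma>)) =
      (\<Sum>\<rho>\<in>{\<rho> \<in> P \<rightarrow>\<^sub>E R0. inj_on \<rho> P}. \<Prod>D\<in>P. block_zeta D (signed_forms D \<sigma>))"
    proof (intro sum.cong[OF refl] prod.cong[OF refl])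
      fix \<rho> D assume \<rho>: "\<rho> \<in> {\<rho> \<in> P \<rightarrow>\<^sub>E R0. inj_on \<rho> P}" and D: "D \<in> P"
      \<comment> \<open>Once a class has its residue, the sign pattern leaves a single digit for
        each of its coordinates.\<close>
      have "{a \<in> R i. \<kappa> i a = \<rho> D} = {if \<sigma> i then - \<rho> D else \<rho> D}" for i
        using \<rho> D by (auto simp: R_def \<kappa>_def)
      then have "card (\<Pi>\<^sub>E i\<in>D. {a \<in> R i. \<kappa> i a = \<rho> D}) = 1"
        using finite_partition_element[OF C(1) P D] by (simp add: card_PiE)
      then show "(\<Sum>r\<in>(\<Pi>\<^sub>E i\<in>D. {a \<in> R i. \<kappa> i a = \<rho> D}). block_zeta D (signed_forms D \<sigma>)) =
          block_zeta D (signed_forms D \<sigma>)" by simp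
    qed
    also have "\<dots> = of_nat (\<Prod>i<card P. q - i) * (\<Prod>D\<in>P. block_zeta D (signed_forms D \<sigma>))"
      using card_inj_PiE[OF finP finR] card_residue_system[OF R0] q by simp
    also have "\<dots> = eval_poly (qfact (card P - 1)) (- inverse (of_nat q)) *
        (\<Prod>D\<in>P. of_nat q * block_zeta D (signed_forms D \<sigma>))"
      unfolding card q_falling by (simp add: prod.distrib card)
    finally show "(\<Sum>\<rho>\<in>{\<rho> \<in> P \<rightarrow>\<^sub>E R0. inj_on \<rho> P}.
       \<Prod>D\<in>P. \<Sum>r\<in>(\<Pi>\<^sub>E i\<in>D. {a \<in> R i. \<kappa> i a = \<rho> D}). block_zeta D (signed_forms D \<sigma>)) =
      eval_poly (qfact (card P - 1)) (- inverse (of_nat q)) *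
          (\<Prod>D\<in>P. of_nat q * block_zeta D (signed_forms D \<sigma>))" .
  qed
  finally show ?thesis .
qed

text \<open>The contribution of one class of a partition. In the class of 0 all digits are 0; in any
  other class the relative signs of the digits are summed over, and the factor \<open>q\<close> is
  the share of this class in the number of digit vectors.\<close>

definition weight_B :: "arr_type \<Rightarrow> nat set \<Rightarrow> complex" where
  "weight_B X C = (if 0 \<in> C then block_zeta (C - {0}) (zero_forms X C)
      else \<Sum>\<sigma>\<in>normal_signs C. of_nat q * block_zeta C (signed_forms C \<sigma>))"

text \<open>
  With a symmetric system of digits, two coordinates are congruent up to sign if and only if their
  digits agree up to sign. A partition into \<open>c\<close> classes arises from \<open>(q - 1) (q - 3) \<dots> (q - 2 c + 3)\<close>
  digit vectors for each choice of relative signs.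
\<close>

lemma zeta_int_B:
  assumes odd: "odd q" and N: "finite N" "0 \<in> N"
  shows "zeta_int (N - {0}) (zero_forms X N) = (\<Sum>P\<in>{P. partition_on N P}.
    eval_poly (qdfact (card P - 1)) (- inverse (of_nat q)) * (\<Prod>C\<in>P. weight_B X C))"
proof -
  obtain R0 :: "'a set" where R0: "residue_system R0" using residue_system_exists by blast
  obtain H :: "'a set" where H: "finite H" "0 \<notin> H" "H \<inter> uminus ` H = {}"
    "residue_system ({0} \<union> H \<union> uminus ` H)"
    using symmetric_residue_system[OF R0] card_residue_system[OF R0] odd q by metis
  define R where "R = {0} \<union> H \<union> uminus ` H"
  have R: "residue_system R" using H(4) by (simp add: R_def)
  have finR: "finite R" using R unfolding residue_system_def by blast
  have R_neg: "- a \<in> R" if "a \<in> R" for a using that by (auto simp: R_def)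
  have disjH: "- a \<notin> H" if "a \<in> H" for a using H(3) that by blast
  have card_H: "q = 2 * card H + 1"
  proof -
    have "card R = card ({0} \<union> (H \<union> uminus ` H))" by (simp add: R_def)
    also have "\<dots> = 1 + card (H \<union> uminus ` H)" using H(1,2) by (subst card_Un_disjoint) auto
    also have "card (H \<union> uminus ` H) = card H + card (uminus ` H)"
      using H(1,3) by (intro card_Un_disjoint) auto
    also have "card (uminus ` H) = card H" by (rule card_image) simp
    finally show ?thesis using card_residue_system[OF R] q by simp
  qed
  define K where "K = insert 0 H"
  \<comment> \<open>For a digit \<open>a\<close> this is the one of \<open>a\<close> and
    \<open>- a\<close> that lies in \<open>{0} \<union> H\<close>, so that digits are compared up to
    sign.\<close>
  define \<kappa> where "\<kappa> a = (if a \<in> K then a else - a)" for a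
  \<comment> \<open>The adjoined coordinate 0 may only take the value 0, so the class of the label 0
    collects the coordinates with digit 0.\<close>
  define R' where "R' i = (if i = (0::nat) then {0} else R)" for i
  have \<kappa>0: "\<kappa> a = 0 \<longleftrightarrow> a = 0" for a by (auto simp: \<kappa>_def K_def)
  have \<kappa>K: "\<kappa> a \<in> K" if "a \<in> R" for a using that by (auto simp: \<kappa>_def K_def R_def)
  have \<kappa>_eq: "\<kappa> a = \<kappa> b \<longleftrightarrow> a = b \<or> a = - b" if "a \<in> R" "b \<in> R" for a b
    using that disjH H(2) by (auto simp: \<kappa>_def K_def R_def)
  have \<kappa>_sign: "a = (if (a \<notin> H) = (b \<notin> H) then 1 else -1) * b"
    if "a \<in> R" "b \<in> R" "\<kappa> a = \<kappa> b" for a b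
    using that disjH H(2) by (auto simp: \<kappa>_def K_def R_def split: if_splits)
  \<comment> \<open>At nonzero digits the sign in such a relation is unique, hence at most one of
    the two forms in a given pair of variables vanishes. At the digit 0 both do, which is why the
    class of 0 carries \<open>zero_forms\<close>.\<close>
  have sign_unique: "(\<epsilon> = 1) = ((a \<notin> H) = (b \<notin> H))"
    if "a \<in> R" "b \<in> R" "a \<noteq> 0" "\<epsilon> \<in> {1, -1::int}" "a = of_int \<epsilon> * b" for a b \<epsilon>
    using that disjH H(2) by (auto simp: R_def)
  let ?I = "N - {0}"
  let ?vanish = "\<lambda>r. {L \<in> zero_forms X N. leval L r = 0}"
  have r_mem: "r i \<in> R" if "r \<in> Pi\<^sub>E N R'" "i \<in> N" for r i
    using PiE_mem[OF that] by (auto simp: R'_def R_def split: if_splits)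
  have unit: "\<not> unif dvd leval L r"
      if r: "r \<in> ?I \<rightarrow>\<^sub>E R" and L: "L \<in> zero_forms X N" "leval L r \<noteq> 0" for r L
  proof -
    have zero: "0 \<in> R" by (simp add: R_def)
    have dist: "\<not> unif dvd a - b" if "a \<in> R" "b \<in> R" "a \<noteq> b" for a b
      using residue_system_unique[OF R] that by blast
    from L(1) consider \<epsilon> i j where "\<epsilon> \<in> {1, -1}" "i \<in> ?I" "j \<in> ?I" "i < j" "L = pair_form \<epsilon> i j"
      | k where "k \<in> ?I" "L = coord_form k" unfolding zero_forms_iff by blast
    then show ?thesis
    proof cases
      case 1
      have "of_int \<epsilon> * r j \<in> R" using 1(1,3) r R_neg by (auto simp: PiE_iff)
      then show ?thesis using dist[of "r i" "of_int \<epsilon> * r j"] r 1 L(2) by (auto simp: leval_pair_form)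
    next
      case 2
      then show ?thesis using dist[of "r k" 0] r zero L(2) by (auto simp: leval_coord_form)
    qed
  qed
  define \<phi> where "\<phi> C r = (if 0 \<in> C then block_zeta (C - {0}) (zero_forms X C)
      else block_zeta C (signed_forms C (\<lambda>i. r i \<notin> H)))"
    for C and r :: "nat \<Rightarrow> 'a"
  have vanish: "block_zeta ?I (?vanish r) = (\<Prod>C\<in>classes (\<lambda>i. \<kappa> (r i)) N. \<phi> C (restrict r C))"
    if r: "r \<in> Pi\<^sub>E N R'" for r
  proof -
    let ?P = "classes (\<lambda>i. \<kappa> (r i)) N"
    let ?F = "\<lambda>C. if 0 \<in> C then zero_forms X C else signed_forms C (\<lambda>i. r i \<notin> H)"
    have r0: "r 0 = 0" using PiE_mem[OF r N(2)] by (simp add: R'_def)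
    have P: "partition_on N ?P" by (rule partition_on_classes)
    have cls: "{j \<in> N. \<kappa> (r j) = \<kappa> (r i)} \<in> ?P" if "i \<in> N" for i using that by (auto simp: classes_def)
    have C0: "r i = 0" if "C \<in> ?P" "0 \<in> C" "i \<in> C" for C i
    proof -
      have "\<kappa> (r i) = \<kappa> (r 0)" using that by (auto simp: classes_def)
      then show ?thesis using \<kappa>0 r0 by metis
    qed
    have same: "\<kappa> (r i) = \<kappa> (r j)" "i \<in> N" "j \<in> N" if "C \<in> ?P" "i \<in> C" "j \<in> C" for C i j
      using that by (auto simp: classes_def)
    have "?vanish r = (\<Union>C\<in>?P. ?F C)"
    proof (intro equalityI subsetI)
      fix L assume "L \<in> ?vanish r"
      then have L: "L \<in> zero_forms X N" "leval L r = 0" by auto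
      from L(1) consider \<epsilon> i j where "\<epsilon> \<in> {1, -1}" "i \<in> ?I" "j \<in> ?I" "i < j" "L = pair_form \<epsilon> i j"
        | k where "k \<in> ?I" "L = coord_form k" "X \<noteq> TypeD" unfolding zero_forms_iff by blast
      then show "L \<in> (\<Union>C\<in>?P. ?F C)"
      proof cases
        case 1
        let ?C = "{k \<in> N. \<kappa> (r k) = \<kappa> (r i)}"
        have mem: "r i \<in> R" "r j \<in> R" using r_mem[OF r] 1 by auto
        have eq: "r i = of_int \<epsilon> * r j" using L(2) 1 by (simp add: leval_pair_form)
        then have "\<kappa> (r j) = \<kappa> (r i)" using 1(1) \<kappa>_eq mem by auto
        then have ij: "i \<in> ?C" "j \<in> ?C" using 1 by auto
        have "L \<in> ?F ?C"
        proof (cases "0 \<in> ?C")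
          case True
          have "i \<in> ?C - {0}" "j \<in> ?C - {0}" using ij 1(2,3) by blast+
          then have "L \<in> zero_forms X ?C" unfolding zero_forms_iff using 1(1,4,5) by blast
          then show ?thesis using True by (simp only: if_True)
        next
          case False
          then have "r i \<noteq> 0" using N(2) r0 by auto
          then have "(\<epsilon> = 1) = ((r i \<notin> H) = (r j \<notin> H))" using sign_unique mem 1(1) eq by blast
          then have "\<epsilon> = (if (r i \<notin> H) = (r j \<notin> H) then 1 else -1)" using 1(1) by auto
          then have "L \<in> signed_forms ?C (\<lambda>i. r i \<notin> H)" unfolding signed_forms_iff using ij 1(4,5)
            by blast
          then show ?thesis using False by (simp only: if_False)
        qed
        then show ?thesis using cls[of i] 1(2) by blast
      next
        case 2
        let ?C = "{j \<in> N. \<kappa> (r j) = \<kappa> (r k)}"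
        have "r k = 0" using L(2) 2 by (simp add: leval_coord_form)
        then have "0 \<in> ?C" "k \<in> ?C" using N(2) r0 2(1) by auto
        then have "L \<in> zero_forms X ?C" using 2 unfolding zero_forms_iff by blast
        then have "L \<in> ?F ?C" using \<open>0 \<in> ?C\<close> by (simp only: if_True)
        then show ?thesis using cls[of k] 2(1) by blast
      qed
    next
      fix L assume "L \<in> (\<Union>C\<in>?P. ?F C)"
      then obtain C where C: "C \<in> ?P" "L \<in> ?F C" by blast
      have sub: "C \<subseteq> N" using C(1) by (auto simp: classes_def)
      show "L \<in> ?vanish r"
      proof (cases "0 \<in> C")
        case True
        then have L: "L \<in> zero_forms X C" using C(2) by simp
        then have "L \<in> zero_forms X N" using sub unfolding zero_forms_iff by blast
        moreover have "leval L r = (\<Sum>i\<in>linform_supp L. 0)"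
          unfolding leval_def using zero_forms_supp[OF L] C0[OF C(1) True] by (intro sum.cong) auto
        ultimately show ?thesis by simp
      next
        case False
        then obtain i j where ij: "i \<in> C" "j \<in> C" "i < j"
          "L = pair_form (if (r i \<notin> H) = (r j \<notin> H) then 1 else -1) i j"
          using C(2) by (auto simp: signed_forms_iff)
        define \<epsilon> :: int where "\<epsilon> = (if (r i \<notin> H) = (r j \<notin> H) then 1 else -1)"
        have "\<epsilon> \<in> {1, -1}" by (simp add: \<epsilon>_def)
        moreover have "i \<noteq> 0" "j \<noteq> 0" using ij(1,2) False by metis+
        then have "i \<in> ?I" "j \<in> ?I" using ij(1,2) sub by blast+
        moreover have "L = pair_form \<epsilon> i j" unfolding \<epsilon>_def by (rule ij(4))
        ultimately have "L \<in> zero_forms X N" using ij(3) unfolding zero_forms_iff by blast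
        moreover have "r i = (if (r i \<notin> H) = (r j \<notin> H) then 1 else -1) * r j"
          using same[OF C(1) ij(1,2)] r_mem[OF r] by (intro \<kappa>_sign) auto
        then have "leval L r = 0" unfolding ij(4) using ij(3) by (subst leval_pair_form) auto
        ultimately show ?thesis by simp
      qed
    qed
    moreover have "block_zeta (\<Union>C\<in>?P. C - {0}) (\<Union>C\<in>?P. ?F C) = (\<Prod>C\<in>?P. block_zeta (C - {0}) (?F C))"
    proof (intro block_zeta_UN disjoint_family_supp[where J = "\<lambda>C. C - {0}"]
        partition_disjoint_family[OF P])
      show "finite ?P" by (rule finite_elements[OF N(1) P])
      fix C assume C: "C \<in> ?P"
      have fin: "finite C" by (rule finite_partition_element[OF N(1) P C])
      show "supported (C - {0}) (?F C)"
        using supported_zero_forms[OF fin] supported_signed_forms[OF fin] by simp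
      fix L assume "L \<in> ?F C"
      then show "linform_supp L \<subseteq> C - {0} \<and> linform_supp L \<noteq> {}"
        using zero_forms_supp signed_forms_supp[of L C "\<lambda>i. r i \<notin> H"] by (cases "0 \<in> C") auto
    qed
    moreover have "(\<Union>C\<in>?P. C - {0}) = ?I" using partition_onD1[OF P] by auto
    moreover have "\<phi> C (restrict r C) = block_zeta (C - {0}) (?F C)" for C
      using signed_forms_cong[of C "\<lambda>i. restrict r C i \<notin> H" "\<lambda>i. r i \<notin> H"] by (simp add: \<phi>_def)
    ultimately show ?thesis by simp
  qed
  have "zeta_int ?I (zero_forms X N) = (\<Sum>r\<in>?I \<rightarrow>\<^sub>E R. block_zeta ?I (?vanish r))"
    using N(1) by (intro zeta_int_digits supported_zero_forms R unit)
  \<comment> \<open>Adjoining the coordinate 0 with the value 0 affects no form and is a bijection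
    on digit vectors.\<close>
  also have "\<dots> = (\<Sum>r\<in>Pi\<^sub>E N R'. block_zeta ?I (?vanish r))"
  proof (rule sum.reindex_bij_witness[where j = "\<lambda>r. r(0 := 0)" and i = "\<lambda>r. restrict r ?I"])
    fix r assume r: "r \<in> ?I \<rightarrow>\<^sub>E R"
    show "restrict (r(0 := 0)) ?I = r" using r by (auto simp: fun_eq_iff PiE_iff extensional_def)
    show "r(0 := 0) \<in> Pi\<^sub>E N R'" using r N(2) by (auto simp: R'_def PiE_iff extensional_def)
    have "leval L (r(0 := 0)) = leval L r" if "L \<in> zero_forms X N" for L
      using zero_forms_supp[OF that] by (intro leval_cong) auto
    then show "block_zeta ?I (?vanish (r(0 := 0))) = block_zeta ?I (?vanish r)"
      by (metis (mono_tags, lifting))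
  next
    fix r assume r: "r \<in> Pi\<^sub>E N R'"
    show "(restrict r ?I)(0 := 0) = r"
      using r PiE_mem[OF r N(2)] by (auto simp: fun_eq_iff PiE_iff extensional_def R'_def)
    show "restrict r ?I \<in> ?I \<rightarrow>\<^sub>E R" using r_mem[OF r] by (intro restrict_PiE_iff[THEN iffD2]) simp
  qed
  also have "\<dots> = (\<Sum>r\<in>Pi\<^sub>E N R'. \<Prod>C\<in>classes (\<lambda>i. \<kappa> (r i)) N. \<phi> C (restrict r C))"
    by (rule sum.cong[OF refl]) (rule vanish)
  also have "\<dots> = (\<Sum>P\<in>{P. partition_on N P}. \<Sum>\<rho>\<in>{\<rho> \<in> P \<rightarrow>\<^sub>E K. inj_on \<rho> P}.
       \<Prod>C\<in>P. \<Sum>r\<in>(\<Pi>\<^sub>E i\<in>C. {a \<in> R' i. \<kappa> a = \<rho> C}). \<phi> C r)"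
  proof (rule sum_digit_vectors[OF N(1)])
    show "finite K" using H(1) by (simp add: K_def)
    show "finite (R' i)" for i using finR by (simp add: R'_def)
    show "\<kappa> a \<in> K" if "a \<in> R' i" for i a
      using that \<kappa>K[of a] by (cases "i = 0") (auto simp: R'_def K_def \<kappa>_def)
  qed
  also have "\<dots> = (\<Sum>P\<in>{P. partition_on N P}.
    eval_poly (qdfact (card P - 1)) (- inverse (of_nat q)) * (\<Prod>C\<in>P. weight_B X C))"
  proof (rule sum.cong[OF refl])
    fix P assume "P \<in> {P. partition_on N P}"
    then have P: "partition_on N P" by simp
    have finP: "finite P" by (rule finite_elements[OF N(1) P])
    define C0 where "C0 = part_of P 0"
    have C0: "C0 \<in> P" "0 \<in> C0" using part_of[OF P N(2)] by (simp_all add: C0_def)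
    have C0_unique: "C = C0" if "C \<in> P" "0 \<in> C" for C using part_of_eq[OF P that] by (simp add: C0_def)
    let ?Q = "P - {C0}"
    have no0: "0 \<notin> C" if "C \<in> ?Q" for C using that C0_unique by auto
    have ne: "C \<noteq> {}" "finite C" if "C \<in> P" for C
      using that partition_onD3[OF P] finite_partition_element[OF N(1) P] by auto
    define V where "V C = (\<Sum>\<sigma>\<in>normal_signs C. block_zeta C (signed_forms C \<sigma>))" for C
    define \<Psi> where "\<Psi> C k = (\<Sum>r\<in>(\<Pi>\<^sub>E i\<in>C. {a \<in> R' i. \<kappa> a = k}). \<phi> C r)" for C k
    \<comment> \<open>The digit of the label 0 is 0, so its class admits no other residue.\<close>
    have \<Psi>0: "\<Psi> C0 k = (if k = 0 then weight_B X C0 else 0)" for k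
    proof (cases "k = 0")
      case True
      have "{a \<in> R' i. \<kappa> a = k} = {0}" for i using True by (auto simp: \<kappa>0 R'_def R_def)
      then have "card (\<Pi>\<^sub>E i\<in>C0. {a \<in> R' i. \<kappa> a = k}) = 1" using ne[OF C0(1)] by (simp add: card_PiE)
      then show ?thesis using True C0(2) by (simp add: \<Psi>_def \<phi>_def weight_B_def)
    next
      case False
      then have "{a \<in> R' 0. \<kappa> a = k} = {}" using \<kappa>0[of 0] by (auto simp: R'_def)
      then have "(\<Pi>\<^sub>E i\<in>C0. {a \<in> R' i. \<kappa> a = k}) = {}" using C0(2) by (auto simp: PiE_eq_empty_iff)
      then show ?thesis using False by (simp add: \<Psi>_def)
    qed
    \<comment> \<open>The digits above \<open>k\<close> are \<open>k\<close> and \<open>- k\<close>,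
      so a choice of digits in the class is a sign pattern. Opposite patterns have the same forms,
      whence the factor 2.\<close>
    have \<Psi>1: "\<Psi> C k = 2 * V C" if C: "C \<in> ?Q" and k: "k \<in> H" for C k
    proof -
      have kk: "- k \<noteq> k" "- k \<notin> H" using disjH[OF k] k by metis+
      have fib: "{a \<in> R' i. \<kappa> a = k} = {k, - k}" if "i \<in> C" for i
        using that no0[OF C] k kk by (auto simp: R'_def R_def \<kappa>_def K_def split: if_splits)
      then have "(\<Pi>\<^sub>E i\<in>C. {a \<in> R' i. \<kappa> a = k}) = (\<Pi>\<^sub>E i\<in>C. {k, - k})" by (rule PiE_cong)
      then have "\<Psi> C k = (\<Sum>r\<in>(\<Pi>\<^sub>E i\<in>C. {k, - k}). block_zeta C (signed_forms C (\<lambda>i. r i \<notin> H)))"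
        using no0[OF C] by (simp add: \<Psi>_def \<phi>_def)
      also have "\<dots> = (\<Sum>\<sigma>\<in>C \<rightarrow>\<^sub>E UNIV. block_zeta C (signed_forms C \<sigma>))"
      proof (rule sum.reindex_bij_witness[where j = "\<lambda>r. \<lambda>i\<in>C. r i \<notin> H"
          and i = "\<lambda>\<sigma>. \<lambda>i\<in>C. if \<sigma> i then - k else k"])
        fix r assume r: "r \<in> (\<Pi>\<^sub>E i\<in>C. {k, - k})"
        show "(\<lambda>i\<in>C. if (\<lambda>i\<in>C. r i \<notin> H) i then - k else k) = r"
        proof
          fix i
          show "(\<lambda>i\<in>C. if (\<lambda>i\<in>C. r i \<notin> H) i then - k else k) i = r i"
            using r k kk PiE_mem[OF r, of i] PiE_arb[OF r, of i] by (cases "i \<in> C") auto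
        qed
        show "block_zeta C (signed_forms C (\<lambda>i\<in>C. r i \<notin> H)) =
            block_zeta C (signed_forms C (\<lambda>i. r i \<notin> H))"
          by (subst signed_forms_cong[of C _ "\<lambda>i. r i \<notin> H"]) auto
      next
        fix \<sigma> :: "nat \<Rightarrow> bool" assume \<sigma>: "\<sigma> \<in> C \<rightarrow>\<^sub>E UNIV"
        show "(\<lambda>i\<in>C. (\<lambda>i\<in>C. if \<sigma> i then - k else k) i \<notin> H) = \<sigma>"
        proof
          fix i
          show "(\<lambda>i\<in>C. (\<lambda>i\<in>C. if \<sigma> i then - k else k) i \<notin> H) i = \<sigma> i"
            using k kk PiE_arb[OF \<sigma>, of i] by (cases "i \<in> C") auto
        qed
      qed auto
      also have "\<dots> = 2 * V C"
        unfolding V_def using ne C by (intro sum_sign_patterns arg_cong[where f = "block_zeta C"]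
            signed_forms_cong) auto
      finally show ?thesis .
    qed
    have "(\<Sum>\<rho>\<in>{\<rho> \<in> P \<rightarrow>\<^sub>E K. inj_on \<rho> P}. \<Prod>C\<in>P. \<Psi> C (\<rho> C)) =
      (\<Sum>\<rho>\<in>{\<rho> \<in> P \<rightarrow>\<^sub>E K. inj_on \<rho> P \<and> \<rho> C0 = 0}. \<Prod>C\<in>P. \<Psi> C (\<rho> C))"
    proof (rule sum.mono_neutral_right)
      show "finite {\<rho> \<in> P \<rightarrow>\<^sub>E K. inj_on \<rho> P}"
        using finP H(1) by (intro finite_subset[OF Collect_subset] finite_PiE) (auto simp: K_def)
      show "\<forall>\<rho>\<in>{\<rho> \<in> P \<rightarrow>\<^sub>E K. inj_on \<rho> P} - {\<rho> \<in> P \<rightarrow>\<^sub>E K. inj_on \<rho> P \<and> \<rho> C0 = 0}. (\<Prod>C\<in>P. \<Psi> C (\<rho> C)) = 0"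
      proof
        fix \<rho> assume "\<rho> \<in> {\<rho> \<in> P \<rightarrow>\<^sub>E K. inj_on \<rho> P} - {\<rho> \<in> P \<rightarrow>\<^sub>E K. inj_on \<rho> P \<and> \<rho> C0 = 0}"
        then have "\<Psi> C0 (\<rho> C0) = 0" using \<Psi>0 by simp
        then show "(\<Prod>C\<in>P. \<Psi> C (\<rho> C)) = 0" using C0(1) finP by (intro prod_zero) auto
      qed
    qed auto
    also have "\<dots> = (\<Sum>\<rho>\<in>{\<rho> \<in> P \<rightarrow>\<^sub>E K. inj_on \<rho> P \<and> \<rho> C0 = 0}. weight_B X C0 * (\<Prod>C\<in>?Q. 2 * V C))"
    proof (rule sum.cong[OF refl])
      fix \<rho> assume \<rho>: "\<rho> \<in> {\<rho> \<in> P \<rightarrow>\<^sub>E K. inj_on \<rho> P \<and> \<rho> C0 = 0}"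
      have "\<Psi> C (\<rho> C) = 2 * V C" if C: "C \<in> ?Q" for C
      proof -
        have "\<rho> C \<in> K" using \<rho> C by auto
        moreover have "\<rho> C \<noteq> \<rho> C0" using \<rho> C C0(1) inj_on_eq_iff[of \<rho> P C C0] by simp
        ultimately have "\<rho> C \<in> H" using \<rho> by (simp add: K_def)
        then show ?thesis by (rule \<Psi>1[OF C])
      qed
      then have "(\<Prod>C\<in>?Q. \<Psi> C (\<rho> C)) = (\<Prod>C\<in>?Q. 2 * V C)" by (rule prod.cong[OF refl])
      then show "(\<Prod>C\<in>P. \<Psi> C (\<rho> C)) = weight_B X C0 * (\<Prod>C\<in>?Q. 2 * V C)"
        using prod.remove[OF finP C0(1), of "\<lambda>C. \<Psi> C (\<rho> C)"] \<Psi>0 \<rho> by simp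
    qed
    also have "\<dots> = of_nat (card {\<rho> \<in> P \<rightarrow>\<^sub>E K. inj_on \<rho> P \<and> \<rho> C0 = 0}) *
        (weight_B X C0 * (\<Prod>C\<in>?Q. 2 * V C))"
      by simp
    \<comment> \<open>With the digit 0 reserved for the class \<open>C0\<close>, the remaining
      classes are mapped injectively into \<open>H\<close>.\<close>
    also have "card {\<rho> \<in> P \<rightarrow>\<^sub>E K. inj_on \<rho> P \<and> \<rho> C0 = 0} = (\<Prod>i<card ?Q. card H - i)"
    proof -
      have "insert C0 ?Q = P" using C0(1) by auto
      moreover have "K - {0} = H" using H(2) by (auto simp: K_def)
      ultimately show ?thesis
        using bij_betw_same_card[OF bij_betw_inj_insert[of C0 ?Q 0 K]] card_inj_PiE[of ?Q H] finP H(1)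
        by (simp add: K_def)
    qed
    \<comment> \<open>The factors 2 are collected for \<open>q_odd_falling\<close>, which combines
      them with the falling factorial of \<open>card H\<close>.\<close>
    also have "of_nat (\<Prod>i<card ?Q. card H - i) * (weight_B X C0 * (\<Prod>C\<in>?Q. 2 * V C)) =
      (2 ^ card ?Q * of_nat (\<Prod>i<card ?Q. card H - i)) * (weight_B X C0 * (\<Prod>C\<in>?Q. V C))"
      by (simp add: prod.distrib)
    also have "\<dots> = eval_poly (qdfact (card ?Q)) (- inverse (of_nat q)) *
        (weight_B X C0 * (\<Prod>C\<in>?Q. of_nat q * V C))"
      unfolding q_odd_falling[OF card_H] by (simp add: prod.distrib)
    also have "(\<Prod>C\<in>?Q. of_nat q * V C) = (\<Prod>C\<in>?Q. weight_B X C)"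
      using no0 by (intro prod.cong) (auto simp: weight_B_def V_def sum_distrib_left)
    also have "weight_B X C0 * (\<Prod>C\<in>?Q. weight_B X C) = (\<Prod>C\<in>P. weight_B X C)"
      by (rule prod.remove[OF finP C0(1), symmetric])
    also have "card ?Q = card P - 1" using C0(1) by simp
    finally show "(\<Sum>\<rho>\<in>{\<rho> \<in> P \<rightarrow>\<^sub>E K. inj_on \<rho> P}.
       \<Prod>C\<in>P. \<Sum>r\<in>(\<Pi>\<^sub>E i\<in>C. {a \<in> R' i. \<kappa> a = \<rho> C}). \<phi> C r) =
      eval_poly (qdfact (card P - 1)) (- inverse (of_nat q)) * (\<Prod>C\<in>P. weight_B X C)"
      unfolding \<Psi>_def .
  qed
  finally show ?thesis .
qed

end

section \<open>Labelled trees without chains\<close>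

definition nums :: "blabel rtree \<Rightarrow> nat set" where
  "nums t = num ` set_mset (leaf_labels t)"

definition branching :: "'l rtree \<Rightarrow> bool" where
  "branching t \<longleftrightarrow> Node {#} \<notin> vertices t \<and> (\<forall>u\<in>parents t. 2 \<le> num_children u)"

definition tree :: "nat set \<Rightarrow> blabel rtree \<Rightarrow> bool" where
  "tree N t \<longleftrightarrow> finite N \<and> branching t \<and> image_mset num (leaf_labels t) = mset_set N"

lemma parents_Leaf [simp]: "parents (Leaf l) = {}"
  by (auto simp: parents_def)

lemma parents_Node:
  "ts \<noteq> {#} \<Longrightarrow> parents (Node ts) = insert (Node ts) (\<Union>v\<in>set_mset ts. parents v)"
  by (auto simp: parents_def)

lemma branching_Leaf [simp]: "branching (Leaf l)"
  by (simp add: branching_def)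

lemma branching_Node: "branching (Node ts) \<longleftrightarrow> 2 \<le> size ts \<and> (\<forall>v\<in>#ts. branching v)"
proof (cases "ts = {#}")
  case False
  then show ?thesis
    unfolding branching_def parents_Node[OF False] by (auto simp: num_children_def)
qed (simp add: branching_def)

lemma nums_Leaf [simp]: "nums (Leaf l) = {num l}"
  by (simp add: nums_def)

lemma nums_Node: "nums (Node ts) = (\<Union>v\<in>set_mset ts. nums v)"
  by (auto simp: nums_def)

lemma nums_ne: "branching t \<Longrightarrow> nums t \<noteq> {}"
  using leaf_count_pos unfolding nums_def branching_def by blast

lemma finite_nums: "finite (nums t)"
  by (simp add: nums_def)

lemma branching_vertex: "branching t \<Longrightarrow> u \<in> vertices t \<Longrightarrow> branching u"
  using vertices_trans unfolding branching_def parents_def by blast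

lemma leaf_labels_vertex:
  assumes "u \<in> vertices t"
  shows "set_mset (leaf_labels u) \<subseteq> set_mset (leaf_labels t)"
  unfolding label_iff_vertex subset_iff using vertices_trans[OF assms] by simp

lemma nums_vertex: "u \<in> vertices t \<Longrightarrow> nums u \<subseteq> nums t"
  unfolding nums_def by (intro image_mono leaf_labels_vertex)

lemma tree_nums: "tree N t \<Longrightarrow> nums t = N"
  unfolding tree_def nums_def by (metis finite_set_mset_mset_set set_image_mset)

lemma mset_set_subset:
  assumes "A + B = mset_set N" "finite N"
  shows "A = mset_set (set_mset A)" "set_mset A \<inter> set_mset B = {}"
proof -
  have c: "count A x + count B x \<le> 1" for x
    using assms by (metis count_mset_set(1,3) count_union le_numeral_extra(4) zero_le_one)
  show "A = mset_set (set_mset A)"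
  proof (rule multiset_eqI)
    fix x
    show "count A x = count (mset_set (set_mset A)) x"
      using c[of x] by (cases "x \<in># A") (auto simp: count_eq_zero_iff dest: count_inI, metis One_nat_def
          Suc_leI add_leD1 count_greater_zero_iff le_antisym)
  qed
  show "set_mset A \<inter> set_mset B = {}"
  proof (rule ccontr)
    assume "set_mset A \<inter> set_mset B \<noteq> {}"
    then obtain x where "x \<in># A" "x \<in># B" by blast
    then have "0 < count A x" "0 < count B x" by simp_all
    then show False using c[of x] by linarith
  qed
qed

lemma tree_child:
  assumes t: "tree N (Node ts)" and v: "ts = add_mset v us"
  shows "tree (nums v) v" "\<And>w. w \<in># us \<Longrightarrow> nums v \<inter> nums w = {}"
proof -
  let ?f = "\<lambda>v. image_mset num (leaf_labels v)"
  have "?f v + image_mset num (\<Sum>\<^sub># (image_mset leaf_labels us)) = mset_set N" "finite N"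
    using t v by (simp_all add: tree_def)
  note * = mset_set_subset[OF this]
  have "branching v" using t v by (simp add: tree_def branching_Node)
  then show "tree (nums v) v" using *(1) by (simp add: tree_def nums_def)
  fix w assume "w \<in># us"
  then have "nums w \<subseteq> set_mset (image_mset num (\<Sum>\<^sub># (image_mset leaf_labels us)))"
    by (auto simp: nums_def)
  then show "nums v \<inter> nums w = {}" using *(2) by (auto simp: nums_def)
qed

text \<open>Labels are distinct and every child has at least one, so different children have
  disjoint label sets and no child occurs twice. The multiset of children can thus be treated as a
  set.\<close>

lemma tree_children:
  assumes t: "tree N (Node ts)"
  shows "\<And>v. v \<in># ts \<Longrightarrow> tree (nums v) v" "ts = mset_set (set_mset ts)"
    "\<And>v w. v \<in># ts \<Longrightarrow> w \<in># ts \<Longrightarrow> v \<noteq> w \<Longrightarrow> nums v \<inter> nums w = {}"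
proof -
  show 1: "tree (nums v) v" if "v \<in># ts" for v
  proof -
    obtain us where "ts = add_mset v us" using \<open>v \<in># ts\<close> by (meson mset_add)
    then show ?thesis by (rule tree_child(1)[OF t])
  qed
  show "nums v \<inter> nums w = {}" if "v \<in># ts" "w \<in># ts" "v \<noteq> w" for v w
  proof -
    obtain us where "ts = add_mset v us" using \<open>v \<in># ts\<close> by (meson mset_add)
    then show ?thesis using tree_child(2)[OF t] that by auto
  qed
  have "count ts v \<le> 1" for v
  proof (rule ccontr)
    assume c: "\<not> count ts v \<le> 1"
    then have "v \<in># ts" by (intro count_inI) linarith
    then obtain us where us: "ts = add_mset v us" by (meson mset_add)
    then have "v \<in># us" using c by (intro count_inI) simp
    then have "nums v = {}" using tree_child(2)[OF t us] by blast
    then show False using nums_ne 1[OF \<open>v \<in># ts\<close>] by (simp add: tree_def)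
  qed
  then show "ts = mset_set (set_mset ts)"
    by (intro multiset_eqI) (metis count_eq_zero_iff count_mset_set(1,3) finite_set_mset le_antisym
        less_one not_less)
qed

lemma tree_partition:
  assumes t: "tree N (Node ts)"
  shows "partition_on N (nums ` set_mset ts)" "inj_on nums (set_mset ts)"
      "size ts = card (nums ` set_mset ts)"
proof -
  note ch = tree_children[OF t]
  have ne: "nums v \<noteq> {}" if "v \<in># ts" for v using ch(1)[OF that] nums_ne by (simp add: tree_def)
  show inj: "inj_on nums (set_mset ts)"
    using ch(3) ne by (intro inj_onI) (metis inf.idem)
  show "partition_on N (nums ` set_mset ts)"
  proof (rule partition_onI)
    show "\<Union> (nums ` set_mset ts) = N" using tree_nums[OF t] by (simp add: nums_Node)
    fix p p' assume "p \<in> nums ` set_mset ts" "p' \<in> nums ` set_mset ts" "p \<noteq> p'"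
    then show "disjnt p p'" using ch(3) by (auto simp: disjnt_def)
  qed (use ne in auto)
  have "size ts = card (set_mset ts)" using ch(2) by (metis size_mset_set)
  then show "size ts = card (nums ` set_mset ts)" using inj by (simp add: card_image)
qed

lemma mset_set_Union:
  assumes "finite P" "\<And>C. C \<in> P \<Longrightarrow> finite C" "disjoint P"
  shows "(\<Sum>C\<in>P. mset_set C) = mset_set (\<Union>P)"
  using assms
proof (induction P rule: finite_induct)
  case (insert C P)
  have "mset_set (C \<union> \<Union>P) = mset_set C + mset_set (\<Union>P)"
    using insert by (intro mset_set_Union) (auto simp: disjoint_def)
  then show ?case using insert by (simp add: pairwise_insert)
qed simp

lemma leaf_labels_Node_set:
  "finite A \<Longrightarrow> image_mset num (leaf_labels (Node (mset_set A))) = (\<Sum>v\<in>A. image_mset num (leaf_labels v))"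
  by (induction A rule: finite_induct) simp_all

text \<open>Inverse to \<open>tree_partition\<close>: trees on the blocks are joined below a new
  root. Two blocks are required because every inner vertex branches.\<close>

lemma tree_NodeI:
  assumes N: "finite N" and P: "partition_on N P" "2 \<le> card P" and g: "\<And>C. C \<in> P \<Longrightarrow> tree C (g C)"
  shows "tree N (Node (mset_set (g ` P)))" "nums ` (g ` P) = P" "inj_on g P"
proof -
  have fin: "finite P" using P(2) by (metis card.infinite not_numeral_le_zero)
  have nums: "nums (g C) = C" if "C \<in> P" for C using tree_nums[OF g[OF that]] .
  then show inj: "inj_on g P" by (metis inj_onI)
  show "nums ` (g ` P) = P" using nums by (auto simp: image_image)
  have "image_mset num (leaf_labels (Node (mset_set (g ` P)))) =
      (\<Sum>v\<in>g ` P. image_mset num (leaf_labels v))"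
    using fin by (intro leaf_labels_Node_set finite_imageI)
  also have "\<dots> = (\<Sum>C\<in>P. image_mset num (leaf_labels (g C)))" using inj by (simp add: sum.reindex)
  also have "\<dots> = (\<Sum>C\<in>P. mset_set C)" using g by (intro sum.cong) (auto simp: tree_def)
  also have "\<dots> = mset_set N"
    using fin P(1) finite_partition_element[OF N P(1)] mset_set_Union[of P]
    by (simp add: partition_on_def)
  finally have "image_mset num (leaf_labels (Node (mset_set (g ` P)))) = mset_set N" .
  moreover have "branching (Node (mset_set (g ` P)))"
    using P(2) fin g inj by (auto simp: branching_Node card_image tree_def)
  ultimately show "tree N (Node (mset_set (g ` P)))" using N by (simp add: tree_def)
qed

text \<open>A tree that is not a leaf is a set partition of its labels together with a tree on each block.\<close>

lemma sum_trees:
  fixes G :: "blabel rtree \<Rightarrow> complex"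
  assumes N: "finite N" and T: "\<And>C t. t \<in> T C \<Longrightarrow> tree C t" and fin: "\<And>C. finite (T C)"
    and S: "\<And>t. t \<in> S \<longleftrightarrow> (\<exists>ts. t = Node ts \<and> tree N (Node ts) \<and> (\<forall>v\<in>#ts. v \<in> T (nums v)))"
    and F: "\<And>ts. Node ts \<in> S \<Longrightarrow> F (Node ts) = h (nums ` set_mset ts) * (\<Prod>v\<in>set_mset ts. G v)"
  shows "(\<Sum>t\<in>S. F t) = (\<Sum>P\<in>{P. partition_on N P \<and> 2 \<le> card P}. h P * (\<Prod>C\<in>P. \<Sum>v\<in>T C. G v))"
proof -
  let ?Ps = "{P. partition_on N P \<and> 2 \<le> card P}"
  have finPs: "finite ?Ps" using finite_partitions[OF N] by (rule finite_subset[rotated]) auto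
  have finP: "finite P" if "P \<in> ?Ps" for P using that finite_elements[OF N] by auto
  have "(\<Sum>P\<in>?Ps. h P * (\<Prod>C\<in>P. \<Sum>v\<in>T C. G v)) =
    (\<Sum>P\<in>?Ps. \<Sum>g\<in>Pi\<^sub>E P T. h P * (\<Prod>C\<in>P. G (g C)))"
  proof (rule sum.cong[OF refl])
    fix P assume "P \<in> ?Ps"
    then have "(\<Prod>C\<in>P. \<Sum>v\<in>T C. G v) = (\<Sum>g\<in>Pi\<^sub>E P T. \<Prod>C\<in>P. G (g C))"
      using finP fin by (intro prod_sum_PiE)
    then show "h P * (\<Prod>C\<in>P. \<Sum>v\<in>T C. G v) = (\<Sum>g\<in>Pi\<^sub>E P T. h P * (\<Prod>C\<in>P. G (g C)))"
      by (simp only: sum_distrib_left)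
  qed
  also have "\<dots> = (\<Sum>(P, g)\<in>(SIGMA P:?Ps. Pi\<^sub>E P T). h P * (\<Prod>C\<in>P. G (g C)))"
    using finPs finP fin by (intro sum.Sigma ballI finite_PiE)
  also have "\<dots> = (\<Sum>t\<in>S. F t)"
  \<comment> \<open>The inverse reads off the label sets of the children and sends each of them to
    the unique child with these labels.\<close>
  proof (rule sum.reindex_bij_witness[where j = "\<lambda>(P, g). Node (mset_set (g ` P))"
        and i = "\<lambda>t. (nums ` set_mset (children t), \<lambda>C\<in>nums ` set_mset (children t).
            the_inv_into (set_mset (children t)) nums C)"])
    fix p assume p: "p \<in> (SIGMA P:?Ps. Pi\<^sub>E P T)"
    obtain P g where Pg: "p = (P, g)" "P \<in> ?Ps" "g \<in> Pi\<^sub>E P T" using p by auto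
    have tr: "tree C (g C)" if "C \<in> P" for C using Pg(3) that T by (auto simp: PiE_iff)
    have P: "partition_on N P" "2 \<le> card P" using Pg(2) by auto
    note tn = tree_NodeI[OF N P tr, simplified]
    have set: "set_mset (mset_set (g ` P)) = g ` P" using finP[OF Pg(2)] by simp
    have nums: "nums (g C) = C" if "C \<in> P" for C using tree_nums[OF tr[OF that]] .
    have inS: "Node (mset_set (g ` P)) \<in> S"
      using tn(1) set nums Pg(3) unfolding S by (auto simp: PiE_iff)
    then show "(\<lambda>(P, g). Node (mset_set (g ` P))) p \<in> S" using Pg(1) by simp
    have "inj_on nums (g ` P)" using nums by (auto intro: inj_onI)
    then have inv: "the_inv_into (g ` P) nums C = g C" if "C \<in> P" for C
      using nums that by (intro the_inv_into_f_eq) auto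
    have "(\<lambda>C\<in>P. the_inv_into (g ` P) nums C) = g"
    proof
      fix C
      show "(\<lambda>C\<in>P. the_inv_into (g ` P) nums C) C = g C"
        using inv[of C] PiE_arb[OF Pg(3), of C] by (cases "C \<in> P") auto
    qed
    then show "(nums ` set_mset (children ((\<lambda>(P, g). Node (mset_set (g ` P))) p)),
        \<lambda>C\<in>nums ` set_mset (children ((\<lambda>(P, g). Node (mset_set (g ` P))) p)).
          the_inv_into (set_mset (children ((\<lambda>(P, g). Node (mset_set (g ` P))) p))) nums C) = p"
      using tn(2) by (simp only: Pg(1) prod.case children.simps set)
    have "F (Node (mset_set (g ` P))) = h P * (\<Prod>v\<in>g ` P. G v)"
      using F[OF inS] by (simp only: set tn(2))
    also have "(\<Prod>v\<in>g ` P. G v) = (\<Prod>C\<in>P. G (g C))" using tn(3) by (simp add: prod.reindex)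
    finally show "F ((\<lambda>(P, g). Node (mset_set (g ` P))) p) = (case p of (P, g) \<Rightarrow> h P * (\<Prod>C\<in>P. G (g C)))"
      by (simp add: Pg(1))
  next
    fix t assume "t \<in> S"
    then obtain ts where ts: "t = Node ts" "tree N (Node ts)" "\<forall>v\<in>#ts. v \<in> T (nums v)" using S by blast
    let ?P = "nums ` set_mset ts"
    let ?g = "\<lambda>C\<in>?P. the_inv_into (set_mset ts) nums C"
    note part = tree_partition[OF ts(2)]
    have g: "?g (nums v) = v" if "v \<in># ts" for v
      using the_inv_into_f_f[OF part(2) that] that by simp
    then have "(\<lambda>v. ?g (nums v)) ` set_mset ts = (\<lambda>v. v) ` set_mset ts" by (rule image_cong[OF refl])
    then have "?g ` ?P = set_mset ts" unfolding image_image image_ident .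
    then have "Node (mset_set (?g ` ?P)) = t" using tree_children(2)[OF ts(2)] ts(1) by simp
    then show "(\<lambda>(P, g). Node (mset_set (g ` P)))
        (nums ` set_mset (children t), \<lambda>C\<in>nums ` set_mset (children t). the_inv_into
            (set_mset (children t)) nums C) = t"
      by (simp add: ts(1))
    have "2 \<le> size ts" using ts(2) by (simp add: tree_def branching_Node)
    moreover have "?g \<in> Pi\<^sub>E ?P T"
    proof (rule PiE_I)
      fix C assume "C \<in> ?P"
      then obtain v where "v \<in># ts" "C = nums v" by blast
      then show "?g C \<in> T C" using g ts(3) by simp
    qed auto
    ultimately show "(nums ` set_mset (children t), \<lambda>C\<in>nums ` set_mset (children t).
        the_inv_into (set_mset (children t)) nums C) \<in> (SIGMA P:?Ps. Pi\<^sub>E P T)"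
      using part by (simp add: ts(1))
  qed
  finally show ?thesis by simp
qed

text \<open>Vertices are identified with subtrees, so a vertex common to two children would be
  counted only once on the left. The disjoint label sets of the children rule this out.\<close>

lemma prod_parents:
  fixes f :: "blabel rtree \<Rightarrow> complex"
  assumes t: "tree N (Node ts)"
  shows "(\<Prod>u\<in>parents (Node ts) - {Node ts}. f u) = (\<Prod>v\<in>set_mset ts. \<Prod>u\<in>parents v. f u)"
    and "(\<Prod>u\<in>parents (Node ts). f u) = f (Node ts) * (\<Prod>v\<in>set_mset ts. \<Prod>u\<in>parents v. f u)"
proof -
  note ch = tree_children[OF t]
  have ne: "ts \<noteq> {#}" using t by (auto simp: tree_def branching_Node)
  have fin: "finite (parents v)" for v :: "blabel rtree" by (simp add: parents_def finite_vertices)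
  have notin: "Node ts \<notin> parents v" if "v \<in># ts" for v
    using size_child[OF that] size_vertex_le[of "Node ts" v] by (auto simp: parents_def)
  have disj: "parents v \<inter> parents w = {}" if vw: "v \<in># ts" "w \<in># ts" "v \<noteq> w" for v w
  proof (rule ccontr)
    assume "parents v \<inter> parents w \<noteq> {}"
    then obtain u where u: "u \<in> vertices v" "u \<in> vertices w" by (auto simp: parents_def)
    have "branching u" using branching_vertex[OF _ u(1)] ch(1)[OF vw(1)] by (simp add: tree_def)
    then show False using nums_ne[of u] nums_vertex[OF u(1)] nums_vertex[OF u(2)] ch(3)[OF vw] by blast
  qed
  have eq: "parents (Node ts) - {Node ts} = (\<Union>v\<in>set_mset ts. parents v)"
    using notin by (auto simp: parents_Node[OF ne])
  show 1: "(\<Prod>u\<in>parents (Node ts) - {Node ts}. f u) = (\<Prod>v\<in>set_mset ts. \<Prod>u\<in>parents v. f u)"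
    unfolding eq using fin disj by (intro prod.UNION_disjoint) auto
  show "(\<Prod>u\<in>parents (Node ts). f u) = f (Node ts) * (\<Prod>v\<in>set_mset ts. \<Prod>u\<in>parents v. f u)"
    unfolding 1[symmetric] using fin by (intro prod.remove) (simp_all add: parents_Node[OF ne])
qed

lemma tree_not_Leaf:
  assumes "tree N t" "2 \<le> card N"
  obtains ts where "t = Node ts"
  using assms tree_nums[OF assms(1)] by (cases t) auto

text \<open>Every inner vertex has at least two children, hence at least two labels.\<close>

lemma tree_singleton:
  assumes t: "tree {k} t"
  obtains b where "t = Leaf (Label k b)"
proof (cases t)
  case (Leaf l)
  then show thesis using that tree_nums[OF t] by (cases l) auto
next
  case (Node ts)
  have P: "partition_on {k} (nums ` set_mset ts)" "2 \<le> card (nums ` set_mset ts)"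
    using tree_partition[of "{k}" ts] t Node by (auto simp: tree_def branching_Node)
  have "C = {k}" if "C \<in> nums ` set_mset ts" for C
    using that P(1) unfolding partition_on_def by (metis Union_upper subset_singletonD)
  then have "nums ` set_mset ts \<subseteq> {{k}}" by blast
  then have "card (nums ` set_mset ts) \<le> 1" using card_mono[of "{{k}}"] by simp
  then show thesis using P(2) by simp
qed

lemma tree_Leaf_iff: "tree N (Leaf l) \<longleftrightarrow> N = {num l}"
  using tree_nums[of N "Leaf l"] by (auto simp: tree_def)

lemma finite_tree_set: "finite {t. tree N t}"
proof (cases "finite N")
  case True
  define L where "L = (\<lambda>(i, b). Label i b) ` (N \<times> UNIV)"
  have "finite L" using True by (simp add: L_def)
  moreover have "{t. tree N t} \<subseteq> {t. set_mset (leaf_labels t) \<subseteq> L \<and> size (leaf_labels t) \<le> card N \<and>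
      Node {#} \<notin> vertices t \<and> (\<forall>u\<in>parents t. 2 \<le> num_children u)}"
  proof
    fix t assume "t \<in> {t. tree N t}"
    then have t: "tree N t" by simp
    have "l \<in> L" if "l \<in># leaf_labels t" for l
    proof -
      have "num l \<in> N" using tree_nums[OF t] that by (auto simp: nums_def)
      then show ?thesis unfolding L_def by (intro image_eqI[of _ _ "(num l, barred l)"]) auto
    qed
    moreover have "size (leaf_labels t) = card N"
      using t unfolding tree_def by (metis size_image_mset size_mset_set)
    ultimately show "t \<in> {t. set_mset (leaf_labels t) \<subseteq> L \<and> size (leaf_labels t) \<le> card N \<and>
      Node {#} \<notin> vertices t \<and> (\<forall>u\<in>parents t. 2 \<le> num_children u)}"
      using t by (auto simp: tree_def branching_def)
  qed
  ultimately show ?thesis using finite_trees finite_subset by blast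
qed (simp add: tree_def)

lemma tree_inj_num:
  assumes t: "tree N t" and l: "l \<in># leaf_labels t" "l' \<in># leaf_labels t" "num l = num l'"
  shows "l = l'"
proof (rule ccontr)
  assume ne: "l \<noteq> l'"
  obtain M where M: "leaf_labels t = add_mset l M" using l(1) by (meson mset_add)
  then have "l' \<in># M" using l(2) ne by simp
  then obtain M' where "M = add_mset l' M'" by (meson mset_add)
  then have "count (image_mset num (leaf_labels t)) (num l) \<ge> 2" using M l(3) by simp
  moreover have "count (mset_set N) (num l) \<le> 1" by (simp add: count_mset_set')
  ultimately show False using t by (simp add: tree_def)
qed

section \<open>Bars of the leaves and vertices above the leaf 0\<close>

definition sgn_of :: "blabel rtree \<Rightarrow> nat \<Rightarrow> bool" where
  "sgn_of t i \<longleftrightarrow> Label i True \<in># leaf_labels t"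

lemma barred_sgn_of:
  assumes "tree N t" "l \<in># leaf_labels t"
  shows "barred l = sgn_of t (num l)"
proof
  assume "barred l"
  then show "sgn_of t (num l)" using assms(2) unfolding sgn_of_def by (cases l) simp
next
  assume "sgn_of t (num l)"
  then have "l = Label (num l) True"
    using tree_inj_num[OF assms] unfolding sgn_of_def by simp
  then show "barred l" by (metis blabel.sel(2))
qed

lemma label_mem_iff:
  assumes "tree N t"
  shows "Label i b \<in># leaf_labels t \<longleftrightarrow> i \<in> nums t \<and> b = sgn_of t i"
proof
  assume l: "Label i b \<in># leaf_labels t"
  then show "i \<in> nums t \<and> b = sgn_of t i"
    using barred_sgn_of[OF assms l] by (force simp: nums_def)
next
  assume "i \<in> nums t \<and> b = sgn_of t i"
  then obtain l where l: "l \<in># leaf_labels t" "num l = i" "b = sgn_of t i" by (auto simp: nums_def)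
  then show "Label i b \<in># leaf_labels t" using barred_sgn_of[OF assms l(1)] by (cases l) simp
qed

lemma sgn_of_vertex:
  assumes "tree N t" "u \<in> vertices t" "tree (nums u) u" "i \<in> nums u"
  shows "sgn_of u i = sgn_of t i"
proof -
  have "Label i (sgn_of u i) \<in># leaf_labels u" using label_mem_iff[OF assms(3)] assms(4) by blast
  then have "Label i (sgn_of u i) \<in># leaf_labels t" using leaf_labels_vertex[OF assms(2)] by blast
  then show ?thesis using label_mem_iff[OF assms(1)] by blast
qed

lemma tree_vertex:
  assumes "tree N t" "u \<in> vertices t"
  shows "tree (nums u) u"
  using assms
proof (induction t arbitrary: N)
  case (Leaf l)
  then show ?case using tree_nums[of N "Leaf l"] by (simp add: tree_Leaf_iff)
next
  case (Node ts)
  then show ?case using tree_children(1)[OF Node.prems(1)] tree_nums[OF Node.prems(1)] by auto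
qed

lemma min_label:
  assumes "tree N t"
  shows "min_label t = Label (Min (nums t)) (sgn_of t (Min (nums t)))"
proof -
  have "nums t \<noteq> {}" using assms nums_ne by (simp add: tree_def)
  then have ex: "Label (Min (nums t)) (sgn_of t (Min (nums t))) \<in># leaf_labels t"
    using label_mem_iff[OF assms] Min_in[OF finite_nums] by blast
  have mem: "min_label t \<in># leaf_labels t"
    unfolding min_label_def by (rule arg_min_natI[of "\<lambda>l. l \<in># leaf_labels t", OF ex])
  have "num (min_label t) \<le> num l" if "l \<in># leaf_labels t" for l
    unfolding min_label_def by (rule arg_min_nat_le[of "\<lambda>l. l \<in># leaf_labels t", OF that])
  then have "num (min_label t) = Min (nums t)"
    using mem finite_nums by (intro Min_eqI[symmetric]) (auto simp: nums_def)
  then show ?thesis using barred_sgn_of[OF assms mem] by (cases "min_label t") simp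
qed

definition zero_plain :: "blabel rtree \<Rightarrow> bool" where
  "zero_plain t \<longleftrightarrow> (\<forall>l\<in>#leaf_labels t. num l = 0 \<longrightarrow> \<not> barred l)"

lemma zero_mem_iff:
  assumes "zero_plain t" "u \<in> vertices t"
  shows "zero_leaf \<in> vertices u \<longleftrightarrow> 0 \<in> nums u"
proof -
  have "0 \<in> nums u \<longleftrightarrow> Label 0 False \<in># leaf_labels u"
  proof
    assume "0 \<in> nums u"
    then obtain l where l: "l \<in># leaf_labels u" "num l = 0" by (auto simp: nums_def)
    then have "\<not> barred l" using assms leaf_labels_vertex unfolding zero_plain_def by blast
    then show "Label 0 False \<in># leaf_labels u" using l by (cases l) simp
  qed (force simp: nums_def)
  then show ?thesis by (simp only: label_iff_vertex)
qed

text \<open>This turns ancestry, which refers to the whole tree, into a property of the vertex, so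
  that products over vertices can be split over subtrees.\<close>

lemma ancestors_zero:
  assumes "tree N t" "zero_plain t"
  shows "ancestors t zero_leaf = {u \<in> parents t. 0 \<in> nums u}"
proof (intro equalityI subsetI)
  fix u assume "u \<in> ancestors t zero_leaf"
  then have u: "u \<in> vertices t" "zero_leaf \<in> vertices u" "u \<noteq> zero_leaf"
    by (auto simp: ancestors_def descendants_def)
  then have "children u \<noteq> {#}" by (cases u) auto
  then show "u \<in> {u \<in> parents t. 0 \<in> nums u}" using u zero_mem_iff[OF assms(2)]
    by (simp add: parents_def)
next
  fix u assume "u \<in> {u \<in> parents t. 0 \<in> nums u}"
  then have u: "u \<in> vertices t" "children u \<noteq> {#}" "zero_leaf \<in> vertices u"
    using zero_mem_iff[OF assms(2)] by (auto simp: parents_def)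
  then show "u \<in> ancestors t zero_leaf" by (cases u) (auto simp: ancestors_def descendants_def)
qed

section \<open>Blocks\<close>

lemma block_A: "block TypeA t u = (\<lambda>i. Label i False) ` nums u"
  by (induction u) (auto simp: nums_Node)

text \<open>The closed form of the recursively defined bars: blocks containing 0 carry none, all
  others are normalized to have their minimum unbarred.\<close>

definition rel_sign :: "blabel rtree \<Rightarrow> nat \<Rightarrow> bool" where
  "rel_sign u i \<longleftrightarrow> 0 \<notin> nums u \<and> sgn_of u i \<noteq> sgn_of u (Min (nums u))"

lemma num_image_Label: "num ` (\<lambda>i. Label i (f i)) ` C = C"
  by (simp add: image_image)

text \<open>By induction every block has its minimum unbarred. The parity test in
  \<open>join_blocks\<close> then compares only the bars of the minimal leaf labels, and barring the
  block of a child passes from signs relative to the minimum of the child to signs relative to the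
  minimum of the vertex.\<close>

lemma block_B:
  assumes X: "X \<noteq> TypeA" and t: "tree N t" "zero_plain t" and u: "u \<in> vertices t"
  shows "block X t u = (\<lambda>i. Label i (rel_sign u i)) ` nums u"
  using u
proof (induction u)
  case (Leaf l)
  have "tree {num l} (Leaf l)" using t(1) by (simp add: tree_Leaf_iff)
  then show ?case by (simp add: rel_sign_def)
next
  case (Node us)
  let ?u = "Node us"
  note tu = tree_vertex[OF t(1) Node.prems]
  note ch = tree_children[OF tu]
  have vert: "v \<in> vertices t" if "v \<in># us" for v
    using vertices_trans[OF Node.prems] that vertices_self by fastforce
  have IH: "block X t v = (\<lambda>i. Label i (rel_sign v i)) ` nums v" if "v \<in># us" for v
    using Node.IH[OF that vert[OF that]] .
  have sgn: "sgn_of v i = sgn_of ?u i" if "v \<in># us" "i \<in> nums v" for v i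
    using sgn_of_vertex[OF tu _ ch(1)] that vertices_self by fastforce
  have us: "us \<noteq> {#}" using tu by (auto simp: tree_def branching_Node)
  have anc: "?u \<in> ancestors t zero_leaf \<longleftrightarrow> 0 \<in> nums ?u"
    using ancestors_zero[OF t] Node.prems us by (simp add: parents_def)
  show ?case
  proof (cases "0 \<in> nums ?u")
    case True
    then have "block X t ?u = (\<Union>v\<in>set_mset us. unbar_block (block X t v))"
      using X anc by simp
    also have "\<dots> = (\<Union>v\<in>set_mset us. (\<lambda>i. Label i False) ` nums v)"
      by (rule SUP_cong[OF refl]) (simp add: IH unbar_block_def image_image)
    also have "\<dots> = (\<lambda>i. Label i (rel_sign ?u i)) ` nums ?u"
      using True by (auto simp: rel_sign_def nums_Node)
    finally show ?thesis .
  next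
    case False
    let ?k = "Min (nums ?u)"
    let ?P = "(\<lambda>v. (min_label v, block X t v)) ` set_mset us"
    have k: "?k \<in> nums ?u" using tu nums_ne Min_in[OF finite_nums] by (simp add: tree_def)
    then obtain v0 where v0: "v0 \<in># us" "?k \<in> nums v0" by (auto simp: nums_Node)
    have no0: "0 \<notin> nums v" if "v \<in># us" for v using False that by (auto simp: nums_Node)
    have min0: "Min (nums v0) = ?k"
    proof (rule Min_eqI[OF finite_nums])
      show "?k \<in> nums v0" by fact
      show "?k \<le> i" if "i \<in> nums v0" for i
        using that v0(1) by (intro Min_le[OF finite_nums]) (auto simp: nums_Node)
    qed
    have ml: "min_label v = Label (Min (nums v)) (sgn_of ?u (Min (nums v)))" if "v \<in># us" for v
    proof -
      have "Min (nums v) \<in> nums v" using ch(1)[OF that] nums_ne Min_in[OF finite_nums]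
        by (simp add: tree_def)
      then show ?thesis using min_label[OF ch(1)[OF that]] sgn[OF that] by simp
    qed
    have the: "(THE p. p \<in> ?P \<and> num (min_label ?u) \<in> num ` snd p) = (min_label v0, block X t v0)"
    proof (rule the_equality)
      have numk: "num (min_label ?u) = ?k" using min_label[OF tu] by simp
      show "(min_label v0, block X t v0) \<in> ?P \<and>
          num (min_label ?u) \<in> num ` snd (min_label v0, block X t v0)"
        using v0 IH[OF v0(1)] numk by (auto simp: num_image_Label)
      fix p assume "p \<in> ?P \<and> num (min_label ?u) \<in> num ` snd p"
      then obtain v where v: "v \<in># us" "p = (min_label v, block X t v)" "?k \<in> num ` block X t v"
        unfolding numk by auto
      then have "?k \<in> nums v" using IH[OF v(1)] by (simp add: num_image_Label)
      then have "v = v0" using ch(3)[OF v(1) v0(1)] v0(2) by blast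
      then show "p = (min_label v0, block X t v0)" using v(2) by simp
    qed
    \<comment> \<open>Both memberships in the parity test are therefore false, and their comparison
      always yields true.\<close>
    have no_true: "Label (Min (nums v)) True \<notin> block X t v" if "v \<in># us" for v
      unfolding IH[OF that] by (auto simp: rel_sign_def)
    have part: "(if (barred (min_label v0) = barred (min_label v)) =
          ((Label (num (min_label v0)) True \<in> block X t v0)
              = (Label (num (min_label v)) True \<in> block X t v))
        then block X t v else bar_block (block X t v)) = (\<lambda>i. Label i (rel_sign ?u i)) ` nums v"
      if v: "v \<in># us" for v
    proof -
      have "rel_sign v i = (sgn_of ?u i \<noteq> sgn_of ?u (Min (nums v)))" if "i \<in> nums v" for i
      proof -
        have "Min (nums v) \<in> nums v" using that by (intro Min_in[OF finite_nums]) auto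
        then show ?thesis unfolding rel_sign_def using no0[OF v] sgn[OF v] that by simp
      qed
      then have b: "block X t v = (\<lambda>i. Label i (sgn_of ?u i \<noteq> sgn_of ?u (Min (nums v)))) ` nums v"
        unfolding IH[OF v] by (intro image_cong) auto
      have cond: "((barred (min_label v0) = barred (min_label v)) =
          ((Label (num (min_label v0)) True \<in> block X t v0)
              = (Label (num (min_label v)) True \<in> block X t v)))
          \<longleftrightarrow> sgn_of ?u ?k = sgn_of ?u (Min (nums v))"
        using no_true[OF v] no_true[OF v0(1)] ml[OF v] ml[OF v0(1)] min0 by simp
      have rs: "rel_sign ?u = (\<lambda>i. sgn_of ?u i \<noteq> sgn_of ?u ?k)"
        using False by (simp add: rel_sign_def fun_eq_iff)
      show ?thesis
      proof (cases "sgn_of ?u ?k = sgn_of ?u (Min (nums v))")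
        case True
        show ?thesis
          by (simp only: cond if_P[OF True]) (simp only: b rs True)
      next
        case neq: False
        have "bar_block (block X t v) =
            (\<lambda>i. Label i (\<not> (sgn_of ?u i \<noteq> sgn_of ?u (Min (nums v))))) ` nums v"
          unfolding bar_block_def b image_image blabel.sel ..
        also have "\<dots> = (\<lambda>i. Label i (rel_sign ?u i)) ` nums v"
          using neq by (intro image_cong) (auto simp: rs)
        finally show ?thesis by (simp only: cond if_not_P[OF neq])
      qed
    qed
    have "block X t ?u = join_blocks (min_label ?u) ?P" using X anc False by simp
    also have "\<dots> = (\<Union>v\<in>set_mset us. (\<lambda>i. Label i (rel_sign ?u i)) ` nums v)"
      unfolding join_blocks_def the Let_def prod.case
      using part by (simp add: image_image)
    also have "\<dots> = (\<lambda>i. Label i (rel_sign ?u i)) ` nums ?u" by (auto simp: nums_Node)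
    finally show ?thesis .
  qed
qed

section \<open>Forms determined by pairs of labels\<close>

lemma form_of_pair:
  assumes "1 \<le> i" "i < j"
  shows "form_of {Label i b, Label j b'} = pair_form (if b = b' then 1 else -1) i j"
  unfolding form_of_def
proof (rule the_equality)
  show "determines_form {Label i b, Label j b'} (pair_form (if b = b' then 1 else -1) i j)"
    using determines_form.intros(1)[OF assms, of b] determines_form.intros(2)[OF assms, of b]
    by (cases b; cases b') auto
  fix L assume "determines_form {Label i b, Label j b'} L"
  then show "L = pair_form (if b = b' then 1 else -1) i j"
    using assms by cases (auto simp: doubleton_eq_iff)
qed

lemma form_of_zero:
  assumes "1 \<le> k"
  shows "form_of {Label 0 False, Label k False} = coord_form k"
  unfolding form_of_def
proof (rule the_equality)
  show "determines_form {Label 0 False, Label k False} (coord_form k)"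
    using assms by (rule determines_form.intros)
  fix L assume "determines_form {Label 0 False, Label k False} L"
  then show "L = coord_form k" using assms by cases (auto simp: doubleton_eq_iff)
qed

text \<open>Different pairs in a block determine different forms, and a form depends on the two bars
  only through their agreement.\<close>

lemma prod_pairs:
  fixes T :: "linform \<Rightarrow> complex"
  assumes "0 \<notin> C"
  shows "(\<Prod>J\<in>pairs ((\<lambda>i. Label i (\<tau> i)) ` C). T (form_of J)) = (\<Prod>L\<in>signed_forms C \<tau>. T L)"
proof -
  let ?S = "{(i, j). i \<in> C \<and> j \<in> C \<and> i < j}"
  let ?p = "\<lambda>(i, j). {Label i (\<tau> i), Label j (\<tau> j)}"
  have "pairs ((\<lambda>i. Label i (\<tau> i)) ` C) = ?p ` ?S"
  proof (intro equalityI subsetI)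
    fix J assume J: "J \<in> pairs ((\<lambda>i. Label i (\<tau> i)) ` C)"
    then obtain x y where xy: "J = {x, y}" "x \<noteq> y" by (auto simp: pairs_def card_2_iff)
    then obtain i j where ij: "i \<in> C" "j \<in> C" "x = Label i (\<tau> i)" "y = Label j (\<tau> j)"
      using J by (auto simp: pairs_def)
    then have "i < j \<or> j < i" using xy(2) by auto
    then show "J \<in> ?p ` ?S"
    proof
      assume "i < j" then show ?thesis using ij xy by (intro image_eqI[of _ _ "(i, j)"]) auto
    next
      assume "j < i" then show ?thesis using ij xy by (intro image_eqI[of _ _ "(j, i)"]) auto
    qed
  qed (auto simp: pairs_def)
  moreover have "inj_on ?p ?S" by (auto simp: inj_on_def doubleton_eq_iff)
  ultimately have "(\<Prod>J\<in>pairs ((\<lambda>i. Label i (\<tau> i)) ` C). T (form_of J)) = (\<Prod>p\<in>?S. T (form_of (?p p)))"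
    by (simp add: prod.reindex)
  also have "\<dots> = (\<Prod>p\<in>?S. T ((\<lambda>(i, j). pair_form (if \<tau> i = \<tau> j then 1 else -1) i j) p))"
  proof (rule prod.cong[OF refl])
    fix p assume p: "p \<in> ?S"
    obtain i j where ij: "p = (i, j)" "i \<in> C" "j \<in> C" "i < j" using p by auto
    have "1 \<le> i" using ij(2) assms by (metis One_nat_def Suc_leI gr0I)
    then show "T (form_of (?p p)) = T ((\<lambda>(i, j). pair_form (if \<tau> i = \<tau> j then 1 else -1) i j) p)"
      unfolding ij(1) prod.case using form_of_pair[of i j "\<tau> i" "\<tau> j"] ij(4) by simp
  qed
  also have "\<dots> = (\<Prod>L\<in>signed_forms C \<tau>. T L)"
  proof -
    have "inj_on (\<lambda>(i, j). pair_form (if \<tau> i = \<tau> j then 1 else -1) i j) ?S"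
    proof (rule inj_onI)
      fix x y assume xy: "x \<in> ?S" "y \<in> ?S" and eq:
          "(\<lambda>(i, j). pair_form (if \<tau> i = \<tau> j then 1 else -1) i j) x =
        (\<lambda>(i, j). pair_form (if \<tau> i = \<tau> j then 1 else -1) i j) y"
      obtain i j i' j' where "x = (i, j)" "y = (i', j')" "i < j" "i' < j'" using xy by auto
      then show "x = y" using pair_form_inject[of _ i j _ i' j'] eq by auto
    qed
    then show ?thesis unfolding signed_forms_def by (simp add: prod.reindex)
  qed
  finally show ?thesis .
qed

lemma prod_pairs_of_type:
  fixes T :: "linform \<Rightarrow> complex"
  assumes "finite N" "0 \<in> N"
  shows "(\<Prod>J\<in>pairs_of_type X N. T (form_of J)) = (\<Prod>L\<in>zero_forms X N. T L)"
proof -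
  let ?S = "{1, -1} \<times> {(i, j). i \<in> N - {0} \<and> j \<in> N - {0} \<and> i < j} :: (int \<times> nat \<times> nat) set"
  let ?p = "\<lambda>(\<epsilon>, i, j). {Label i False, Label j (\<epsilon> \<noteq> 1)}"
  let ?f = "\<lambda>(\<epsilon>, i, j). pair_form \<epsilon> i j"
  let ?z = "\<lambda>k. {Label 0 False, Label k False}"
  have finS: "finite ?S"
    using assms(1) by (intro finite_cartesian_product finite_subset[of "{(i, j). _ i j}" "N \<times> N"]) auto
  have D: "pairs_D N = ?p ` ?S"
  proof (intro equalityI subsetI)
    fix J assume "J \<in> pairs_D N"
    then obtain i j b where ij: "J = {Label i False, Label j b}" "i \<in> N - {0}" "j \<in> N - {0}" "i < j"
      unfolding pairs_D_def by blast
    then show "J \<in> ?p ` ?S" by (intro image_eqI[of _ _ "(if b then -1 else 1, i, j)"]) auto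
  next
    fix J assume "J \<in> ?p ` ?S"
    then obtain x where x: "J = ?p x" "x \<in> ?S" by (rule imageE)
    obtain \<epsilon> i j where "x = (\<epsilon>, i, j)" by (rule prod_cases3)
    then have "J = {Label i False, Label j (\<epsilon> \<noteq> 1)}" "i \<in> N - {0}" "j \<in> N - {0}" "i < j"
      using x by simp_all
    then show "J \<in> pairs_D N" unfolding pairs_D_def by blast
  qed
  have injp: "inj_on ?p ?S" by (auto simp: inj_on_def doubleton_eq_iff)
  have injf: "inj_on ?f ?S"
  proof (rule inj_onI)
    fix x y assume xy: "x \<in> ?S" "y \<in> ?S" and eq: "?f x = ?f y"
    obtain \<epsilon> i j where x: "x = (\<epsilon>, i, j)" "\<epsilon> \<in> {1, -1}" "i < j" using xy(1) by auto
    obtain \<epsilon>' i' j' where y: "y = (\<epsilon>', i', j')" "\<epsilon>' \<in> {1, -1}" "i' < j'" using xy(2) by auto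
    show "x = y" using pair_form_inject[of \<epsilon> i j \<epsilon>' i' j'] eq x y by simp
  qed
  have "(\<Prod>J\<in>pairs_D N. T (form_of J)) = (\<Prod>p\<in>?S. T (form_of (?p p)))"
    unfolding D using injp by (simp add: prod.reindex)
  also have "\<dots> = (\<Prod>p\<in>?S. T (?f p))"
  proof (rule prod.cong[OF refl])
    fix p assume "p \<in> ?S"
    then obtain \<epsilon> i j where p: "p = (\<epsilon>, i, j)" "\<epsilon> \<in> {1, -1}" "i \<in> N - {0}" "i < j" by auto
    have "form_of {Label i False, Label j (\<epsilon> \<noteq> 1)} = pair_form \<epsilon> i j"
      using p by (subst form_of_pair) auto
    then show "T (form_of (?p p)) = T (?f p)" by (simp add: p(1))
  qed
  also have "\<dots> = (\<Prod>L\<in>?f ` ?S. T L)" using injf by (simp add: prod.reindex)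
  finally have pD: "(\<Prod>J\<in>pairs_D N. T (form_of J)) = (\<Prod>L\<in>?f ` ?S. T L)" .
  show ?thesis
  proof (cases "X = TypeD")
    case True
    then show ?thesis using pD by (simp add: pairs_of_type_def zero_forms_def)
  next
    case False
    have B: "pairs_B N = ?z ` (N - {0}) \<union> pairs_D N" unfolding pairs_B_def using assms(2) by auto
    have "pairs_of_type X N = ?z ` (N - {0}) \<union> pairs_D N" using False B by (simp add: pairs_of_type_def)
    moreover have "0 \<notin> num ` J" if "J \<in> pairs_D N" for J using that unfolding pairs_D_def by auto
    then have "?z ` (N - {0}) \<inter> pairs_D N = {}" by fastforce
    moreover have "finite (pairs_D N)" unfolding D using finS by (rule finite_imageI)
    ultimately have "(\<Prod>J\<in>pairs_of_type X N. T (form_of J)) =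
        (\<Prod>J\<in>?z ` (N - {0}). T (form_of J)) * (\<Prod>J\<in>pairs_D N. T (form_of J))"
      using assms(1) by (simp add: prod.union_disjoint)
    also have "(\<Prod>J\<in>?z ` (N - {0}). T (form_of J)) = (\<Prod>k\<in>N - {0}. T (form_of (?z k)))"
      by (subst prod.reindex) (auto simp: inj_on_def doubleton_eq_iff)
    also have "\<dots> = (\<Prod>k\<in>N - {0}. T (coord_form k))"
      by (rule prod.cong) (auto simp: form_of_zero)
    also have "\<dots> = (\<Prod>L\<in>coord_form ` (N - {0}). T L)"
    proof -
      have "inj_on coord_form (N - {0})" using supp_coord_form by (metis inj_onI singleton_inject)
      then show ?thesis by (simp add: prod.reindex)
    qed
    also have "(\<Prod>L\<in>coord_form ` (N - {0}). T L) * (\<Prod>J\<in>pairs_D N. T (form_of J)) =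
        (\<Prod>L\<in>?f ` ?S \<union> coord_form ` (N - {0}). T L)"
    proof -
      have "?f ` ?S \<inter> coord_form ` (N - {0}) = {}"
      proof (rule ccontr)
        assume "?f ` ?S \<inter> coord_form ` (N - {0}) \<noteq> {}"
        then obtain L where L: "L \<in> ?f ` ?S" "L \<in> coord_form ` (N - {0})" by (meson disjoint_iff)
        obtain x where "L = ?f x" "x \<in> ?S" using L(1) by (rule imageE)
        moreover obtain k where "L = coord_form k" using L(2) by (rule imageE)
        ultimately have x: "x \<in> ?S" "?f x = coord_form k" by simp_all
        obtain \<epsilon> i j where "x = (\<epsilon>, i, j)" by (rule prod_cases3)
        then have "\<epsilon> \<in> {1, -1}" "i < j" "pair_form \<epsilon> i j = coord_form k" using x by simp_all
        then have "{i, j} = {k}" using supp_pair_form supp_coord_form by metis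
        then show False using \<open>i < j\<close> by auto
      qed
      from prod.union_disjoint[OF finite_imageI[OF finS]
          finite_imageI[OF finite_Diff[OF assms(1)]] this, of T]
      show ?thesis unfolding pD by (simp only: mult.commute)
    qed
    finally show ?thesis using False by (simp add: zero_forms_def)
  qed
qed

text \<open>These are the forms vanishing on the residue classes that the vertex describes. When 0
  is absent, the bars of the leaves and those of the block differ by a global flip at most, which
  changes no form; so the signs are read off the leaves.\<close>

definition vforms :: "arr_type \<Rightarrow> blabel rtree \<Rightarrow> linform set" where
  "vforms X u = (if 0 \<in> nums u then zero_forms X (nums u) else signed_forms (nums u) (sgn_of u))"

definition vweight :: "arr_type \<Rightarrow> complex \<Rightarrow> (linform \<Rightarrow> complex) \<Rightarrow> blabel rtree \<Rightarrow> complex" where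
  "vweight X Z T u = Z ^ (card (nums u) - 1) * (\<Prod>L\<in>vforms X u. T L)"

lemma finite_parents: "finite (parents t)"
  by (simp add: parents_def finite_vertices)

text \<open>Blocks enter only through their label sets and the agreement of bars. The two products
  of \<open>cgp\<close> are told apart by membership of 0, which \<open>vforms\<close> tests itself,
  so they merge into one.\<close>

lemma cgp_eq:
  assumes t: "tree N t" "zero_plain t" and X: "X = TypeA \<Longrightarrow> 0 \<notin> N \<and> (\<forall>l\<in>#leaf_labels t. \<not> barred l)"
  shows "cgp X t Z T = (\<Prod>u\<in>parents t - {t}. gp (vweight X Z T u))"
proof -
  let ?A = "ancestors t zero_leaf - {t}"
  have anc: "?A = {u \<in> parents t - {t}. 0 \<in> nums u}" using ancestors_zero[OF t] by auto
  have block: "\<exists>\<tau>. block X t u = (\<lambda>i. Label i (\<tau> i)) ` nums u \<and>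
      (0 \<notin> nums u \<longrightarrow> signed_forms (nums u) \<tau> = signed_forms (nums u) (sgn_of u))" if u: "u \<in>
          parents t" for u
  proof (cases "X = TypeA")
    case True
    have "\<not> sgn_of u i" for i
      using X[OF True] u leaf_labels_vertex[of u t] unfolding sgn_of_def parents_def by fastforce
    then have "signed_forms (nums u) (\<lambda>_. False) = signed_forms (nums u) (sgn_of u)"
      by (intro signed_forms_cong) simp
    then show ?thesis using block_A[of t u] True by (intro exI[of _ "\<lambda>_. False"]) simp
  next
    case False
    have "u \<in> vertices t" using u by (simp add: parents_def)
    moreover have "signed_forms (nums u) (rel_sign u) = signed_forms (nums u) (sgn_of u)" if "0 \<notin> nums u"
      using that by (intro signed_forms_cong) (auto simp: rel_sign_def)
    ultimately show ?thesis using block_B[OF False t] by (intro exI[of _ "rel_sign u"]) simp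
  qed
  have card: "card (block X t u) = card (nums u)" and num: "num ` block X t u = nums u"
    if u: "u \<in> parents t" for u
  proof -
    obtain \<tau> where b: "block X t u = (\<lambda>i. Label i (\<tau> i)) ` nums u" using block[OF u] by blast
    show "num ` block X t u = nums u" unfolding b by (rule num_image_Label)
    show "card (block X t u) = card (nums u)" unfolding b by (rule card_image) (simp add: inj_on_def)
  qed
  have "cgp X t Z T = (\<Prod>u\<in>(parents t - {t}) - ?A. gp (vweight X Z T u)) * (\<Prod>u\<in>?A. gp (vweight X Z T u))"
    unfolding cgp_def
  proof (rule arg_cong2[where f = "(*)"])
    show "(\<Prod>u\<in>(parents t - {t}) - ?A. gp (Z ^ (card (block X t u) - 1) *
        (\<Prod>J\<in>pairs (block X t u). T (form_of J)))) =
      (\<Prod>u\<in>(parents t - {t}) - ?A. gp (vweight X Z T u))"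
    proof (rule prod.cong[OF refl])
      fix u assume "u \<in> (parents t - {t}) - ?A"
      then have u: "u \<in> parents t" "0 \<notin> nums u" using anc by auto
      obtain \<tau> where b: "block X t u = (\<lambda>i. Label i (\<tau> i)) ` nums u" "signed_forms (nums u) \<tau> =
          signed_forms (nums u) (sgn_of u)"
        using block[OF u(1)] u(2) by blast
      have "(\<Prod>J\<in>pairs (block X t u). T (form_of J)) = (\<Prod>L\<in>vforms X u. T L)"
        unfolding b(1) prod_pairs[OF u(2)] b(2) using u(2) by (simp add: vforms_def)
      then show "gp (Z ^ (card (block X t u) - 1) * (\<Prod>J\<in>pairs (block X t u). T (form_of J))) =
          gp (vweight X Z T u)"
        by (simp add: vweight_def card[OF u(1)])
    qed
    show "(\<Prod>u\<in>?A. gp (Z ^ (card (block X t u) - 1) *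
        (\<Prod>J\<in>pairs_of_type X (num ` block X t u). T (form_of J)))) =
      (\<Prod>u\<in>?A. gp (vweight X Z T u))"
    proof (rule prod.cong[OF refl])
      fix u assume "u \<in> ?A"
      then have u: "u \<in> parents t" "0 \<in> nums u" using anc by auto
      show "gp (Z ^ (card (block X t u) - 1) * (\<Prod>J\<in>pairs_of_type X (num ` block X t u). T (form_of J)))
          = gp (vweight X Z T u)"
        unfolding vweight_def vforms_def card[OF u(1)] num[OF u(1)]
            prod_pairs_of_type[OF finite_nums u(2)]
        using u(2) by simp
    qed
  qed
  also have "\<dots> = (\<Prod>u\<in>parents t - {t}. gp (vweight X Z T u))"
    using anc finite_parents by (intro prod.subset_diff[symmetric]) auto
  finally show ?thesis .
qed

section \<open>Factorization of the polynomials\<close>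

text \<open>The correction of type D is attached to the vertex it belongs to: since all parents
  branch, the closest branching ancestor of the leaf 0 is its parent, recognizable by having this
  leaf as a child.\<close>

definition vpoly :: "arr_type \<Rightarrow> blabel rtree \<Rightarrow> int poly" where
  "vpoly X u = (let c = num_children u in
     if 0 \<in> nums u then
       if X = TypeD \<and> zero_leaf \<in># children u then qnum (2 * c - num_unbranched u - 2) * qdfact (c - 2)
       else qdfact (c - 1)
     else qfact (c - 1))"

lemma pi_A_eq:
  assumes "tree N t" "0 \<notin> N"
  shows "pi_A t = (\<Prod>u\<in>parents t. vpoly TypeA u)"
proof -
  have "0 \<notin> nums u" if "u \<in> parents t" for u
    using that nums_vertex[of u t] tree_nums[OF assms(1)] assms(2) by (auto simp: parents_def)
  then show ?thesis unfolding pi_A_def by (intro prod.cong) (auto simp: vpoly_def)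
qed

lemma pi_B_eq:
  assumes "tree N t" "zero_plain t"
  shows "pi_B t = (\<Prod>u\<in>parents t. vpoly TypeB u)"
proof -
  have "(\<Prod>u\<in>parents t. vpoly TypeB u) =
    (\<Prod>u\<in>parents t - ancestors t zero_leaf. vpoly TypeB u) * (\<Prod>u\<in>ancestors t zero_leaf. vpoly TypeB u)"
    using ancestors_zero[OF assms] finite_parents by (intro prod.subset_diff) auto
  moreover have "(\<Prod>u\<in>ancestors t zero_leaf. vpoly TypeB u) =
      (\<Prod>u\<in>ancestors t zero_leaf. qdfact (num_children u - 1))"
    using ancestors_zero[OF assms] by (intro prod.cong) (auto simp: vpoly_def)
  moreover have "(\<Prod>u\<in>parents t - ancestors t zero_leaf. vpoly TypeB u) =
      (\<Prod>u\<in>parents t - ancestors t zero_leaf. qfact (num_children u - 1))"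
    using ancestors_zero[OF assms] by (intro prod.cong) (auto simp: vpoly_def)
  ultimately show ?thesis unfolding pi_B_def by (simp add: mult.commute)
qed

lemma qdfact_nonzero: "qdfact n \<noteq> 0"
proof -
  have "poly (qdfact n) 0 = 1" by (simp add: qdfact_def poly_prod qnum_def)
  then show ?thesis by (metis poly_0 zero_neq_one)
qed

lemma leaf_parent_exists:
  "Leaf l \<in> vertices t \<Longrightarrow> t \<noteq> Leaf l \<Longrightarrow> \<exists>u\<in>parents t. Leaf l \<in># children u"
proof (induction t)
  case (Node ts)
  then obtain v where v: "v \<in># ts" "Leaf l \<in> vertices v" by auto
  show ?case
  proof (cases "v = Leaf l")
    case True
    then show ?thesis using v(1) by (intro bexI[of _ "Node ts"]) (auto simp: parents_def)
  next
    case False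
    then obtain u where "u \<in> parents v" "Leaf l \<in># children u" using Node.IH[OF v] by blast
    then show ?thesis using v(1) by (intro bexI[of _ u]) (auto simp: parents_def)
  qed
qed simp

lemma tree_count_label:
  assumes t: "tree N t" and l: "l \<in># leaf_labels t"
  shows "count (leaf_labels t) l = 1"
proof (rule ccontr)
  assume c: "count (leaf_labels t) l \<noteq> 1"
  obtain M where M: "leaf_labels t = add_mset l M" using l by (meson mset_add)
  then have "l \<in># M" using c by (intro count_inI) simp
  then obtain M' where "M = add_mset l M'" by (meson mset_add)
  then have "count (image_mset num (leaf_labels t)) (num l) \<ge> 2" using M by simp
  moreover have "count (mset_set N) (num l) \<le> 1" by (simp add: count_mset_set')
  ultimately show False using t by (simp add: tree_def)
qed

text \<open>All inner vertices branch, so every ancestor of the leaf 0 qualifies. The ancestors form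
  a chain, and none lies properly below \<open>u\<close>, because among the children of
  \<open>u\<close> only the leaf itself contains the label 0.\<close>

lemma first_branching_eq:
  assumes t: "tree N t" "zero_plain t" and u: "u \<in> parents t" "zero_leaf \<in># children u"
  shows "first_branching t zero_leaf = u"
proof -
  let ?A = "ancestors t zero_leaf"
  obtain us where us: "u = Node us" using u(2) by (cases u) auto
  have uv: "u \<in> vertices t" using u(1) by (simp add: parents_def)
  have zu: "zero_leaf \<in> vertices u" using u(2) vertices_self us by auto
  have uA: "u \<in> ?A" using uv zu us by (auto simp: ancestors_def descendants_def)
  have two: "2 \<le> num_children w" if "w \<in> ?A" for w
    using that t(1) ancestors_zero[OF t] by (auto simp: tree_def branching_def)
  have cnt: "count (leaf_labels t) (Label 0 False) = 1"
    using vertices_trans[OF uv zu] by (intro tree_count_label[OF t(1)]) (simp only: label_iff_vertex)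
  note tu = tree_vertex[OF t(1) uv]
  have low: "w = u" if w: "w \<in> ?A" "w \<in> vertices u" for w
  proof (rule ccontr)
    assume "w \<noteq> u"
    then obtain v where v: "v \<in># us" "w \<in> vertices v" using w(2) us by auto
    have zw: "zero_leaf \<in> vertices w" "w \<noteq> zero_leaf" using w(1)
      by (auto simp: ancestors_def descendants_def)
    then have "zero_leaf \<in> vertices v" using vertices_trans v(2) by blast
    then have "0 \<in> nums v" using nums_vertex[of zero_leaf v] by simp
    moreover have "0 \<in> nums zero_leaf" by simp
    ultimately have "v = zero_leaf"
      using tree_children(3)[of "nums u" us v zero_leaf] tu v(1) u(2) us by auto
    then show False using v(2) zw(2) by simp
  qed
  have cl: "w = u \<or> w \<in> ancestors t u" if w: "w \<in> ?A" for w
  proof -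
    have "u \<in> vertices w \<or> w \<in> vertices u"
      using vertices_chain[OF cnt uv, of w] w zu by (auto simp: ancestors_def descendants_def)
    then show ?thesis using low[OF w] w by (auto simp: ancestors_def descendants_def)
  qed
  show ?thesis
    unfolding first_branching_def
  proof (rule the_equality)
    show "u \<in> ?A \<and> 2 \<le> num_children u \<and> (\<forall>w\<in>?A. 2 \<le> num_children w \<longrightarrow> w = u \<or> w \<in> ancestors t u)"
      using uA two cl by blast
    fix x assume x: "x \<in> ?A \<and> 2 \<le> num_children x \<and> (\<forall>w\<in>?A. 2 \<le> num_children w \<longrightarrow> w =
        x \<or> w \<in> ancestors t x)"
    then have "u = x \<or> u \<in> ancestors t x" using uA two by blast
    moreover have "x = u \<or> x \<in> ancestors t u" using cl x by blast
    ultimately show "x = u" using ancestor_size[of u t x] ancestor_size[of x t u] by fastforce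
  qed
qed

text \<open>The denominator is the factor of \<open>pi_B\<close> at the parent of the leaf 0. It is
  a nonzero polynomial, so the division cancels this factor exactly.\<close>

lemma pi_D_eq:
  assumes t: "tree N t" "zero_plain t" "0 \<in> N" "2 \<le> card N"
  shows "pi_D t = (\<Prod>u\<in>parents t. vpoly TypeD u)"
proof -
  have "zero_leaf \<in> vertices t" using zero_mem_iff[OF t(2) vertices_self] tree_nums[OF t(1)] t(3) by simp
  moreover have "t \<noteq> zero_leaf"
  proof
    assume "t = zero_leaf"
    then have "N = {0}" using tree_nums[OF t(1)] by simp
    then show False using t(4) by simp
  qed
  ultimately have "\<exists>u\<in>parents t. zero_leaf \<in># children u" by (rule leaf_parent_exists)
  then obtain v where v: "v \<in> parents t" "zero_leaf \<in># children v" by (elim bexE)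
  have fb: "first_branching t zero_leaf = v" by (rule first_branching_eq[OF t(1,2) v])
  obtain vs where "v = Node vs" using v(2) by (cases v) auto
  then have "zero_leaf \<in> vertices v" using v(2) by (auto intro!: bexI[of _ zero_leaf])
  then have v0: "0 \<in> nums v" using zero_mem_iff[OF t(2)] v(1) by (simp add: parents_def)
  have other: "vpoly TypeB u = vpoly TypeD u" if "u \<in> parents t - {v}" for u
    using that first_branching_eq[OF t(1,2), of u] fb by (auto simp: vpoly_def Let_def)
  have "pi_B t = vpoly TypeB v * (\<Prod>u\<in>parents t - {v}. vpoly TypeB u)"
    unfolding pi_B_eq[OF t(1,2)] by (rule prod.remove[OF finite_parents v(1)])
  also have "\<dots> = qdfact (num_children v - 1) * (\<Prod>u\<in>parents t - {v}. vpoly TypeD u)"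
    using v0 other by (simp add: vpoly_def Let_def)
  finally have "pi_D t = (\<Prod>u\<in>parents t - {v}. vpoly TypeD u) *
      (qnum (2 * num_children v - num_unbranched v - 2) * qdfact (num_children v - 2))"
    unfolding pi_D_def Let_def fb using qdfact_nonzero by (simp add: mult.assoc)
  also have "\<dots> = vpoly TypeD v * (\<Prod>u\<in>parents t - {v}. vpoly TypeD u)"
    using v0 v(2) by (simp add: vpoly_def Let_def mult.commute)
  also have "\<dots> = (\<Prod>u\<in>parents t. vpoly TypeD u)" by (rule prod.remove[OF finite_parents v(1), symmetric])
  finally show ?thesis .
qed

text \<open>
  Standard form and the condition of type D in a form inherited by subtrees: in type D the condition
  excludes precisely the vertices with two leaves, one of them labelled 0.
\<close>

definition admissible :: "arr_type \<Rightarrow> blabel rtree \<Rightarrow> bool" where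
  "admissible X t \<longleftrightarrow> (\<forall>u\<in>vertices t. 0 \<in> nums u \<longrightarrow>
     (\<forall>v\<in>#children u. \<not> barred (min_label v)) \<and> (X = TypeD \<longrightarrow> card (nums u) \<noteq> 2))"

definition signed_trees :: "nat set \<Rightarrow> (nat \<Rightarrow> bool) \<Rightarrow> blabel rtree set" where
  "signed_trees C \<sigma> = {t. tree C t \<and> (\<forall>l\<in>#leaf_labels t. barred l = \<sigma> (num l))}"

text \<open>The condition at the root is the one that standard form imposes on a child of an
  ancestor of the leaf 0; with it the family is closed under passing to the children of such an
  ancestor. If \<open>C\<close> contains 0, it says that the label 0 carries no bar.\<close>

definition standard_trees :: "arr_type \<Rightarrow> nat set \<Rightarrow> blabel rtree set" where
  "standard_trees X C = {t. tree C t \<and> \<not> barred (min_label t) \<and> admissible X t}"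

lemma finite_signed_trees: "finite (signed_trees C \<sigma>)"
  by (rule finite_subset[OF _ finite_tree_set[of C]]) (auto simp: signed_trees_def)

lemma finite_standard_trees: "finite (standard_trees X C)"
  by (rule finite_subset[OF _ finite_tree_set[of C]]) (auto simp: standard_trees_def)

lemma partitions_split:
  assumes "finite C" "C \<noteq> {}"
  shows "{P. partition_on C P} = insert {C} {P. partition_on C P \<and> 2 \<le> card P}"
proof (intro equalityI subsetI)
  fix P assume "P \<in> {P. partition_on C P}"
  then have P: "partition_on C P" by simp
  have "P \<noteq> {}" using P assms(2) by (auto simp: partition_on_def)
  then have "card P \<noteq> 0" using finite_elements[OF assms(1) P] by simp
  then consider "2 \<le> card P" | "card P = 1" by linarith
  then show "P \<in> insert {C} {P. partition_on C P \<and> 2 \<le> card P}"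
  proof cases
    case 2
    then obtain D where "P = {D}" by (rule card_1_singletonE)
    then show ?thesis using P by (auto simp: partition_on_def)
  qed (use P in simp)
next
  fix P assume "P \<in> insert {C} {P. partition_on C P \<and> 2 \<le> card P}"
  then show "P \<in> {P. partition_on C P}" using partition_on_space[OF assms(2)] by (elim insertE) simp_all
qed

lemma partition_block_less:
  assumes "finite C" "partition_on C P" "2 \<le> card P" "D \<in> P"
  shows "card D < card C"
proof (rule psubset_card_mono[OF assms(1)])
  have "P \<noteq> {D}" using assms(3) by auto
  then obtain E where E: "E \<in> P" "E \<noteq> D" using assms(4) by blast
  then have "E \<inter> D = {}" "E \<noteq> {}" "E \<subseteq> C" "D \<subseteq> C"
    using assms(2,4) by (auto simp: partition_on_def disjoint_def)
  then show "D \<subset> C" by blast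
qed

lemma gp_cancel: "w \<noteq> 1 \<Longrightarrow> gp w * ((1 - w) * z) = w * (z :: complex)"
  by (simp add: gp_def)

lemma vweight_signed_trees:
  assumes "t \<in> signed_trees C \<sigma>" "0 \<notin> C"
  shows "vweight X Z T t = Z ^ (card C - 1) * (\<Prod>L\<in>signed_forms C \<sigma>. T L)"
proof -
  have t: "tree C t" "\<And>l. l \<in># leaf_labels t \<Longrightarrow> barred l = \<sigma> (num l)" using assms(1)
    by (auto simp: signed_trees_def)
  have "sgn_of t i = \<sigma> i" if "i \<in> C" for i
  proof -
    have "Label i (sgn_of t i) \<in># leaf_labels t" using label_mem_iff[OF t(1)] tree_nums[OF t(1)] that
      by blast
    then show ?thesis using t(2) by fastforce
  qed
  then have "signed_forms C (sgn_of t) = signed_forms C \<sigma>" by (intro signed_forms_cong) simp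
  then show ?thesis using tree_nums[OF t(1)] assms(2) by (simp add: vweight_def vforms_def)
qed

lemma num_children_eq: "tree N (Node ts) \<Longrightarrow> num_children (Node ts) = card (nums ` set_mset ts)"
  using tree_partition(3) by (simp add: num_children_def)

lemma signed_trees_Node:
  assumes "2 \<le> card C"
  shows "t \<in> signed_trees C \<sigma> \<longleftrightarrow>
      (\<exists>ts. t = Node ts \<and> tree C (Node ts) \<and> (\<forall>v\<in>#ts. v \<in> signed_trees (nums v) \<sigma>))"
proof
  assume t: "t \<in> signed_trees C \<sigma>"
  then have tr: "tree C t" by (simp add: signed_trees_def)
  then obtain ts where ts: "t = Node ts" using tree_not_Leaf assms by blast
  have "v \<in> signed_trees (nums v) \<sigma>" if "v \<in># ts" for v
    using t tree_children(1)[of C ts v] that unfolding ts signed_trees_def by auto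
  then show "\<exists>ts. t = Node ts \<and> tree C (Node ts) \<and> (\<forall>v\<in>#ts. v \<in> signed_trees (nums v) \<sigma>)"
    using tr ts by blast
qed (auto simp: signed_trees_def)

context haar_zeta
begin

definition subtree_term :: "arr_type \<Rightarrow> blabel rtree \<Rightarrow> complex" where
  "subtree_term X t = (\<Prod>u\<in>parents t. eval_poly (vpoly X u) (- inverse (of_nat q)) *
      gp (vweight X (inverse (of_nat q)) form_weight u))"

text \<open>The summand of the theorem, in which the root has a polynomial but no geometric
  progression. In \<open>subtree_term\<close> the root has both, since it is to become an inner
  vertex of a larger tree.\<close>

definition tree_term :: "arr_type \<Rightarrow> blabel rtree \<Rightarrow> complex" where
  "tree_term X t = (\<Prod>u\<in>parents t. eval_poly (vpoly X u) (- inverse (of_nat q))) *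
     (\<Prod>u\<in>parents t - {t}. gp (vweight X (inverse (of_nat q)) form_weight u))"

lemma subtree_term_Leaf [simp]: "subtree_term X (Leaf l) = 1"
  by (simp add: subtree_term_def)

lemma tree_term_Node:
  assumes "tree N (Node ts)"
  shows "tree_term X (Node ts) = eval_poly (vpoly X (Node ts)) (- inverse (of_nat q)) *
      (\<Prod>v\<in>set_mset ts. subtree_term X v)"
  unfolding tree_term_def subtree_term_def prod_parents[OF assms] by (simp add: prod.distrib)

lemma subtree_term_Node:
  assumes "tree N (Node ts)"
  shows "subtree_term X (Node ts) = gp (vweight X (inverse (of_nat q)) form_weight (Node ts)) *
      tree_term X (Node ts)"
  unfolding tree_term_Node[OF assms] unfolding subtree_term_def prod_parents(2)[OF assms] by simp

lemma norm_form_weight: "norm (form_weight L) \<le> 1"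
proof -
  have "norm (form_weight L) = exp (- Re (s L) * ln (real q))"
    using q_pos by (simp add: form_weight_def powr_def Ln_of_nat)
  also have "\<dots> \<le> exp 0"
    using q_ge_2 Re_s by (subst exp_le_cancel_iff) simp
  finally show ?thesis by simp
qed

text \<open>The weights of the forms have norm at most 1 and \<open>q\<close> is at least 2, so the
  product has norm less than 1. Hence no denominator of a geometric progression vanishes.\<close>

lemma weight_ne_1:
  assumes "1 \<le> k"
  shows "inverse (of_nat q) ^ k * (\<Prod>L\<in>F. form_weight L) \<noteq> 1"
proof -
  have "(\<Prod>L\<in>F. norm (form_weight L)) \<le> (\<Prod>L\<in>F. 1)"
    using norm_form_weight by (intro prod_mono) auto
  then have "norm (\<Prod>L\<in>F. form_weight L) \<le> 1" by (simp add: prod_norm)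
  moreover have "inverse (real q) ^ k < 1"
    using q_ge_2 assms by (intro power_less_one_iff[THEN iffD2]) (auto simp: field_simps)
  ultimately have "inverse (real q) ^ k * norm (\<Prod>L\<in>F. form_weight L) < 1"
    by (meson le_less_trans mult_left_le norm_ge_zero zero_le_power inverse_nonnegative_iff_nonnegative
        of_nat_0_le_iff)
  then have "norm (inverse (of_nat q) ^ k * (\<Prod>L\<in>F. form_weight L)) < 1"
    by (simp add: norm_mult norm_power norm_inverse)
  then show ?thesis by auto
qed

text \<open>The factor \<open>q\<close> cancels one of the factors \<open>1 / q\<close> belonging to
  the coordinates. This produces the exponent, one less than the size of the block, in the geometric
  progressions.\<close>

lemma block_zeta_signed_forms:
  assumes "finite C" "C \<noteq> {}"
  shows "of_nat q * block_zeta C (signed_forms C \<sigma>) =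
      inverse (of_nat q) ^ (card C - 1) * (\<Prod>L\<in>signed_forms C \<sigma>. form_weight L) *
      zeta_int C (signed_forms C \<sigma>)"
proof -
  obtain c where "card C = Suc c" using assms by (metis card_eq_0_iff not0_implies_Suc)
  then show ?thesis unfolding block_zeta_def using q_pos by simp
qed

text \<open>Both claims are proved together by induction on the number of labels. Removing the root
  turns the sum of \<open>tree_term\<close> into a sum over partitions with at least two blocks, to
  which the first claim applies. In the recursion of the zeta integral these are all summands but
  one, and the missing one is the root weight \<open>w\<close> times the integral. The geometric
  progression at the root then turns \<open>1 - w\<close> into \<open>w\<close>, which is the first
  claim for \<open>C\<close>.\<close>

lemma sum_signed_trees:
  assumes "finite C" "C \<noteq> {}" "0 \<notin> C"
  shows "(\<Sum>t\<in>signed_trees C \<sigma>. subtree_term X t) = of_nat q * block_zeta C (signed_forms C \<sigma>)"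
    and "2 \<le> card C \<Longrightarrow> (\<Sum>t\<in>signed_trees C \<sigma>. tree_term X t) =
      (1 - inverse (of_nat q) ^ (card C - 1) * (\<Prod>L\<in>signed_forms C \<sigma>. form_weight L)) *
          zeta_int C (signed_forms C \<sigma>)"
proof -
  have "(\<Sum>t\<in>signed_trees C \<sigma>. subtree_term X t) = of_nat q * block_zeta C (signed_forms C \<sigma>) \<and>
      (2 \<le> card C \<longrightarrow> (\<Sum>t\<in>signed_trees C \<sigma>. tree_term X t) =
      (1 - inverse (of_nat q) ^ (card C - 1) * (\<Prod>L\<in>signed_forms C \<sigma>. form_weight L)) *
          zeta_int C (signed_forms C \<sigma>))"
    using assms
  proof (induction C rule: measure_induct_rule[where f = card])
    case (less C)
    let ?Y = "- inverse (of_nat q) :: complex"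
    let ?w = "inverse (of_nat q) ^ (card C - 1) * (\<Prod>L\<in>signed_forms C \<sigma>. form_weight L)"
    show ?case
    proof (cases "2 \<le> card C")
      case False
      then have "card C = 1" using less.prems
        by (metis Suc_1 card_eq_0_iff not_less_eq_eq le_antisym One_nat_def le_0_eq not0_implies_Suc
            Suc_leI gr0I)
      then obtain k where k: "C = {k}" by (rule card_1_singletonE)
      have "signed_trees C \<sigma> = {Leaf (Label k (\<sigma> k))}"
      proof (intro equalityI subsetI)
        fix t assume t: "t \<in> signed_trees C \<sigma>"
        then obtain b where "t = Leaf (Label k b)" using tree_singleton k
          by (auto simp: signed_trees_def)
        then show "t \<in> {Leaf (Label k (\<sigma> k))}" using t by (simp add: signed_trees_def)
      qed (simp add: signed_trees_def k tree_Leaf_iff)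
      moreover have "of_nat q * block_zeta C (signed_forms C \<sigma>) = 1"
        using block_zeta_signed_forms[OF less.prems(1,2)]
        by (simp add: k signed_forms_singleton zeta_int_no_forms)
      ultimately show ?thesis using False by simp
    next
      case True
      have "(\<Sum>t\<in>signed_trees C \<sigma>. tree_term X t) = (\<Sum>P\<in>{P. partition_on C P \<and> 2 \<le> card P}.
          eval_poly (qfact (card P - 1)) ?Y * (\<Prod>D\<in>P. \<Sum>v\<in>signed_trees D \<sigma>. subtree_term X v))"
      proof (rule sum_trees[OF less.prems(1), where T = "\<lambda>D. signed_trees D \<sigma>"])
        show "tree D t" if "t \<in> signed_trees D \<sigma>" for D t using that by (simp add: signed_trees_def)
        show "finite (signed_trees D \<sigma>)" for D by (rule finite_signed_trees)
        show "t \<in> signed_trees C \<sigma> \<longleftrightarrow>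
            (\<exists>ts. t = Node ts \<and> tree C (Node ts) \<and> (\<forall>v\<in>#ts. v \<in> signed_trees (nums v) \<sigma>))" for t
          by (rule signed_trees_Node[OF True])
        fix ts assume "Node ts \<in> signed_trees C \<sigma>"
        then have ts: "tree C (Node ts)" by (simp add: signed_trees_def)
        have "vpoly X (Node ts) = qfact (card (nums ` set_mset ts) - 1)"
          using tree_nums[OF ts] less.prems(3) num_children_eq[OF ts] by (simp add: vpoly_def)
        then show "tree_term X (Node ts) =
            eval_poly (qfact (card (nums ` set_mset ts) - 1)) ?Y * (\<Prod>v\<in>set_mset ts. subtree_term X v)"
          using tree_term_Node[OF ts] by simp
      qed
      also have "\<dots> = (\<Sum>P\<in>{P. partition_on C P \<and> 2 \<le> card P}.
          eval_poly (qfact (card P - 1)) ?Y * (\<Prod>D\<in>P. of_nat q * block_zeta D (signed_forms D \<sigma>)))"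
      proof (intro sum.cong[OF refl] arg_cong2[where f = "(*)", OF refl] prod.cong[OF refl])
        fix P D assume P: "P \<in> {P. partition_on C P \<and> 2 \<le> card P}" and D: "D \<in> P"
        then have "D \<noteq> {}" "finite D" "0 \<notin> D"
          using finite_partition_element[OF less.prems(1)] less.prems(3) by (auto simp: partition_on_def)
        then show "(\<Sum>v\<in>signed_trees D \<sigma>. subtree_term X v) = of_nat q * block_zeta D (signed_forms D \<sigma>)"
          using less.IH[of D] partition_block_less[OF less.prems(1)] P D by blast
      qed
      \<comment> \<open>The partition with the single block \<open>C\<close> has the polynomial 1
        and accounts for the subtracted term.\<close>
      also have "\<dots> = zeta_int C (signed_forms C \<sigma>) - of_nat q * block_zeta C (signed_forms C \<sigma>)"
      proof -
        have "zeta_int C (signed_forms C \<sigma>) =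
            eval_poly (qfact (card {C} - 1)) ?Y * (\<Prod>D\<in>{C}. of_nat q * block_zeta D (signed_forms D \<sigma>)) +
          (\<Sum>P\<in>{P. partition_on C P \<and> 2 \<le> card P}. eval_poly (qfact (card P - 1)) ?Y *
              (\<Prod>D\<in>P. of_nat q * block_zeta D (signed_forms D \<sigma>)))"
          unfolding zeta_int_A[OF less.prems(1,2)] partitions_split[OF less.prems(1,2)]
          using finite_partitions[OF less.prems(1)]
          by (intro sum.insert) (auto intro: finite_subset[rotated])
        then show ?thesis by (simp add: eval_poly_qfact)
      qed
      also have "\<dots> = (1 - ?w) * zeta_int C (signed_forms C \<sigma>)"
        unfolding block_zeta_signed_forms[OF less.prems(1,2)] by (simp add: algebra_simps)
      finally have F: "(\<Sum>t\<in>signed_trees C \<sigma>. tree_term X t) = (1 - ?w) * zeta_int C (signed_forms C \<sigma>)" .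
      have "(\<Sum>t\<in>signed_trees C \<sigma>. subtree_term X t) = (\<Sum>t\<in>signed_trees C \<sigma>. gp ?w * tree_term X t)"
      proof (rule sum.cong[OF refl])
        fix t assume t: "t \<in> signed_trees C \<sigma>"
        then obtain ts where "t = Node ts" "tree C (Node ts)" using signed_trees_Node[OF True] by blast
        then show "subtree_term X t = gp ?w * tree_term X t"
          using subtree_term_Node vweight_signed_trees[OF t less.prems(3)] by simp
      qed
      also have "\<dots> = gp ?w * ((1 - ?w) * zeta_int C (signed_forms C \<sigma>))"
        unfolding sum_distrib_left[symmetric] F ..
      also have "\<dots> = ?w * zeta_int C (signed_forms C \<sigma>)" using True by (intro gp_cancel weight_ne_1) simp
      finally show ?thesis using F block_zeta_signed_forms[OF less.prems(1,2)] by simp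
    qed
  qed
  then show "(\<Sum>t\<in>signed_trees C \<sigma>. subtree_term X t) = of_nat q * block_zeta C (signed_forms C \<sigma>)"
    "2 \<le> card C \<Longrightarrow> (\<Sum>t\<in>signed_trees C \<sigma>. tree_term X t) =
      (1 - inverse (of_nat q) ^ (card C - 1) * (\<Prod>L\<in>signed_forms C \<sigma>. form_weight L)) *
          zeta_int C (signed_forms C \<sigma>)" by blast+
qed

text \<open>Without the label 0 admissibility is void, and the only condition concerns the bar of
  the least label. The trees are sorted by their bars, and each sign pattern is a type A
  situation.\<close>

lemma sum_standard_trees_nonzero:
  assumes C: "finite C" "C \<noteq> {}" "0 \<notin> C"
  shows "(\<Sum>t\<in>standard_trees X C. subtree_term X t) = weight_B X C"
proof -
  have fin: "finite (normal_signs C)"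
    using C(1) by (auto simp: normal_signs_def intro!: finite_subset[OF Collect_subset] finite_PiE)
  have "standard_trees X C = (\<Union>\<sigma>\<in>normal_signs C. signed_trees C \<sigma>)"
  proof (intro equalityI subsetI)
    fix t assume t: "t \<in> standard_trees X C"
    then have tr: "tree C t" by (simp add: standard_trees_def)
    let ?\<sigma> = "restrict (sgn_of t) C"
    have "\<not> sgn_of t (Min C)" using t min_label[OF tr] tree_nums[OF tr] by (simp add: standard_trees_def)
    then have "?\<sigma> \<in> normal_signs C" using C Min_in[OF C(1,2)] by (simp add: normal_signs_def)
    moreover have "t \<in> signed_trees C ?\<sigma>"
      using barred_sgn_of[OF tr] tr tree_nums[OF tr] by (auto simp: signed_trees_def nums_def)
    ultimately show "t \<in> (\<Union>\<sigma>\<in>normal_signs C. signed_trees C \<sigma>)" by blast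
  next
    fix t assume "t \<in> (\<Union>\<sigma>\<in>normal_signs C. signed_trees C \<sigma>)"
    then obtain \<sigma> where \<sigma>: "\<sigma> \<in> normal_signs C" "t \<in> signed_trees C \<sigma>" by blast
    then have tr: "tree C t" by (simp add: signed_trees_def)
    have "min_label t \<in># leaf_labels t"
      using min_label[OF tr] label_mem_iff[OF tr] tree_nums[OF tr] Min_in[OF C(1,2)] by simp
    then have "barred (min_label t) = \<sigma> (Min C)"
      using \<sigma>(2) min_label[OF tr] tree_nums[OF tr] by (fastforce simp: signed_trees_def)
    then have "\<not> barred (min_label t)" using \<sigma>(1) by (simp add: normal_signs_def)
    moreover have "0 \<notin> nums u" if "u \<in> vertices t" for u
      using nums_vertex[OF that] tree_nums[OF tr] C(3) by blast
    ultimately show "t \<in> standard_trees X C" using tr by (simp add: standard_trees_def admissible_def)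
  qed
  moreover have "signed_trees C \<sigma> \<inter> signed_trees C \<tau> = {}"
      if st: "\<sigma> \<in> normal_signs C" "\<tau> \<in> normal_signs C" "\<sigma> \<noteq> \<tau>" for \<sigma> \<tau>
  proof (rule ccontr)
    assume "signed_trees C \<sigma> \<inter> signed_trees C \<tau> \<noteq> {}"
    then obtain t where t: "t \<in> signed_trees C \<sigma>" "t \<in> signed_trees C \<tau>" by blast
    then have tr: "tree C t" by (simp add: signed_trees_def)
    have "\<sigma> i = \<tau> i" if "i \<in> C" for i
    proof -
      have "i \<in> nums t" using tree_nums[OF tr] that by simp
      then obtain l where "l \<in># leaf_labels t" "num l = i" by (auto simp: nums_def)
      then show ?thesis using t by (auto simp: signed_trees_def)
    qed
    moreover have "\<sigma> i = \<tau> i" if "i \<notin> C" for i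
      using st(1,2) that by (auto simp: normal_signs_def PiE_iff extensional_def)
    ultimately show False using st(3) by blast
  qed
  ultimately have "(\<Sum>t\<in>standard_trees X C. subtree_term X t) =
      (\<Sum>\<sigma>\<in>normal_signs C. \<Sum>t\<in>signed_trees C \<sigma>. subtree_term X t)"
    using fin finite_signed_trees by (simp add: sum.UNION_disjoint)
  then show ?thesis using sum_signed_trees(1)[OF C] C(3) by (simp add: weight_B_def)
qed

end

section \<open>The root of a standard tree\<close>

lemma unbranched_iff:
  assumes "tree N v"
  shows "unbranched v \<longleftrightarrow> card (nums v) = 1"
proof (cases v)
  case (Leaf l)
  then show ?thesis by (simp add: unbranched_def)
next
  case (Node ts)
  have "{w \<in> descendants v. is_Leaf w} = Leaf ` set_mset (leaf_labels v)"
  proof (intro equalityI subsetI)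
    fix w assume w: "w \<in> {w \<in> descendants v. is_Leaf w}"
    then obtain l where l: "w = Leaf l" by (cases w) auto
    then have "l \<in># leaf_labels v" using w by (simp add: label_iff_vertex descendants_def)
    then show "w \<in> Leaf ` set_mset (leaf_labels v)" using l by blast
  next
    fix w assume "w \<in> Leaf ` set_mset (leaf_labels v)"
    then obtain l where l: "w = Leaf l" "l \<in># leaf_labels v" by blast
    then have "w \<in> vertices v" by (simp only: label_iff_vertex)
    then show "w \<in> {w \<in> descendants v. is_Leaf w}" using l(1) Node by (simp add: descendants_def)
  qed
  then have "card {w \<in> descendants v. is_Leaf w} = card (set_mset (leaf_labels v))"
    by (simp add: card_image inj_on_def)
  also have "\<dots> = card (nums v)"
    unfolding nums_def using tree_inj_num[OF assms] by (intro card_image[symmetric] inj_onI)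
  finally show ?thesis using Node by (simp add: unbranched_def)
qed

text \<open>The polynomial at the root expressed by the label sets of its children: the block
  \<open>{0}\<close> stands for the leaf 0 as a child, and blocks of size 1 are the unbranched
  children.\<close>

definition root_poly :: "arr_type \<Rightarrow> nat set set \<Rightarrow> int poly" where
  "root_poly X P = (if X = TypeD \<and> {0} \<in> P
     then qnum (2 * card P - card {D \<in> P. card D = 1} - 2) * qdfact (card P - 2)
         else qdfact (card P - 1))"

lemma vpoly_root_poly:
  assumes t: "tree C (Node ts)" "0 \<in> C" and plain: "\<And>v. v \<in># ts \<Longrightarrow> \<not> barred (min_label v)"
  shows "vpoly X (Node ts) = root_poly X (nums ` set_mset ts)"
proof -
  let ?P = "nums ` set_mset ts"
  note ch = tree_children[OF t(1)]
  have zero: "zero_leaf \<in># ts \<longleftrightarrow> {0} \<in> ?P"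
  proof
    assume "zero_leaf \<in># ts"
    then show "{0} \<in> ?P" by (intro image_eqI[of _ _ zero_leaf]) auto
  next
    assume "{0} \<in> ?P"
    then obtain v where v: "v \<in># ts" "nums v = {0}" by auto
    have tr: "tree {0} v" using ch(1)[OF v(1)] v(2) by simp
    obtain b where b: "v = Leaf (Label 0 b)" using tree_singleton[OF tr] .
    have "\<not> sgn_of v 0" using plain[OF v(1)] min_label[OF tr] v(2) by simp
    then have "\<not> b" using b by (simp add: sgn_of_def)
    then show "zero_leaf \<in># ts" using v(1) b by simp
  qed
  have "num_unbranched (Node ts) = card {v \<in> set_mset ts. unbranched v}"
  proof -
    have "filter_mset unbranched ts = mset_set {v \<in> set_mset ts. unbranched v}"
      by (subst ch(2)) (simp add: filter_mset_mset_set)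
    then show ?thesis by (simp add: num_unbranched_def)
  qed
  also have "{v \<in> set_mset ts. unbranched v} = {v \<in> set_mset ts. card (nums v) = 1}"
    using unbranched_iff[OF ch(1)] by blast
  also have "card \<dots> = card (nums ` {v \<in> set_mset ts. card (nums v) = 1})"
    using tree_partition(2)[OF t(1)] by (intro card_image[symmetric]) (auto intro: inj_on_subset)
  also have "nums ` {v \<in> set_mset ts. card (nums v) = 1} = {D \<in> ?P. card D = 1}" by blast
  finally have "num_unbranched (Node ts) = card {D \<in> ?P. card D = 1}" .
  then show ?thesis
    using num_children_eq[OF t(1)] tree_nums[OF t(1)] t(2) zero
    by (simp add: vpoly_def root_poly_def Let_def)
qed

text \<open>The root adds no condition to those on its children: its minimal label is 0, which
  already occurs in a child, and having exactly two labels is excluded in type D by the hypothesis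
  on \<open>C\<close>.\<close>

lemma standard_trees_Node:
  assumes C: "0 \<in> C" "2 \<le> card C" "X = TypeD \<Longrightarrow> card C \<noteq> 2"
  shows "t \<in> standard_trees X C \<longleftrightarrow>
      (\<exists>ts. t = Node ts \<and> tree C (Node ts) \<and> (\<forall>v\<in>#ts. v \<in> standard_trees X (nums v)))"
proof
  assume t: "t \<in> standard_trees X C"
  then have tr: "tree C t" and g: "admissible X t" by (simp_all add: standard_trees_def)
  then obtain ts where ts: "t = Node ts" using tree_not_Leaf C(2) by blast
  have "v \<in> standard_trees X (nums v)" if v: "v \<in># ts" for v
  proof -
    have "0 \<in> nums t" using tree_nums[OF tr] C(1) by simp
    then have "\<not> barred (min_label v)" using g v vertices_self[of t] unfolding admissible_def ts
      by fastforce
    moreover have "vertices v \<subseteq> vertices t" using v ts by auto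
    then have "admissible X v" using g unfolding admissible_def by blast
    ultimately show ?thesis using tree_children(1)[of C ts v] tr ts v by (simp add: standard_trees_def)
  qed
  then show "\<exists>ts. t = Node ts \<and> tree C (Node ts) \<and> (\<forall>v\<in>#ts. v \<in> standard_trees X (nums v))"
    using tr ts by blast
next
  assume "\<exists>ts. t = Node ts \<and> tree C (Node ts) \<and> (\<forall>v\<in>#ts. v \<in> standard_trees X (nums v))"
  then obtain ts where ts: "t = Node ts" "tree C (Node ts)"
      and v: "\<And>v. v \<in># ts \<Longrightarrow> v \<in> standard_trees X (nums v)" by blast
  have nt: "nums t = C" using tree_nums[OF ts(2)] ts(1) by simp
  have fin: "finite C" using ts(2) by (simp add: tree_def)
  have Min0: "Min D = 0" if "0 \<in> D" "finite D" for D :: "nat set"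
    using that by (metis Min_le bot_nat_0.extremum_unique)
  obtain v0 where v0: "v0 \<in># ts" "0 \<in> nums v0" using nt C(1) ts(1) by (auto simp: nums_Node)
  have t0: "tree (nums v0) v0" "\<not> barred (min_label v0)" using v[OF v0(1)]
    by (simp_all add: standard_trees_def)
  have "\<not> sgn_of v0 0" using min_label[OF t0(1)] t0(2) Min0[OF v0(2) finite_nums] by simp
  moreover have "v0 \<in> vertices t" using v0(1) ts(1) vertices_self by auto
  ultimately have "\<not> sgn_of t 0" using sgn_of_vertex[OF _ _ t0(1) v0(2)] ts by metis
  then have "\<not> barred (min_label t)" using min_label[of C t] ts nt Min0[OF C(1) fin] by simp
  moreover have "admissible X t"
    unfolding admissible_def
  proof (intro ballI impI)
    fix u assume u: "u \<in> vertices t" "0 \<in> nums u"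
    show "(\<forall>v\<in>#children u. \<not> barred (min_label v)) \<and> (X = TypeD \<longrightarrow> card (nums u) \<noteq> 2)"
    proof (cases "u = t")
      case True
      then show ?thesis using v nt C(3) ts(1) by (auto simp: standard_trees_def)
    next
      case False
      then obtain w where "w \<in># ts" "u \<in> vertices w" using u(1) ts(1) by auto
      then show ?thesis using v u(2) unfolding standard_trees_def admissible_def by blast
    qed
  qed
  ultimately show "t \<in> standard_trees X C" using ts by (simp add: standard_trees_def)
qed

section \<open>Redistribution of classes in type D\<close>

context haar_zeta
begin

lemma weight_B_zero_singleton: "weight_B X {0} = 1"
proof -
  have "zero_forms X {0} = {}" by (simp add: zero_forms_def)
  then show ?thesis by (simp add: weight_B_def)
qed

lemma weight_B_singleton:
  assumes "k \<noteq> 0"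
  shows "weight_B X {k} = 1"
proof -
  have "normal_signs {k} = {\<lambda>i\<in>{k}. False}"
    unfolding normal_signs_def by (auto simp: fun_eq_iff PiE_iff extensional_def)
  moreover have "of_nat q * block_zeta {k} (signed_forms {k} \<sigma>) = 1" for \<sigma>
    using block_zeta_signed_forms[of "{k}" \<sigma>] by (simp add: signed_forms_singleton zeta_int_no_forms)
  ultimately show ?thesis using assms by (simp add: weight_B_def)
qed

text \<open>No form of type D lives on this class, so only the measure \<open>1 / q\<close> of the
  condition that the coordinate \<open>k\<close> has digit 0 remains.\<close>

lemma weight_D_pair:
  assumes "k \<noteq> 0"
  shows "weight_B TypeD {0, k} = inverse (of_nat q)"
proof -
  have "zero_forms TypeD {0, k} = {}" by (auto simp: zero_forms_def)
  moreover have "{0, k} - {0} = {k}" using assms by auto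
  ultimately show ?thesis by (simp add: weight_B_def block_zeta_def zeta_int_no_forms)
qed

text \<open>For \<open>c\<close> classes, \<open>u\<close> of them singletons,
  \<open>((2c-u-2)) = ((2c-3)) - (u-1) Y\<close> and \<open>((c-1))!! = ((c-2))!! ((2c-3))\<close>.
  At \<open>Y = - 1 / q\<close> the type D polynomial thus exceeds that of type B by
  \<open>(u-1) / q\<close> times \<open>((c-2))!!\<close>.\<close>

lemma root_poly_D_diff:
  assumes P: "finite P" "2 \<le> card P" "{0} \<in> P"
  shows "eval_poly (root_poly TypeD P) (- inverse (of_nat q) :: complex) =
    eval_poly (qdfact (card P - 1)) (- inverse (of_nat q)) +
    of_nat (card {D \<in> P. card D = 1} - 1) * (eval_poly (qdfact (card P - 2)) (- inverse (of_nat q)) *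
        inverse (of_nat q))"
proof -
  obtain c where c: "card P = Suc (Suc c)" using P(2) by (metis add_2_eq_Suc le_Suc_ex)
  let ?u = "card {D \<in> P. card D = 1}"
  have "{0} \<in> {D \<in> P. card D = 1}" using P(3) by simp
  then have "{D \<in> P. card D = 1} \<noteq> {}" by blast
  then have u: "1 \<le> ?u" using P(1) by (simp add: Suc_le_eq card_gt_0_iff)
  have "?u \<le> card P" using P(1) by (intro card_mono) auto
  obtain w where w1: "?u = Suc w" using u by (metis One_nat_def Suc_le_D)
  \<comment> \<open>Here \<open>c\<close> is two less than the number of classes,
    \<open>Suc w\<close> is the number of singletons and \<open>d\<close> the index in
    \<open>root_poly\<close>. The relation \<open>d + w = 2 * c + 1\<close> replaces truncated
    subtraction.\<close>
  define d where "d = 2 * c + 2 - Suc w"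
  have "Suc w \<le> 2 * c + 2" using \<open>?u \<le> card P\<close> unfolding w1 c by simp
  then have w: "?u = Suc w" "2 * c + 2 - ?u = d" "2 * c + 2 = d + Suc w"
    using w1 by (simp_all add: d_def)
  have h: "root_poly TypeD P = qnum d * qdfact c"
    using P(3) c w by (simp add: root_poly_def)
  have "qdfact (Suc c) = qdfact c * qnum (2 * c + 1)" by (simp add: qdfact_def)
  then have h': "qdfact (card P - 1) = qdfact c * qnum (d + w)" using c w(3) by simp
  show ?thesis unfolding h h' w(1) using c by (simp add: eval_poly_mult eval_poly_qnum algebra_simps)
qed

text \<open>
  A zero block \<open>{0, k}\<close> carries no form of type D. Splitting it into \<open>{0}\<close> and \<open>{k}\<close> accounts for
  the correction factor of the type D polynomials.
\<close>

lemma sum_partitions_D: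
  assumes N: "finite N" "0 \<in> N" "3 \<le> card N"
  shows "(\<Sum>P\<in>{P. partition_on N P \<and> 2 \<le> card P}. eval_poly (root_poly TypeD P) (- inverse (of_nat q)) *
      (\<Prod>D\<in>P. if 0 \<in> D \<and> card D = 2 then 0 else weight_B TypeD D)) =
    (\<Sum>P\<in>{P. partition_on N P \<and> 2 \<le> card P}. eval_poly (qdfact (card P - 1)) (- inverse (of_nat q)) *
      (\<Prod>D\<in>P. weight_B TypeD D))"
proof -
  let ?Y = "- inverse (of_nat q) :: complex"
  let ?W = "\<lambda>P. \<Prod>D\<in>P. weight_B TypeD D"
  let ?PP = "{P. partition_on N P \<and> 2 \<le> card P}"
  \<comment> \<open>Partitions in which 0 is alone, and those in which it has exactly one companion;
    every other partition contributes the same to both sides.\<close>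
  define B0 where "B0 = {P \<in> ?PP. {0} \<in> P}"
  define B1 where "B1 = {P \<in> ?PP. \<exists>k. k \<noteq> 0 \<and> {0, k} \<in> P}"
  have finPP: "finite ?PP" using finite_partitions[OF N(1)] by (rule finite_subset[rotated]) auto
  have fin: "finite B0" "finite B1"
    unfolding B0_def B1_def using finPP by (auto intro: finite_subset[rotated])
  have finP: "finite P" if "partition_on N P" for P using finite_elements[OF N(1) that] .
  have uniq: "D = E" if "partition_on N P" "D \<in> P" "E \<in> P" "i \<in> D" "i \<in> E" for P D E i
    using part_of_eq[OF that(1,2,4)] part_of_eq[OF that(1,3,5)] by simp
  have disj: "B0 \<inter> B1 = {}"
  proof (rule ccontr)
    assume "B0 \<inter> B1 \<noteq> {}"
    then obtain P k where "partition_on N P" "{0} \<in> P" "k \<noteq> 0" "{0, k} \<in> P" by (auto simp: B0_def B1_def)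
    then have "{0} = {0, k}" using uniq[of P "{0}" "{0, k}" 0] by blast
    then show False using \<open>k \<noteq> 0\<close> by auto
  qed
  have decomp: "?PP = (?PP - B0 - B1) \<union> B0 \<union> B1" by (auto simp: B0_def B1_def)
  have split: "(\<Sum>P\<in>?PP. f P) = (\<Sum>P\<in>?PP - B0 - B1. f P) + (\<Sum>P\<in>B0. f P) + (\<Sum>P\<in>B1. f P)"
    for f :: "nat set set \<Rightarrow> complex"
  proof -
    have "(\<Sum>P\<in>?PP. f P) = (\<Sum>P\<in>(?PP - B0 - B1) \<union> B0. f P) + (\<Sum>P\<in>B1. f P)"
      by (subst decomp, rule sum.union_disjoint) (use finPP fin disj in auto)
    also have "(\<Sum>P\<in>(?PP - B0 - B1) \<union> B0. f P) = (\<Sum>P\<in>?PP - B0 - B1. f P) + (\<Sum>P\<in>B0. f P)"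
      by (rule sum.union_disjoint) (use finPP fin in auto)
    finally show ?thesis .
  qed
  have zero_pair: "\<exists>k. k \<noteq> 0 \<and> D = {0, k}" if "0 \<in> D" "card D = 2" for D :: "nat set"
  proof -
    obtain x y where D: "D = {x, y}" "x \<noteq> y" using \<open>card D = 2\<close> by (auto simp: card_2_iff)
    show ?thesis
    proof (cases "x = 0")
      case True
      then show ?thesis using D by (intro exI[of _ y]) auto
    next
      case False
      then show ?thesis using D \<open>0 \<in> D\<close> by (intro exI[of _ x]) auto
    qed
  qed
  have prod_eq: "(\<Prod>D\<in>P. if 0 \<in> D \<and> card D = 2 then 0 else weight_B TypeD D) =
      (if P \<in> B1 then 0 else ?W P)"
    if P: "P \<in> ?PP" for P
  proof (cases "P \<in> B1")
    case True
    then obtain k where k: "k \<noteq> 0" "{0, k} \<in> P" by (auto simp: B1_def)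
    then have "0 \<in> {0, k} \<and> card {0, k} = 2" by simp
    then have "\<exists>D\<in>P. (if 0 \<in> D \<and> card D = 2 then 0 else weight_B TypeD D) = 0" using k(2)
      by (metis (full_types))
    then have "(\<Prod>D\<in>P. if 0 \<in> D \<and> card D = 2 then 0 else weight_B TypeD D) = 0"
      using finP P by (intro prod_zero) auto
    then show ?thesis using True by simp
  next
    case False
    then have "\<nexists>k. k \<noteq> 0 \<and> {0, k} \<in> P" using P unfolding B1_def by blast
    then have "\<not> (0 \<in> D \<and> card D = 2)" if "D \<in> P" for D using that zero_pair[of D] by metis
    then show ?thesis using False by (auto intro!: prod.cong)
  qed
  \<comment> \<open>A companion \<open>k\<close> and a partition of the remaining labels. Adding the
    class \<open>{0, k}\<close> parametrizes \<open>B1\<close>; adding the two classes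
    \<open>{0}\<close> and \<open>{k}\<close> parametrizes the members of \<open>B0\<close> with a
    marked singleton \<open>{k}\<close>.\<close>
  let ?S = "SIGMA k:N - {0}. {Q. partition_on (N - {0, k}) Q}"
  let ?g = "\<lambda>(k, Q). eval_poly (qdfact (card Q)) ?Y * inverse (of_nat q) * ?W Q"
  have Q: "finite Q" "Q \<noteq> {}" "\<And>D. D \<in> Q \<Longrightarrow> 0 \<notin> D \<and> k \<notin> D"
    if k: "k \<in> N - {0}" and Q: "partition_on (N - {0, k}) Q" for k Q
  proof -
    show "finite Q" using finite_elements[OF _ Q] N(1) by simp
    show "0 \<notin> D \<and> k \<notin> D" if "D \<in> Q" for D using Q that by (auto simp: partition_on_def)
    \<comment> \<open>With at least three labels something remains beside 0 and \<open>k\<close>, so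
      that uniting these two still leaves two classes.\<close>
    have "N - {0, k} \<noteq> {}"
    proof
      assume "N - {0, k} = {}"
      then have "card N \<le> card {0, k}" by (intro card_mono) auto
      also have "\<dots> \<le> 2" by (simp add: card_insert_if)
      finally show False using N(3) by simp
    qed
    then show "Q \<noteq> {}" using Q by (auto simp: partition_on_def)
  qed
  have S1: "(\<Sum>P\<in>B1. eval_poly (qdfact (card P - 1)) ?Y * ?W P) = (\<Sum>p\<in>?S. ?g p)"
  proof (rule sum.reindex_bij_witness[where j = "\<lambda>P. (THE k.
      k \<noteq> 0 \<and> {0, k} \<in> P, P - {{0, THE k. k \<noteq> 0 \<and> {0, k} \<in> P}})"
        and i = "\<lambda>(k, Q). insert {0, k} Q"])
    fix P assume "P \<in> B1"
    then obtain k where k: "k \<noteq> 0" "{0, k} \<in> P" and P: "partition_on N P" by (auto simp: B1_def)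
    have the: "(THE k. k \<noteq> 0 \<and> {0, k} \<in> P) = k"
    proof (rule the_equality)
      show "k' = k" if "k' \<noteq> 0 \<and> {0, k'} \<in> P" for k'
        using uniq[OF P k(2), of "{0, k'}" 0] that k(1) by (auto simp: doubleton_eq_iff)
    qed (use k in simp)
    have ins: "insert {0, k} (P - {{0, k}}) = P" using k(2) by blast
    have "disjnt {0, k} (\<Union>(P - {{0, k}}))"
    proof -
      have "{0, k} \<inter> D = {}" if "D \<in> P - {{0, k}}" for D
        using uniq[OF P k(2), of D] that by blast
      then show ?thesis by (auto simp: disjnt_def)
    qed
    then have part: "partition_on (N - {0, k}) (P - {{0, k}})" "{0, k} \<subseteq> N"
      using partition_on_insert[of "{0, k}" "P - {{0, k}}" N] P ins by auto
    show "(case (THE k. k \<noteq> 0 \<and> {0, k} \<in> P, P - {{0, THE k. k \<noteq> 0 \<and> {0, k} \<in> P}}) of (k, Q) \<Rightarrow>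
        insert {0, k} Q) = P"
      unfolding the prod.case by (rule ins)
    show "(THE k. k \<noteq> 0 \<and> {0, k} \<in> P, P - {{0, THE k. k \<noteq> 0 \<and> {0, k} \<in> P}}) \<in> ?S"
      unfolding the using part k(1) by simp
    have "?W P = weight_B TypeD {0, k} * ?W (P - {{0, k}})" by (rule prod.remove[OF finP[OF P] k(2)])
    then show "?g (THE k. k \<noteq> 0 \<and> {0, k} \<in> P, P - {{0, THE k. k \<noteq> 0 \<and> {0, k} \<in> P}}) =
        eval_poly (qdfact (card P - 1)) ?Y * ?W P"
      unfolding the using weight_D_pair[OF k(1)] k(2) by simp
  next
    fix p assume "p \<in> ?S"
    then obtain k Q where "k \<in> N - {0}" "Q \<in> {Q. partition_on (N - {0, k}) Q}" "p = (k, Q)"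
      by (rule SigmaE)
    then have p: "p = (k, Q)" "k \<in> N - {0}" "partition_on (N - {0, k}) Q" by simp_all
    note Qp = Q[OF p(2,3)]
    have notin: "{0, k} \<notin> Q" using Qp(3) by blast
    have disjQ: "disjnt {0, k} (\<Union>Q)" using Qp(3) by (auto simp: disjnt_def)
    have P: "partition_on N (insert {0, k} Q)"
      using partition_on_insert[OF disjQ, of N] p N(2) by auto
    have the: "(THE k'. k' \<noteq> 0 \<and> {0, k'} \<in> insert {0, k} Q) = k"
      using p(2) Qp(3) by (intro the_equality) (auto simp: doubleton_eq_iff)
    show "(THE k'. k' \<noteq> 0 \<and> {0, k'} \<in> (case p of (k, Q) \<Rightarrow> insert {0, k} Q),
      (case p of (k, Q) \<Rightarrow> insert {0, k} Q) -
          {{0, THE k'. k' \<noteq> 0 \<and> {0, k'} \<in> (case p of (k, Q) \<Rightarrow> insert {0, k} Q)}}) = p"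
      unfolding p(1) prod.case the using notin by simp
    have "1 \<le> card Q" using Qp(1,2) by (simp add: Suc_le_eq card_gt_0_iff)
    then have "2 \<le> card (insert {0, k} Q)" using Qp(1) notin by simp
    then show "(case p of (k, Q) \<Rightarrow> insert {0, k} Q) \<in> B1" using P p(1,2) by (auto simp: B1_def)
  qed
  \<comment> \<open>The number of singletons minus one counts the ways of marking a singleton other
    than \<open>{0}\<close>.\<close>
  have S0: "(\<Sum>P\<in>B0. of_nat (card {D \<in> P. card D = 1} - 1) *
      (eval_poly (qdfact (card P - 2)) ?Y * inverse (of_nat q)) * ?W P) =
    (\<Sum>p\<in>?S. ?g p)"
  proof -
    have "(\<Sum>P\<in>B0. of_nat (card {D \<in> P. card D = 1} - 1) *
        (eval_poly (qdfact (card P - 2)) ?Y * inverse (of_nat q)) * ?W P) =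
      (\<Sum>P\<in>B0. \<Sum>k\<in>{k \<in> N - {0}. {k} \<in> P}. eval_poly (qdfact (card P - 2)) ?Y * inverse (of_nat q) * ?W P)"
    proof (rule sum.cong[OF refl])
      fix P assume P: "P \<in> B0"
      define K where "K = {k \<in> N - {0}. {k} \<in> P}"
      have part: "partition_on N P" "{0} \<in> P" using P by (simp_all add: B0_def)
      have eq: "{D \<in> P. card D = 1} = insert {0} ((\<lambda>k. {k}) ` K)"
      proof (intro equalityI subsetI)
        fix D assume D: "D \<in> {D \<in> P. card D = 1}"
        then have "card D = 1" by simp
        then obtain k where k: "D = {k}" by (rule card_1_singletonE)
        have "k \<in> N" using D k partition_onD1[OF part(1)] by blast
        then show "D \<in> insert {0} ((\<lambda>k. {k}) ` K)" using D k by (cases "k = 0") (auto simp: K_def)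
      qed (use part(2) in \<open>auto simp: K_def\<close>)
      have "finite K" using N(1) by (simp add: K_def)
      then have finK: "finite ((\<lambda>k. {k}) ` K)" by (rule finite_imageI)
      have notin: "{0} \<notin> (\<lambda>k. {k}) ` K" by (auto simp: K_def)
      have "card ((\<lambda>k. {k}) ` K) = card K" by (rule card_image) simp
      then have "card {D \<in> P. card D = 1} = Suc (card {k \<in> N - {0}. {k} \<in> P})"
        unfolding eq card_insert_disjoint[OF finK notin] by (simp only: K_def)
      then have "card {D \<in> P. card D = 1} - 1 = card {k \<in> N - {0}. {k} \<in> P}" by simp
      then show "of_nat (card {D \<in> P. card D = 1} - 1) *
          (eval_poly (qdfact (card P - 2)) ?Y * inverse (of_nat q)) * ?W P =
        (\<Sum>k\<in>{k \<in> N - {0}. {k} \<in> P}. eval_poly (qdfact (card P - 2)) ?Y * inverse (of_nat q) * ?W P)"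
        by (simp add: mult.assoc)
    qed
    also have "\<dots> = (\<Sum>(P, k)\<in>(SIGMA P:B0. {k \<in> N - {0}. {k} \<in> P}). eval_poly (qdfact (card P - 2)) ?Y *
        inverse (of_nat q) * ?W P)"
      using fin N(1) by (intro sum.Sigma) auto
    also have "\<dots> = (\<Sum>p\<in>?S. ?g p)"
    proof (rule sum.reindex_bij_witness[where j = "\<lambda>(P, k). (k, P - {{0}, {k}})"
          and i = "\<lambda>(k, Q). (insert {0} (insert {k} Q), k)"])
      fix x assume "x \<in> (SIGMA P:B0. {k \<in> N - {0}. {k} \<in> P})"
      then obtain P k where "P \<in> B0" "k \<in> {k \<in> N - {0}. {k} \<in> P}" "x = (P, k)" by (rule SigmaE)
      then have x: "x = (P, k)" "P \<in> B0" "k \<in> N - {0}" "{k} \<in> P" by simp_all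
      have P: "partition_on N P" "{0} \<in> P" using x(2) by (auto simp: B0_def)
      have eq: "insert {0} (insert {k} (P - {{0}, {k}})) = P" using P(2) x(4) by blast
      show "(\<lambda>(k, Q). (insert {0} (insert {k} Q), k)) ((\<lambda>(P, k). (k, P - {{0}, {k}})) x) = x"
        unfolding x(1) prod.case eq ..
      have k0: "{0} \<noteq> {k}" using x(3) by auto
      have d: "i \<notin> D" if "{i} \<in> P" "D \<in> P" "D \<noteq> {i}" for i D
        using uniq[OF P(1) that(1,2), of i] that(3) by auto
      have "partition_on (N - {0} - {k}) (P - {{0}, {k}})"
      proof -
        have d0: "disjnt {0} (\<Union>(insert {k} (P - {{0}, {k}})))"
          using d[OF P(2)] k0 x(4) by (auto simp: disjnt_def)
        have d1: "disjnt {k} (\<Union>(P - {{0}, {k}}))"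
          using d[OF x(4)] by (auto simp: disjnt_def)
        show ?thesis
          using partition_on_insert[OF d0, of N] partition_on_insert[OF d1, of "N - {0}"] P(1) eq by simp
      qed
      moreover have "N - {0} - {k} = N - {0, k}" by auto
      ultimately show "(\<lambda>(P, k). (k, P - {{0}, {k}})) x \<in> ?S" using x by simp
      have "?W P = weight_B TypeD {0} * (weight_B TypeD {k} * ?W (P - {{0}} - {{k}}))"
        using prod.remove[OF finP[OF P(1)] P(2), of "weight_B TypeD"]
          prod.remove[of "P - {{0}}" "{k}" "weight_B TypeD"] finP[OF P(1)] x(4) k0 by simp
      moreover have "P - {{0}} - {{k}} = P - {{0}, {k}}" by auto
      moreover have "card (P - {{0}, {k}}) = card P - 2"
        using finP[OF P(1)] P(2) x(4) k0 by (subst card_Diff_subset) auto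
      ultimately show "?g ((\<lambda>(P, k). (k, P - {{0}, {k}})) x) =
          (case x of (P, k) \<Rightarrow> eval_poly (qdfact (card P - 2)) ?Y * inverse (of_nat q) * ?W P)"
        using x weight_B_zero_singleton weight_B_singleton[of k] by simp
    next
      fix p assume "p \<in> ?S"
      then obtain k Q where "k \<in> N - {0}" "Q \<in> {Q. partition_on (N - {0, k}) Q}" "p = (k, Q)"
        by (rule SigmaE)
    then have p: "p = (k, Q)" "k \<in> N - {0}" "partition_on (N - {0, k}) Q" by simp_all
      note Qp = Q[OF p(2,3)]
      have notin: "{0} \<notin> Q" "{k} \<notin> Q" "{0} \<noteq> {k}" using Qp(3) p(2) by auto
      show "(\<lambda>(P, k). (k, P - {{0}, {k}})) ((\<lambda>(k, Q). (insert {0} (insert {k} Q), k)) p) = p"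
        using notin p(1) by auto
      have "disjnt {k} (\<Union>Q)" using Qp(3) by (auto simp: disjnt_def)
      moreover have "N - {0, k} = N - {0} - {k}" by auto
      ultimately have "partition_on (N - {0}) (insert {k} Q)"
        using partition_on_insert[of "{k}" Q "N - {0}"] p(2,3) by auto
      moreover have "disjnt {0} (\<Union>(insert {k} Q))" using Qp(3) notin(3) by (auto simp: disjnt_def)
      ultimately have P: "partition_on N (insert {0} (insert {k} Q))"
        using partition_on_insert[of "{0}" "insert {k} Q" N] N(2) by auto
      have "2 \<le> card (insert {0} (insert {k} Q))" using Qp(1) notin by (simp add: card_insert_if)
      then show "(\<lambda>(k, Q). (insert {0} (insert {k} Q), k)) p \<in> (SIGMA P:B0. {k \<in> N - {0}. {k} \<in> P})"
        using P p by (simp add: B0_def)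
    qed
    finally show ?thesis .
  qed
  have "(\<Sum>P\<in>?PP. eval_poly (root_poly TypeD P) ?Y * (\<Prod>D\<in>P.
      if 0 \<in> D \<and> card D = 2 then 0 else weight_B TypeD D)) =
    (\<Sum>P\<in>?PP. eval_poly (root_poly TypeD P) ?Y * (if P \<in> B1 then 0 else ?W P))"
    by (intro sum.cong[OF refl] arg_cong2[where f = "(*)", OF refl] prod_eq)
  also have "\<dots> = (\<Sum>P\<in>?PP - B0 - B1. eval_poly (qdfact (card P - 1)) ?Y * ?W P) +
      (\<Sum>P\<in>B0. eval_poly (root_poly TypeD P) ?Y * ?W P)"
  proof -
    have "(\<Sum>P\<in>?PP - B0 - B1. eval_poly (root_poly TypeD P) ?Y * (if P \<in> B1 then 0 else ?W P)) =
      (\<Sum>P\<in>?PP - B0 - B1. eval_poly (qdfact (card P - 1)) ?Y * ?W P)"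
      by (rule sum.cong) (auto simp: root_poly_def B0_def)
    moreover have "(\<Sum>P\<in>B0. eval_poly (root_poly TypeD P) ?Y * (if P \<in> B1 then 0 else ?W P)) =
      (\<Sum>P\<in>B0. eval_poly (root_poly TypeD P) ?Y * ?W P)"
      using disj by (intro sum.cong) auto
    moreover have "(\<Sum>P\<in>B1. eval_poly (root_poly TypeD P) ?Y * (if P \<in> B1 then 0 else ?W P)) = 0"
      by (rule sum.neutral) simp
    ultimately show ?thesis unfolding split by simp
  qed
  also have "(\<Sum>P\<in>B0. eval_poly (root_poly TypeD P) ?Y * ?W P) =
      (\<Sum>P\<in>B0. eval_poly (qdfact (card P - 1)) ?Y * ?W P) +
    (\<Sum>P\<in>B0. of_nat (card {D \<in> P. card D = 1} - 1) *
        (eval_poly (qdfact (card P - 2)) ?Y * inverse (of_nat q)) * ?W P)"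
    unfolding sum.distrib[symmetric]
  proof (rule sum.cong[OF refl])
    fix P assume "P \<in> B0"
    then have "partition_on N P" "2 \<le> card P" "{0} \<in> P" by (auto simp: B0_def)
    then show "eval_poly (root_poly TypeD P) ?Y * ?W P = eval_poly (qdfact (card P - 1)) ?Y * ?W P +
        of_nat (card {D \<in> P. card D = 1} - 1) *
            (eval_poly (qdfact (card P - 2)) ?Y * inverse (of_nat q)) * ?W P"
      using root_poly_D_diff[OF finP] by (simp add: distrib_right)
  qed
  also have "(\<Sum>P\<in>B0. of_nat (card {D \<in> P. card D = 1} - 1) *
      (eval_poly (qdfact (card P - 2)) ?Y * inverse (of_nat q)) * ?W P) =
    (\<Sum>P\<in>B1. eval_poly (qdfact (card P - 1)) ?Y * ?W P)" unfolding S0 S1 ..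
  finally show ?thesis unfolding split by (simp only: add.assoc)
qed

end

lemma vweight_standard_trees:
  assumes "t \<in> standard_trees X C" "0 \<in> C"
  shows "vweight X Z T t = Z ^ (card C - 1) * (\<Prod>L\<in>zero_forms X C. T L)"
  using assms tree_nums[of C t] by (simp add: standard_trees_def vweight_def vforms_def)

lemma standard_trees_zero: "standard_trees X {0} = {zero_leaf}"
proof -
  have ml: "min_label (Leaf (Label 0 b)) = Label 0 b" for b
    using min_label[of "{0}" "Leaf (Label 0 b)"] by (simp add: tree_Leaf_iff sgn_of_def)
  show ?thesis
  proof (intro equalityI subsetI)
    fix t assume t: "t \<in> standard_trees X {0}"
    then obtain b where "t = Leaf (Label 0 b)" using tree_singleton by (auto simp: standard_trees_def)
    then show "t \<in> {zero_leaf}" using t ml by (simp add: standard_trees_def)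
  qed (simp add: standard_trees_def tree_Leaf_iff ml admissible_def)
qed

section \<open>Sums over standard trees containing the label 0\<close>

context haar_zeta
begin

text \<open>The label 0 is counted in \<open>C\<close> but is no coordinate, so the exponent is
  again one less than the number of labels.\<close>

lemma block_zeta_zero_forms:
  assumes "finite C" "0 \<in> C"
  shows "block_zeta (C - {0}) (zero_forms X C) =
      inverse (of_nat q) ^ (card C - 1) * (\<Prod>L\<in>zero_forms X C. form_weight L) *
      zeta_int (C - {0}) (zero_forms X C)"
  using assms by (simp add: block_zeta_def)

text \<open>The induction of \<open>sum_signed_trees\<close>, now with the recursion
  \<open>zeta_int_B\<close>; classes avoiding 0 are already settled. In type D a class
  \<open>{0, k}\<close> carries no admissible tree although its weight is \<open>1 / q\<close>, and
  \<open>sum_partitions_D\<close> makes up for this by the polynomial at the root.\<close>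

lemma sum_standard_trees:
  assumes odd: "odd q" and "finite C" "0 \<in> C" "X = TypeD \<Longrightarrow> card C \<noteq> 2"
  shows "(\<Sum>t\<in>standard_trees X C. subtree_term X t) = weight_B X C"
    and "2 \<le> card C \<Longrightarrow> (\<Sum>t\<in>standard_trees X C. tree_term X t) =
      (1 - inverse (of_nat q) ^ (card C - 1) * (\<Prod>L\<in>zero_forms X C. form_weight L)) *
          zeta_int (C - {0}) (zero_forms X C)"
proof -
  have "(\<Sum>t\<in>standard_trees X C. subtree_term X t) = weight_B X C \<and>
      (2 \<le> card C \<longrightarrow> (\<Sum>t\<in>standard_trees X C. tree_term X t) =
      (1 - inverse (of_nat q) ^ (card C - 1) * (\<Prod>L\<in>zero_forms X C. form_weight L)) *
          zeta_int (C - {0}) (zero_forms X C))"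
    using assms(2-)
  proof (induction C rule: measure_induct_rule[where f = card])
    case (less C)
    let ?Y = "- inverse (of_nat q) :: complex"
    let ?w = "inverse (of_nat q) ^ (card C - 1) * (\<Prod>L\<in>zero_forms X C. form_weight L)"
    let ?Z = "zeta_int (C - {0}) (zero_forms X C)"
    let ?PP = "{P. partition_on C P \<and> 2 \<le> card P}"
    have ne: "C \<noteq> {}" using less.prems(2) by blast
    have weight: "weight_B X C = ?w * ?Z"
      using block_zeta_zero_forms[OF less.prems(1,2)] less.prems(2) by (simp add: weight_B_def)
    show ?case
    proof (cases "2 \<le> card C")
      case False
      have "card C \<noteq> 0" using less.prems(1) ne by simp
      then have "card C = 1" using False by linarith
      then obtain k where "C = {k}" by (rule card_1_singletonE)
      then have "C = {0}" using less.prems(2) by simp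
      then show ?thesis by (simp add: standard_trees_zero weight_B_zero_singleton)
    next
      case True
      have "(\<Sum>t\<in>standard_trees X C. tree_term X t) =
          (\<Sum>P\<in>?PP. eval_poly (root_poly X P) ?Y * (\<Prod>D\<in>P. \<Sum>v\<in>standard_trees X D. subtree_term X v))"
      proof (rule sum_trees[OF less.prems(1), where T = "standard_trees X"])
        show "tree D t" if "t \<in> standard_trees X D" for D t using that by (simp add: standard_trees_def)
        show "finite (standard_trees X D)" for D by (rule finite_standard_trees)
        show iff: "t \<in> standard_trees X C \<longleftrightarrow>
            (\<exists>ts. t = Node ts \<and> tree C (Node ts) \<and> (\<forall>v\<in>#ts. v \<in> standard_trees X (nums v)))" for t
          by (rule standard_trees_Node[OF less.prems(2) True less.prems(3)])
        fix ts assume ts: "Node ts \<in> standard_trees X C"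
        then have tr: "tree C (Node ts)" by (simp add: standard_trees_def)
        have "\<not> barred (min_label v)" if "v \<in># ts" for v using ts iff that
          by (auto simp: standard_trees_def)
        then show "tree_term X (Node ts) =
            eval_poly (root_poly X (nums ` set_mset ts)) ?Y * (\<Prod>v\<in>set_mset ts. subtree_term X v)"
          unfolding tree_term_Node[OF tr] using vpoly_root_poly[OF tr less.prems(2)] by simp
      qed
      also have "\<dots> = (\<Sum>P\<in>?PP. eval_poly (root_poly X P) ?Y *
          (\<Prod>D\<in>P. if X = TypeD \<and> 0 \<in> D \<and> card D = 2 then 0 else weight_B X D))"
      proof (intro sum.cong[OF refl] arg_cong2[where f = "(*)", OF refl] prod.cong[OF refl])
        fix P D assume P: "P \<in> ?PP" and D: "D \<in> P"
        have D': "D \<noteq> {}" "finite D"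
          using finite_partition_element[OF less.prems(1)] P D by (auto simp: partition_on_def)
        show "(\<Sum>v\<in>standard_trees X D. subtree_term X v) =
            (if X = TypeD \<and> 0 \<in> D \<and> card D = 2 then 0 else weight_B X D)"
        proof (cases "0 \<in> D")
          case False
          then show ?thesis using sum_standard_trees_nonzero[OF D'(2,1)] by simp
        next
          case zero: True
          show ?thesis
          proof (cases "X = TypeD \<and> card D = 2")
            case True
            have "standard_trees X D = {}"
            proof (rule ccontr)
              assume "standard_trees X D \<noteq> {}"
              then obtain t where t: "tree D t" "admissible X t" by (auto simp: standard_trees_def)
              then show False
                using tree_nums[OF t(1)] zero True vertices_self[of t] unfolding admissible_def by blast
            qed
            then show ?thesis using zero True by simp
          next
            case False
            then show ?thesis
              using less.IH[of D] partition_block_less[OF less.prems(1)] P D D'(2) zero by auto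
          qed
        qed
      qed
      also have "\<dots> = (\<Sum>P\<in>?PP. eval_poly (qdfact (card P - 1)) ?Y * (\<Prod>D\<in>P. weight_B X D))"
      proof (cases "X = TypeD")
        case D: True
        then have "3 \<le> card C" using less.prems(3) True by linarith
        from sum_partitions_D[OF less.prems(1,2) this] show ?thesis unfolding D by simp
      qed (simp add: root_poly_def)
      also have "\<dots> = ?Z - weight_B X C"
      proof -
        have "?Z = eval_poly (qdfact (card {C} - 1)) ?Y * (\<Prod>D\<in>{C}. weight_B X D) +
          (\<Sum>P\<in>?PP. eval_poly (qdfact (card P - 1)) ?Y * (\<Prod>D\<in>P. weight_B X D))"
          unfolding zeta_int_B[OF odd less.prems(1,2)] partitions_split[OF less.prems(1) ne]
          using finite_partitions[OF less.prems(1)]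
          by (intro sum.insert) (auto intro: finite_subset[rotated])
        then show ?thesis by (simp add: eval_poly_qdfact)
      qed
      also have "\<dots> = (1 - ?w) * ?Z" unfolding weight by (simp add: algebra_simps)
      finally have F: "(\<Sum>t\<in>standard_trees X C. tree_term X t) = (1 - ?w) * ?Z" .
      have "(\<Sum>t\<in>standard_trees X C. subtree_term X t) = (\<Sum>t\<in>standard_trees X C. gp ?w * tree_term X t)"
      proof (rule sum.cong[OF refl])
        fix t assume t: "t \<in> standard_trees X C"
        then obtain ts where "t = Node ts" "tree C (Node ts)"
          using standard_trees_Node[OF less.prems(2) True less.prems(3)] by blast
        then show "subtree_term X t = gp ?w * tree_term X t"
          using subtree_term_Node vweight_standard_trees[OF t less.prems(2)] by simp
      qed
      also have "\<dots> = gp ?w * ((1 - ?w) * ?Z)" unfolding sum_distrib_left[symmetric] F ..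
      also have "\<dots> = ?w * ?Z" using True by (intro gp_cancel weight_ne_1) simp
      finally show ?thesis using F weight by simp
    qed
  qed
  then show "(\<Sum>t\<in>standard_trees X C. subtree_term X t) = weight_B X C"
    "2 \<le> card C \<Longrightarrow> (\<Sum>t\<in>standard_trees X C. tree_term X t) =
      (1 - inverse (of_nat q) ^ (card C - 1) * (\<Prod>L\<in>zero_forms X C. form_weight L)) *
          zeta_int (C - {0}) (zero_forms X C)" by blast+
qed

end

section \<open>Total partitions\<close>

lemma labelled_by_iff:
  "finite N \<Longrightarrow> labelled_by N t \<and> (\<forall>u\<in>parents t. 2 \<le> num_children u) \<longleftrightarrow> tree N t"
  by (auto simp: labelled_by_def tree_def branching_def)

text \<open>No leaf carries the label 0, so standard form is vacuous in type A.\<close>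

lemma total_partitions_A: "total_partitions TypeA n = signed_trees {1..n + 1} (\<lambda>_. False)"
proof -
  have std: "standard_form t" if "tree {1..n + 1} t" for t
  proof -
    have "zero_leaf \<notin> vertices u" if "u \<in> vertices t" for u
      using nums_vertex[OF vertices_trans[OF that], of zero_leaf] tree_nums[OF \<open>tree _ t\<close>] by auto
    then have "ancestors t zero_leaf = {}" by (auto simp: ancestors_def descendants_def)
    then show ?thesis by (simp add: standard_form_def)
  qed
  show ?thesis
    unfolding total_partitions_def signed_trees_def using labelled_by_iff[of "{1..n + 1}"] std by auto
qed

lemma plain_iff_min_label:
  assumes t: "tree N t" "0 \<in> N"
  shows "zero_plain t \<longleftrightarrow> \<not> barred (min_label t)"
proof -
  have N: "nums t = N" "finite N" using tree_nums[OF t(1)] t(1) by (simp_all add: tree_def)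
  have "Min (nums t) = 0" using N t(2) by (metis Min_le bot_nat_0.extremum_unique)
  then have ml: "barred (min_label t) = sgn_of t 0" using min_label[OF t(1)] by simp
  have "Label 0 (sgn_of t 0) \<in># leaf_labels t" using label_mem_iff[OF t(1)] N t(2) by simp
  then show ?thesis
    unfolding ml zero_plain_def using barred_sgn_of[OF t(1)] by force
qed

lemma sum_card_blocks:
  assumes "tree N (Node us)"
  shows "(\<Sum>D\<in>nums ` set_mset us. card D) = card N"
proof -
  have P: "partition_on N (nums ` set_mset us)" by (rule tree_partition(1)[OF assms])
  have "card (\<Union>(nums ` set_mset us)) = (\<Sum>D\<in>nums ` set_mset us. card D)"
    using partition_onD2[OF P] finite_nums by (intro card_Union_disjoint) auto
  then show ?thesis unfolding partition_onD1[OF P, symmetric] by simp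
qed

text \<open>If all children of the parent \<open>v\<close> of the leaf 0 are unbranched, it has as
  many children as labels; there are at least two, and exactly two only if \<open>v\<close> has two
  labels. Conversely, a vertex with two labels, one of them 0, has two leaves as children and
  therefore is \<open>v\<close>.\<close>

lemma type_D_condition:
  assumes t: "tree N t" "zero_plain t" "0 \<in> N" "2 \<le> card N"
  shows "(let v = first_branching t zero_leaf in (\<forall>u\<in>#children v. unbranched u) \<longrightarrow> 3 \<le> num_children v) \<longleftrightarrow>
    (\<forall>u\<in>vertices t. 0 \<in> nums u \<longrightarrow> card (nums u) \<noteq> 2)"
proof -
  have "zero_leaf \<in> vertices t" using zero_mem_iff[OF t(2) vertices_self] tree_nums[OF t(1)] t(3) by simp
  moreover have "t \<noteq> zero_leaf"
  proof
    assume "t = zero_leaf"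
    then have "N = {0}" using tree_nums[OF t(1)] by simp
    then show False using t(4) by simp
  qed
  ultimately have "\<exists>u\<in>parents t. zero_leaf \<in># children u" by (rule leaf_parent_exists)
  then obtain v where v: "v \<in> parents t" "zero_leaf \<in># children v" by (elim bexE)
  have fb: "first_branching t zero_leaf = v" by (rule first_branching_eq[OF t(1,2) v])
  obtain vs where vs: "v = Node vs" using v(2) by (cases v) auto
  have vt: "v \<in> vertices t" using v(1) by (simp add: parents_def)
  have tv: "tree (nums v) (Node vs)" using tree_vertex[OF t(1) vt] vs by simp
  have v0: "0 \<in> nums v" using v(2) vs by (auto simp: nums_Node intro!: bexI[of _ zero_leaf])
  show ?thesis
  proof
    assume cond: "let v = first_branching t zero_leaf in (\<forall>u\<in>#children v. unbranched u) \<longrightarrow>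
        3 \<le> num_children v"
    show "\<forall>u\<in>vertices t. 0 \<in> nums u \<longrightarrow> card (nums u) \<noteq> 2"
    proof (intro ballI impI notI)
      fix u assume u: "u \<in> vertices t" "0 \<in> nums u" "card (nums u) = 2"
      note tu = tree_vertex[OF t(1) u(1)]
      obtain us where us: "u = Node us" using tree_not_Leaf[OF tu] u(3) by auto
      have tu': "tree (nums u) (Node us)" using tu us by simp
      let ?P = "nums ` set_mset us"
      have cP: "2 \<le> card ?P" using tree_partition(3)[OF tu'] tu' by (simp add: tree_def branching_Node)
      have ge1: "1 \<le> card D" if "D \<in> ?P" for D
        using that nums_ne tree_children(1)[OF tu'] finite_nums
        by (auto simp: tree_def Suc_le_eq card_gt_0_iff)
      have total: "(\<Sum>D\<in>?P. card D) = 2" using sum_card_blocks[OF tu'] u(3) by simp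
      \<comment> \<open>There are at least two blocks, each of size at least 1, and their sizes add
        up to 2.\<close>
      have one: "card D = 1" if D: "D \<in> ?P" for D
      proof -
        have "(\<Sum>D\<in>?P. card D) = card D + (\<Sum>E\<in>?P - {D}. card E)"
          using D by (intro sum.remove) auto
        moreover have "card (?P - {D}) \<le> (\<Sum>E\<in>?P - {D}. card E)"
          using sum_mono[of "?P - {D}" "\<lambda>_. 1" card] ge1 by simp
        moreover have "card (?P - {D}) = card ?P - 1" using D by simp
        ultimately show ?thesis using total cP ge1[OF D] by linarith
      qed
      then have "(\<Sum>D\<in>?P. card D) = card ?P" by simp
      then have two: "num_children u = 2" using total num_children_eq[OF tu'] us by simp
      have unb: "\<forall>w\<in>#children u. unbranched w"
        using one unbranched_iff[OF tree_children(1)[OF tu']] us by auto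
      obtain w where w: "w \<in># us" "0 \<in> nums w" using u(2) us by (auto simp: nums_Node)
      then have "card (nums w) = 1" using one by blast
      then obtain k where "nums w = {k}" by (rule card_1_singletonE)
      then have tw: "tree {0} w" using tree_children(1)[OF tu' w(1)] w(2) by simp
      obtain b where b: "w = Leaf (Label 0 b)" using tree_singleton[OF tw] .
      have "w \<in> vertices u" using w(1) us vertices_self[of w] by auto
      then have "Label 0 b \<in># leaf_labels t" using vertices_trans[OF u(1)] b
        by (simp add: label_iff_vertex)
      then have "\<not> b" using t(2) by (force simp: zero_plain_def)
      then have "zero_leaf \<in># children u" using b w(1) us by simp
      moreover have "u \<in> parents t" using u(1) us w(1) by (auto simp: parents_def)
      ultimately have "first_branching t zero_leaf = u" by (intro first_branching_eq[OF t(1,2)])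
      then show False using cond unb two by (simp add: Let_def)
    qed
  next
    assume no2: "\<forall>u\<in>vertices t. 0 \<in> nums u \<longrightarrow> card (nums u) \<noteq> 2"
    show "let v = first_branching t zero_leaf in (\<forall>u\<in>#children v. unbranched u) \<longrightarrow> 3 \<le> num_children v"
      unfolding Let_def fb
    proof
      assume unb: "\<forall>u\<in>#children v. unbranched u"
      have "card D = 1" if "D \<in> nums ` set_mset vs" for D
        using that unb unbranched_iff[OF tree_children(1)[OF tv]] vs by auto
      then have "card (nums v) = card (nums ` set_mset vs)" using sum_card_blocks[OF tv] by simp
      then have "card (nums v) = num_children v" using num_children_eq[OF tv] vs by simp
      moreover have "2 \<le> num_children v" using tv vs
        by (simp add: tree_def branching_Node num_children_def)
      moreover have "card (nums v) \<noteq> 2" using no2 vt v0 by blast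
      ultimately show "3 \<le> num_children v" by linarith
    qed
  qed
qed

text \<open>That the minimal label at the root is unbarred expresses the convention that 0 carries
  no bar. The other conditions are matched vertex by vertex by means of
  \<open>ancestors_zero\<close> and \<open>type_D_condition\<close>.\<close>

lemma total_partitions_B:
  assumes X: "X \<noteq> TypeA" and n: "1 \<le> n"
  shows "total_partitions X n = standard_trees X {0..n}"
proof -
  let ?N = "{0..n}"
  have N: "0 \<in> ?N" "2 \<le> card ?N" using n by auto
  have std: "standard_form t \<longleftrightarrow> (\<forall>u\<in>vertices t. 0 \<in> nums u \<longrightarrow> (\<forall>v\<in>#children u. \<not> barred (min_label v)))"
    if t: "tree ?N t" "zero_plain t" for t
    unfolding standard_form_def ancestors_zero[OF t] parents_def by auto
  have admissible: "admissible X t \<longleftrightarrow> standard_form t \<and> (X = TypeD \<longrightarrow>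
      (let v = first_branching t zero_leaf in (\<forall>u\<in>#children v. unbranched u) \<longrightarrow> 3 \<le> num_children v))"
    if t: "tree ?N t" "zero_plain t" for t
    unfolding std[OF t] type_D_condition[OF t N] admissible_def by blast
  have "t \<in> total_partitions X n \<longleftrightarrow> tree ?N t \<and> zero_plain t \<and> standard_form t \<and> (X = TypeD \<longrightarrow>
      (let v = first_branching t zero_leaf
          in (\<forall>u\<in>#children v. unbranched u) \<longrightarrow> 3 \<le> num_children v))" for t
    using X labelled_by_iff[of ?N t] unfolding total_partitions_def zero_plain_def
    by (cases X) (auto simp: B_labelled_def)
  moreover have "t \<in> standard_trees X ?N \<longleftrightarrow> tree ?N t \<and> zero_plain t \<and> admissible X t" for t
    using plain_iff_min_label[of ?N t] N(1) by (auto simp: standard_trees_def)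
  ultimately show ?thesis using admissible by blast
qed

section \<open>The arrangements\<close>

lemma arrangement_A: "arrangement TypeA n = signed_forms {1..n + 1} (\<lambda>_. False)"
proof (intro equalityI subsetI)
  fix L assume "L \<in> arrangement TypeA n"
  then obtain i j where "1 \<le> i" "i < j" "j \<le> n + 1" "L = pair_form 1 i j" by auto
  then show "L \<in> signed_forms {1..n + 1} (\<lambda>_. False)" unfolding signed_forms_iff
    by (intro exI[of _ i] exI[of _ j]) simp
next
  fix L assume "L \<in> signed_forms {1..n + 1} (\<lambda>_. False)"
  then show "L \<in> arrangement TypeA n" unfolding signed_forms_iff by auto
qed

lemma arrangement_BD:
  assumes "X \<noteq> TypeA"
  shows "arrangement X n = zero_forms X {0..n}"
proof -
  have "{0..n} - {0} = {1..n}" by auto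
  moreover have "{pair_form \<epsilon> i j |\<epsilon> i j. 1 \<le> i \<and> i < j \<and> j \<le> n \<and> \<epsilon> \<in> {1, -1}} =
      (\<lambda>(\<epsilon>, i, j). pair_form \<epsilon> i j) ` ({1, -1} \<times> {(i, j). i \<in> {1..n} \<and> j \<in> {1..n} \<and> i < j})"
    (is "?A = ?B")
  proof (intro equalityI subsetI)
    fix L assume "L \<in> ?A"
    then obtain \<epsilon> i j where "1 \<le> i" "i < j" "j \<le> n" "\<epsilon> \<in> {1, -1}" "L = pair_form \<epsilon> i j" by blast
    then show "L \<in> ?B" by (intro image_eqI[of _ _ "(\<epsilon>, i, j)"]) auto
  next
    fix L assume "L \<in> ?B"
    then obtain x where x: "L = (\<lambda>(\<epsilon>, i, j). pair_form \<epsilon> i j) x"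
      "x \<in> {1, -1} \<times> {(i, j). i \<in> {1..n} \<and> j \<in> {1..n} \<and> i < j}" by (rule imageE)
    obtain \<epsilon> i j where "x = (\<epsilon>, i, j)" by (rule prod_cases3)
    then have "1 \<le> i \<and> i < j \<and> j \<le> n \<and> \<epsilon> \<in> {1, -1}" "L = pair_form \<epsilon> i j" using x by simp_all
    then show "L \<in> ?A" by blast
  qed
  ultimately show ?thesis using assms unfolding zero_forms_def by (cases X) simp_all
qed

lemma signed_forms_subset_zero_forms: "0 \<notin> C \<Longrightarrow> C \<subseteq> N \<Longrightarrow> signed_forms C \<sigma> \<subseteq> zero_forms X N"
proof
  fix L assume C: "0 \<notin> C" "C \<subseteq> N" and "L \<in> signed_forms C \<sigma>"
  then obtain i j where ij: "i \<in> C" "j \<in> C" "i < j" "L = pair_form (if \<sigma> i = \<sigma> j then 1 else -1) i j"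
    unfolding signed_forms_iff by blast
  have "i \<noteq> 0" "j \<noteq> 0" using ij C(1) by metis+
  then have "i \<in> N - {0}" "j \<in> N - {0}" using ij(1,2) C(2) by blast+
  moreover have "(if \<sigma> i = \<sigma> j then 1 else -1) \<in> {1, -1::int}" by simp
  ultimately show "L \<in> zero_forms X N" unfolding zero_forms_iff using ij(3,4) by blast
qed

lemma zero_forms_mono: "C \<subseteq> N \<Longrightarrow> zero_forms X C \<subseteq> zero_forms X N"
  unfolding subset_iff zero_forms_iff by blast

lemma signed_forms_mono: "C \<subseteq> N \<Longrightarrow> signed_forms C \<sigma> \<subseteq> signed_forms N \<sigma>"
  unfolding subset_iff signed_forms_iff by blast

lemma complex_powr_neg_sum:
  assumes "0 < q" "finite F"
  shows "of_nat q powr (- of_nat n - (\<Sum>L\<in>F. s L)) =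
      inverse (of_nat q :: complex) ^ n * (\<Prod>L\<in>F. of_nat q powr (- s L))"
proof -
  have sum: "of_nat q powr (\<Sum>L\<in>F. f L :: complex) = (\<Prod>L\<in>F. of_nat q powr f L)" for f
    using assms(2) by (induction F rule: finite_induct) (use assms(1) in \<open>simp_all add: powr_add\<close>)
  have "of_nat q powr (- of_nat n - (\<Sum>L\<in>F. s L)) =
      of_nat q powr (- of_nat n) * of_nat q powr (\<Sum>L\<in>F. - s L :: complex)"
    by (simp add: powr_add[symmetric] sum_negf)
  also have "of_nat q powr (- of_nat n :: complex) = inverse (of_nat q) ^ n"
    using assms(1) by (simp add: powr_minus powr_nat power_inverse)
  also have "of_nat q powr (\<Sum>L\<in>F. - s L :: complex) = (\<Prod>L\<in>F. of_nat q powr (- s L))" by (rule sum)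
  finally show ?thesis .
qed

theorem theorem3:
  fixes \<mu> :: "'o::compact_dvr measure"
    and X :: arr_type
    and n q :: nat
    and s :: "linform \<Rightarrow> complex"
  assumes "1 \<le> n"
    and "X = TypeD \<Longrightarrow> 2 \<le> n"
    and "q = residue_card TYPE('o)"
    and "X \<noteq> TypeA \<Longrightarrow> odd q"
    and "normalized_haar \<mu>"
    and "\<And>L. L \<in> arrangement X n \<Longrightarrow> 0 \<le> Re (s L)"
  shows "atom_zeta \<mu> X n s =
    1 / (1 - of_nat q powr (- of_nat n - (\<Sum>L\<in>arrangement X n. s L))) *
    (\<Sum>t\<in>total_partitions X n.
       poly (map_poly of_int (tree_poly X t)) (- inverse (of_nat q)) *
       cgp X t (inverse (of_nat q)) (\<lambda>L. of_nat q powr (- s L)))"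
proof -
  let ?A = "arrangement X n"
  let ?T = "\<lambda>L. of_nat q powr (- s L) :: complex"
  \<comment> \<open>Outside the arrangement the exponents are set to 0, because the locale asks for
    a nonnegative real part at every form.\<close>
  define s' where "s' L = (if L \<in> ?A then s L else 0)" for L
  interpret haar_zeta \<mu> q s'
    by unfold_locales (use assms(3,5,6) in \<open>auto simp: s'_def\<close>)
  have T: "form_weight L = ?T L" if "L \<in> ?A" for L using that by (simp add: form_weight_def s'_def)
  let ?I = "{1..arr_dim X n}"
  \<comment> \<open>The weight that the root would have; it equals \<open>q\<close> to the power of
    minus \<open>n\<close> minus the sum of the exponents.\<close>
  let ?w = "inverse (of_nat q) ^ n * (\<Prod>L\<in>?A. form_weight L)"
  have sup: "supported ?I ?A"
  proof (cases "X = TypeA")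
    case True
    then show ?thesis using supported_signed_forms[of "{1..n + 1}"]
      by (simp only: arrangement_A arr_dim.simps finite_atLeastAtMost)
  next
    case False
    have "{0..n} - {0} = {1..n}" by auto
    moreover have "arr_dim X n = n" using False by (cases X) auto
    ultimately show ?thesis using supported_zero_forms[of "{0..n}" X] unfolding arrangement_BD[OF False]
      by simp
  qed
  have zeta: "atom_zeta \<mu> X n s = zeta_int ?I ?A"
  proof -
    have "eval_form (arr_dim X n) L x = leval L x" if "L \<in> ?A" for L and x :: "nat \<Rightarrow> 'o"
      using sup that by (intro eval_form_eq_leval) (auto simp: supported_def)
    then show ?thesis
      unfolding atom_zeta_def zeta_int_def form_prod_def
      by (intro Bochner_Integration.integral_cong[OF refl] prod.cong[OF refl]) (simp add: s'_def)
  qed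
  \<comment> \<open>The forms at every vertex belong to the arrangement, where \<open>s'\<close>
    agrees with \<open>s\<close>; so the given weights may be replaced by
    \<open>form_weight\<close>.\<close>
  have summand: "poly (map_poly of_int (tree_poly X t)) (- inverse (of_nat q)) *
      cgp X t (inverse (of_nat q)) ?T = tree_term X t"
    if t: "tree N t" "zero_plain t" and XA: "X = TypeA \<Longrightarrow> 0 \<notin> N \<and> (\<forall>l\<in>#leaf_labels t. \<not> barred l)"
      and poly: "tree_poly X t = (\<Prod>u\<in>parents t. vpoly X u)"
      and forms: "\<And>u. u \<in> vertices t \<Longrightarrow> vforms X u \<subseteq> ?A" for N t
  proof -
    have "vweight X (inverse (of_nat q)) ?T u = vweight X (inverse (of_nat q)) form_weight u"
        if "u \<in> parents t" for u
      using forms[of u] that T unfolding vweight_def parents_def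
      by (intro arg_cong2[where f = "(*)", OF refl] prod.cong) auto
    moreover have "cgp X t (inverse (of_nat q)) ?T =
        (\<Prod>u\<in>parents t - {t}. gp (vweight X (inverse (of_nat q)) ?T u))"
      by (rule cgp_eq[OF t]) (rule XA)
    ultimately have "cgp X t (inverse (of_nat q)) ?T =
        (\<Prod>u\<in>parents t - {t}. gp (vweight X (inverse (of_nat q)) form_weight u))"
      by simp
    moreover have "poly (map_poly of_int (tree_poly X t)) (- inverse (of_nat q) :: complex) =
        (\<Prod>u\<in>parents t. eval_poly (vpoly X u) (- inverse (of_nat q)))"
      unfolding poly eval_poly_prod[symmetric] by (simp add: eval_poly_def)
    ultimately show ?thesis unfolding tree_term_def by simp
  qed
  have "(\<Sum>t\<in>total_partitions X n. poly (map_poly of_int (tree_poly X t)) (- inverse (of_nat q)) *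
      cgp X t (inverse (of_nat q)) ?T) = (1 - ?w) * zeta_int ?I ?A"
  proof (cases "X = TypeA")
    case A: True
    let ?N = "{1..n + 1}"
    let ?\<sigma> = "\<lambda>_. False"
    have "(\<Sum>t\<in>total_partitions X n. poly (map_poly of_int (tree_poly X t)) (- inverse (of_nat q)) *
        cgp X t (inverse (of_nat q)) ?T) = (\<Sum>t\<in>signed_trees ?N ?\<sigma>. tree_term X t)"
      unfolding A total_partitions_A
    proof (rule sum.cong[OF refl], rule summand[unfolded A])
      fix t assume "t \<in> signed_trees ?N ?\<sigma>"
      then have t: "tree ?N t" "\<And>l. l \<in># leaf_labels t \<Longrightarrow> \<not> barred l" by (auto simp: signed_trees_def)
      show "tree ?N t" "zero_plain t" using t by (simp_all add: zero_plain_def)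
      show "0 \<notin> ?N \<and> (\<forall>l\<in>#leaf_labels t. \<not> barred l)" using t(2) by simp
      show "tree_poly TypeA t = (\<Prod>u\<in>parents t. vpoly TypeA u)" using pi_A_eq[OF t(1)] by simp
      fix u assume u: "u \<in> vertices t"
      have "\<not> sgn_of u i" for i
        using t(2) leaf_labels_vertex[OF u] unfolding sgn_of_def by fastforce
      then have "signed_forms (nums u) (sgn_of u) = signed_forms (nums u) ?\<sigma>"
        by (intro signed_forms_cong) simp
      moreover have sub: "nums u \<subseteq> ?N" using nums_vertex[OF u] tree_nums[OF t(1)] by simp
      ultimately have "signed_forms (nums u) (sgn_of u) \<subseteq> arrangement TypeA n"
        unfolding arrangement_A using signed_forms_mono by metis
      moreover have "0 \<notin> nums u" using sub by auto
      ultimately show "vforms TypeA u \<subseteq> arrangement TypeA n" by (simp add: vforms_def)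
    qed
    \<comment> \<open>The labels 1 to \<open>n + 1\<close> give the exponent \<open>n\<close>, just
      as the labels 0 to \<open>n\<close> do in the other types.\<close>
    also have "\<dots> = (1 - ?w) * zeta_int ?I ?A"
      using sum_signed_trees(2)[where C = ?N and \<sigma> = ?\<sigma> and X = X] assms(1) unfolding A arrangement_A
      by simp
    finally show ?thesis .
  next
    case False
    let ?N = "{0..n}"
    have I: "?N - {0} = ?I" using False by (cases X) auto
    have N: "finite ?N" "0 \<in> ?N" "2 \<le> card ?N" using assms(1) by auto
    have "(\<Sum>t\<in>total_partitions X n. poly (map_poly of_int (tree_poly X t)) (- inverse (of_nat q)) *
        cgp X t (inverse (of_nat q)) ?T) = (\<Sum>t\<in>standard_trees X ?N. tree_term X t)"
      unfolding total_partitions_B[OF False assms(1)]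
    proof (rule sum.cong[OF refl], rule summand)
      fix t assume "t \<in> standard_trees X ?N"
      then show t: "tree ?N t" "zero_plain t"
        using plain_iff_min_label[of ?N t] N(2) by (auto simp: standard_trees_def)
      show "tree_poly X t = (\<Prod>u\<in>parents t. vpoly X u)"
        using False pi_B_eq[OF t] pi_D_eq[OF t N(2,3)] by (cases X) simp_all
      show "0 \<notin> ?N \<and> (\<forall>l\<in>#leaf_labels t. \<not> barred l)" if "X = TypeA" using that False by simp
      fix u assume u: "u \<in> vertices t"
      have sub: "nums u \<subseteq> ?N" using nums_vertex[OF u] tree_nums[OF t(1)] by simp
      show "vforms X u \<subseteq> ?A"
        unfolding arrangement_BD[OF False] vforms_def
        using zero_forms_mono[OF sub] signed_forms_subset_zero_forms[OF _ sub] by simp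
    qed
    also have "\<dots> = (1 - ?w) * zeta_int (?N - {0}) ?A"
      using sum_standard_trees(2)[where C = ?N and X = X] assms(2,4) False N
      unfolding arrangement_BD[OF False] by fastforce
    finally show ?thesis unfolding I .
  qed
  moreover have "?w \<noteq> 1" by (rule weight_ne_1[OF assms(1)])
  moreover have "of_nat q powr (- of_nat n - (\<Sum>L\<in>?A. s L)) = ?w"
  proof -
    have "of_nat q powr (- of_nat n - (\<Sum>L\<in>?A. s L)) = inverse (of_nat q) ^ n * (\<Prod>L\<in>?A. ?T L)"
      using sup q_pos by (intro complex_powr_neg_sum) (auto simp: supported_def)
    then show ?thesis using T by simp
  qed
  ultimately show ?thesis unfolding zeta by simp
qed

end
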